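(* Let $P$ be a right prism with a tiling polygon as base. Consider the natural coding on this billiard table and let $\omega$ be a minimal and $BP$ irrational direction. Let $p(n,\omega)$ be the directional billiard complexity. Then there exist positive constants $A,B$ such that $$B\le \frac{p(n,\omega)}{n^{2}}\le A\qquad\text{for all } n>0.$$
   Context: Billiard: a point mass moves inside a polyhedron $P\subset\mathbb R^3$ with unit speed along a straight line until it reaches $\partial P$, then its direction changes according to the mirror law (reflection in the face that is hit), and it continues along the new line. Tiling polygon: a polygon that tiles the plane by its successive reflections in its sides, i.e. the copies obtained by unfolding the polygon do not overlap and cover the plane (e.g. the regular hexagon, the square, tiling triangles). The group $G$ generated by the linear reflections in the faces of the prism is finite. Natural coding and complexity: each face of $P$ is labelled by its own letter and an orbit is coded by the sequence of faces it hits (orbits hitting edges are excluded). $\mathcal L(n,\omega)$ is the set of all words of length $n$ arising from orbits with direction $\omega$, and $p(n,\omega)=\mathrm{card}(\mathcal L(n,\omega))$. Minimal direction: the billiard map restricted to the invariant part $\partial P\times G\omega$ of phase space is minimal (every orbit defined for all times is dense). Diagonals: a (generalized) diagonal in the direction $\omega$ is a billiard orbit segment in the fixed direction $\omega$ which starts and ends in an edge of $P$. $BP$ irrational: $\omega$ is $BP$ irrational if there is no diagonal in this direction which passes through three sorts of edges (edges of three different types, a type being a class of parallel edges) and there is no diagonal in this direction which passes through two parallel edges. *)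

theory Defs
  imports "HOL-Analysis.Analysis"
begin

text \<open>A polygon is given by the cyclic list of its vertices.\<close>

definition next_vertex :: "'a list \<Rightarrow> nat \<Rightarrow> 'a" where
  "next_vertex vs i = vs ! (Suc i mod length vs)"

definition side :: "(real^2) list \<Rightarrow> nat \<Rightarrow> (real^2) set" where
  "side vs i = closed_segment (vs ! i) (next_vertex vs i)"

definition outline :: "(real^2) list \<Rightarrow> (real^2) set" where
  "outline vs = (\<Union>i<length vs. side vs i)"

definition region :: "(real^2) list \<Rightarrow> (real^2) set" where
  "region vs = outline vs \<union> inside (outline vs)"

text \<open>The last clause rules out flat angles, so that each side of the
  polygon is one entry of the list. Convexity is not assumed.\<close>

definition simple_polygon :: "(real^2) list \<Rightarrow> bool" where
  "simple_polygon vs \<longleftrightarrow>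
     3 \<le> length vs \<and> distinct vs \<and>
     (\<forall>i<length vs. \<forall>j<length vs. i \<noteq> j \<longrightarrow>
        side vs i \<inter> side vs j = {vs ! i, next_vertex vs i} \<inter> {vs ! j, next_vertex vs j}) \<and>
     (\<forall>i<length vs. \<not> collinear {vs ! i, vs ! (Suc i mod length vs), vs ! (Suc (Suc i) mod length vs)})"

definition reflect :: "'a::real_inner \<Rightarrow> 'a \<Rightarrow> 'a" where
  "reflect n x = x - (2 * (x \<bullet> n) / (n \<bullet> n)) *\<^sub>R n"

definition reflect_at :: "'a::real_inner \<Rightarrow> 'a \<Rightarrow> 'a \<Rightarrow> 'a" where
  "reflect_at a n x = a + reflect n (x - a)"

text \<open>The sets of generators used below consist of involutions, so the generated
  monoid is the generated group.\<close>

inductive_set generated :: "('a \<Rightarrow> 'a) set \<Rightarrow> ('a \<Rightarrow> 'a) set" for S where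
  gen_id: "id \<in> generated S"
| gen_step: "g \<in> generated S \<Longrightarrow> s \<in> S \<Longrightarrow> g \<circ> s \<in> generated S"

definition side_normal :: "(real^2) list \<Rightarrow> nat \<Rightarrow> real^2" where
  "side_normal vs i = (let d = next_vertex vs i - vs ! i in vector [- (d $ 2), d $ 1])"

text \<open>If \<open>r\<close> is the reflection in a side of the polygon \<open>Q\<close>, then the reflection of
  the copy \<open>g ` Q\<close> in the corresponding side of that copy is
  \<open>(g \<circ> r \<circ> inv g) ` (g ` Q) = (g \<circ> r) ` Q\<close>. Hence the copies obtained by successive
  unfolding are the images of \<open>Q\<close> under the group generated by the reflections in its
  sides. Different group elements may give the same copy (regular hexagon).\<close>

definition plane_unfoldings :: "(real^2) list \<Rightarrow> (real^2 \<Rightarrow> real^2) set" where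
  "plane_unfoldings vs =
     generated ((\<lambda>i. reflect_at (vs ! i) (side_normal vs i)) ` {..<length vs})"

definition tiling_polygon :: "(real^2) list \<Rightarrow> bool" where
  "tiling_polygon vs \<longleftrightarrow>
     simple_polygon vs \<and>
     (\<forall>g\<in>plane_unfoldings vs. \<forall>g'\<in>plane_unfoldings vs.
        g ` region vs = g' ` region vs \<or>
        interior (g ` region vs) \<inter> interior (g' ` region vs) = {}) \<and>
     (\<Union>g\<in>plane_unfoldings vs. g ` region vs) = UNIV"

text \<open>Euclidean 3-space is \<open>real^2 \<times> real\<close>, with the last coordinate along the axis of
  the prism; \<open>h\<close> is the height.\<close>

type_synonym space = "(real^2) \<times> real"

definition prism :: "(real^2) list \<Rightarrow> real \<Rightarrow> space set" where
  "prism vs h = region vs \<times> {0..h}"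

datatype face = Side nat | Bottom | Top

definition faces :: "(real^2) list \<Rightarrow> face set" where
  "faces vs = Side ` {..<length vs} \<union> {Bottom, Top}"

primrec face_set :: "(real^2) list \<Rightarrow> real \<Rightarrow> face \<Rightarrow> space set" where
  "face_set vs h (Side i) = side vs i \<times> {0..h}"
| "face_set vs h Bottom = region vs \<times> {0}"
| "face_set vs h Top = region vs \<times> {h}"

primrec face_point :: "(real^2) list \<Rightarrow> real \<Rightarrow> face \<Rightarrow> space" where
  "face_point vs h (Side i) = (vs ! i, 0)"
| "face_point vs h Bottom = (vs ! 0, 0)"
| "face_point vs h Top = (vs ! 0, h)"

primrec face_normal :: "(real^2) list \<Rightarrow> face \<Rightarrow> space" where
  "face_normal vs (Side i) = (side_normal vs i, 0)"
| "face_normal vs Bottom = (0, 1)"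
| "face_normal vs Top = (0, 1)"

definition edges :: "(real^2) list \<Rightarrow> real \<Rightarrow> space set set" where
  "edges vs h =
     {side vs i \<times> {0} | i. i < length vs} \<union>
     {side vs i \<times> {h} | i. i < length vs} \<union>
     {{vs ! i} \<times> {0..h} | i. i < length vs}"

definition direction_group :: "(real^2) list \<Rightarrow> (space \<Rightarrow> space) set" where
  "direction_group vs = generated ((\<lambda>f. reflect (face_normal vs f)) ` faces vs)"

definition direction_orbit :: "(real^2) list \<Rightarrow> space \<Rightarrow> space set" where
  "direction_orbit vs \<omega> = (\<lambda>g. g \<omega>) ` direction_group vs"

text \<open>A state is a point of the boundary off the edges together with the direction after
  the reflection there. The billiard map is a partial map, undefined when the next
  boundary point lies on an edge; it is rendered as a relation.\<close>

type_synonym state = "space \<times> space"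

definition billiard_step :: "(real^2) list \<Rightarrow> real \<Rightarrow> state \<Rightarrow> state \<Rightarrow> bool" where
  "billiard_step vs h = (\<lambda>(m, \<theta>) (m', \<theta>').
     \<exists>f\<in>faces vs. \<exists>t>0.
       m' = m + t *\<^sub>R \<theta> \<and> open_segment m m' \<subseteq> interior (prism vs h) \<and>
       m' \<in> face_set vs h f \<and> m' \<notin> \<Union>(edges vs h) \<and>
       \<theta>' = reflect (face_normal vs f) \<theta>)"

text \<open>Orbits defined for all times, past and future; they never meet an edge.\<close>

definition billiard_orbit :: "(real^2) list \<Rightarrow> real \<Rightarrow> (int \<Rightarrow> state) \<Rightarrow> bool" where
  "billiard_orbit vs h x \<longleftrightarrow> (\<forall>k. billiard_step vs h (x k) (x (k + 1)))"

text \<open>The part of phase space over the directions \<open>G \<omega>\<close>: at a boundary point only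
  the directions pointing into the prism occur after a reflection.\<close>

definition phase_part :: "(real^2) list \<Rightarrow> real \<Rightarrow> space \<Rightarrow> state set" where
  "phase_part vs h \<omega> =
     {(m, \<theta>). m \<in> frontier (prism vs h) \<and> m \<notin> \<Union>(edges vs h) \<and>
        \<theta> \<in> direction_orbit vs \<omega> \<and>
        (\<exists>\<epsilon>>0. \<forall>t. 0 < t \<and> t < \<epsilon> \<longrightarrow> m + t *\<^sub>R \<theta> \<in> interior (prism vs h))}"

definition minimal_direction :: "(real^2) list \<Rightarrow> real \<Rightarrow> space \<Rightarrow> bool" where
  "minimal_direction vs h \<omega> \<longleftrightarrow>
     (\<forall>x. billiard_orbit vs h x \<and> x 0 \<in> phase_part vs h \<omega> \<longrightarrow>
        phase_part vs h \<omega> \<subseteq> closure (range x))"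

text \<open>Words may be read off from any time \<open>k\<close> of an orbit starting in direction \<open>\<omega>\<close>.
  Off the edges the face containing a boundary point is unique.\<close>

definition billiard_language :: "(real^2) list \<Rightarrow> real \<Rightarrow> nat \<Rightarrow> space \<Rightarrow> face list set" where
  "billiard_language vs h n \<omega> =
     {w. length w = n \<and> set w \<subseteq> faces vs \<and>
        (\<exists>x k. billiard_orbit vs h x \<and> snd (x 0) = \<omega> \<and>
           (\<forall>i<n. fst (x (k + int i)) \<in> face_set vs h (w ! i)))}"

definition billiard_complexity :: "(real^2) list \<Rightarrow> real \<Rightarrow> nat \<Rightarrow> space \<Rightarrow> nat" where
  "billiard_complexity vs h n \<omega> = card (billiard_language vs h n \<omega>)"

definition space_unfoldings :: "(real^2) list \<Rightarrow> real \<Rightarrow> (space \<Rightarrow> space) set" where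
  "space_unfoldings vs h =
     generated ((\<lambda>f. reflect_at (face_point vs h f) (face_normal vs f)) ` faces vs)"

definition unfolded_edges :: "(real^2) list \<Rightarrow> real \<Rightarrow> space set set" where
  "unfolded_edges vs h = {g ` e | g e. g \<in> space_unfoldings vs h \<and> e \<in> edges vs h}"

text \<open>A diagonal may meet further edges between its ends, where the billiard map is not
  defined; it continues there as a straight line through the unfolded copies of the
  prism, which tile space. So diagonals are taken in unfolded form, where an orbit with
  direction \<open>\<omega>\<close> is a straight line in the fixed direction \<open>\<omega>\<close>, and the edges met by
  it, and their parallelism, are those of the unfolded copies. Folding back, these are the
  orbit segments from edge to edge of the prism with directions in \<open>G \<omega>\<close>.\<close>

definition diagonal :: "(real^2) list \<Rightarrow> real \<Rightarrow> space \<Rightarrow> space set \<Rightarrow> bool" where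
  "diagonal vs h \<omega> D \<longleftrightarrow>
     (\<exists>a t. 0 < t \<and> D = closed_segment a (a + t *\<^sub>R \<omega>) \<and>
        a \<in> \<Union>(unfolded_edges vs h) \<and> a + t *\<^sub>R \<omega> \<in> \<Union>(unfolded_edges vs h))"

definition parallel_edges :: "space set \<Rightarrow> space set \<Rightarrow> bool" where
  "parallel_edges e e' \<longleftrightarrow>
     (\<exists>a b c d r. e = closed_segment a b \<and> e' = closed_segment c d \<and> a \<noteq> b \<and> c \<noteq> d \<and>
        b - a = r *\<^sub>R (d - c))"

definition BP_irrational :: "(real^2) list \<Rightarrow> real \<Rightarrow> space \<Rightarrow> bool" where
  "BP_irrational vs h \<omega> \<longleftrightarrow>
     \<not> (\<exists>D. diagonal vs h \<omega> D \<and>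
          (\<exists>e1\<in>unfolded_edges vs h. \<exists>e2\<in>unfolded_edges vs h. \<exists>e3\<in>unfolded_edges vs h.
             \<not> parallel_edges e1 e2 \<and> \<not> parallel_edges e1 e3 \<and> \<not> parallel_edges e2 e3 \<and>
             D \<inter> e1 \<noteq> {} \<and> D \<inter> e2 \<noteq> {} \<and> D \<inter> e3 \<noteq> {})) \<and>
     \<not> (\<exists>D. diagonal vs h \<omega> D \<and>
          (\<exists>e1\<in>unfolded_edges vs h. \<exists>e2\<in>unfolded_edges vs h.
             e1 \<noteq> e2 \<and> parallel_edges e1 e2 \<and> D \<inter> e1 \<noteq> {} \<and> D \<inter> e2 \<noteq> {}))"

end

theory Submission
  imports Defs
begin

text \<open>Unfolding turns an orbit into a straight line in the direction \<open>(\<theta>, c)\<close> through copies of the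
  prism, and irrationality gives \<open>\<theta> \<noteq> 0\<close> and \<open>c \<noteq> 0\<close>. Upper bound: the line of an orbit with \<open>n\<close>
  hits stays in a tube which meets only \<open>O(n)\<close> copies, since the unfolding group is discrete and
  cocompact. Projecting along the line turns their edges into \<open>O(n)\<close> segments in a plane, the word
  is determined by the position of the starting point relative to the lines carrying these segments,
  and \<open>O(n)\<close> lines cut a plane into \<open>O(n\<^sup>2)\<close> cells. Only finitely many initial directions occur,
  because the linear parts of the unfolding group form a finite group.

  Lower bound: if an edge lies between two parallel lines at bounded depth, their words differ, as
  the copies are convex. A thin strip of starting points in the base plane is cut by \<open>\<ge> const \<cdot> n\<close>
  vertices of the planar tiling, all at different offsets because no diagonal passes through two
  vertical edges. Over each starting point in the plane the sides that are crossed cut the heights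
  in \<open>(0, h)\<close> at \<open>\<ge> const \<cdot> n\<close> places, since no diagonal passes through three horizontal edges:
  two of them would be parallel or all three of different types.\<close>

subsection \<open>Plane geometry and simple polygons\<close>

text \<open>The definition of a tiling polygon mentions neither convexity nor discreteness; both are
  extracted from the tiling. Interior points cannot lie on the line through a side, so the interior
  is cut out by half-planes. For discreteness, the images of one inner point in different tiles are
  uniformly apart, and the motions preserving a tile permute its vertices. The linear parts are
  finite in number because a rotation can be conjugated until its centre lies in the polygon. Hence
  the translations of the group leave only bounded gaps, and they supply the vertices in the strip:
  two of them have small offsets of opposite sign and both advance, so a walk can be steered to
  remain in the strip at bounded cost per step.

  A word needs an orbit defined for all past and future times. The set \<open>grid\<close> of all
  unfolded edges is invariant under the unfolding group, so a line missing \<open>grid\<close> folds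
  to such an orbit, and generic starting points exist because only countably many offsets and
  heights are bad.\<close>

definition perp :: "real^2 \<Rightarrow> real^2" where
  "perp x = vector [- (x $ 2), x $ 1]"

lemma perp_simps [simp]: "perp x $ 1 = - (x $ 2)" "perp x $ 2 = x $ 1"
  by (simp_all add: perp_def)

lemma inner_2: "x \<bullet> y = x $ 1 * y $ 1 + x $ 2 * y $ 2" for x y :: "real^2"
  by (simp add: inner_vec_def sum_2)

lemma vec2_eq_iff: "x = y \<longleftrightarrow> x $ 1 = y $ 1 \<and> x $ 2 = y $ 2" for x y :: "real^2"
  by (simp add: vec_eq_iff forall_2)

lemma perp_orth [simp]: "x \<bullet> perp x = 0" "perp x \<bullet> x = 0"
  by (simp_all add: inner_2)

lemma inner_perp_perp [simp]: "perp x \<bullet> perp y = x \<bullet> y"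
  by (simp add: inner_2)

lemma perp_eq_0_iff [simp]: "perp x = 0 \<longleftrightarrow> x = 0"
  by (auto simp: vec2_eq_iff)

lemma perp_decomp: "(d \<bullet> d) *\<^sub>R x = (x \<bullet> d) *\<^sub>R d + (x \<bullet> perp d) *\<^sub>R perp d"
  by (simp add: vec2_eq_iff inner_2 algebra_simps)

lemma parallel_of_inner_perp_0:
  assumes "d \<noteq> 0" "x \<bullet> perp d = 0"
  shows "x = ((x \<bullet> d) / (d \<bullet> d)) *\<^sub>R d"
proof -
  have "(d \<bullet> d) *\<^sub>R x = (d \<bullet> d) *\<^sub>R (((x \<bullet> d) / (d \<bullet> d)) *\<^sub>R d)"
    using perp_decomp[of d x] assms by simp
  then show ?thesis
    using assms(1) by (metis inner_eq_zero_iff scaleR_left_imp_eq)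
qed

lemma side_normal_eq: "side_normal vs i = perp (next_vertex vs i - vs ! i)"
  by (simp add: side_normal_def perp_def Let_def)

text \<open>The signed distance from the line through the side, scaled by the length of the side.
  Its sign depends on the orientation of the vertex list, which is not prescribed; \<open>ht\<close>
  below repairs this.\<close>

definition side_form :: "(real^2) list \<Rightarrow> nat \<Rightarrow> real^2 \<Rightarrow> real" where
  "side_form vs i x = (x - vs ! i) \<bullet> side_normal vs i"

lemma side_form_vertex [simp]: "side_form vs i (vs ! i) = 0"
  by (simp add: side_form_def)

lemma side_form_next [simp]: "side_form vs i (next_vertex vs i) = 0"
  by (simp add: side_form_def side_normal_eq)

lemma side_form_combo:
  "side_form vs i ((1 - u) *\<^sub>R x + u *\<^sub>R y) = (1 - u) * side_form vs i x + u * side_form vs i y"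
  by (simp add: side_form_def algebra_simps)

lemma side_form_add: "side_form vs i (x + t *\<^sub>R y) = side_form vs i x + t * (y \<bullet> side_normal vs i)"
  by (simp add: side_form_def algebra_simps)

lemma side_form_diff: "side_form vs i y - side_form vs i x = (y - x) \<bullet> side_normal vs i"
  by (simp add: side_form_def algebra_simps)

lemma side_form_side: "x \<in> side vs i \<Longrightarrow> side_form vs i x = 0"
  by (auto simp: side_def in_segment side_form_combo)

lemma continuous_on_side_form [continuous_intros]: "continuous_on S (side_form vs i)"
  unfolding side_form_def by (intro continuous_intros)

lemma convex_side_form_pos: "convex {x. 0 < e * side_form vs i x}"
proof -
  have "{x. 0 < e * side_form vs i x} = {x. (e *\<^sub>R side_normal vs i) \<bullet> x > e * (vs ! i \<bullet> side_normal vs i)}"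
    by (auto simp: side_form_def algebra_simps inner_commute)
  then show ?thesis by (simp only: convex_halfspace_gt)
qed

locale polygon =
  fixes vs :: "(real^2) list"
  assumes simple: "simple_polygon vs"
begin

abbreviation "nv \<equiv> length vs"

lemma nv_ge: "3 \<le> nv" and distinct_vs: "distinct vs"
  using simple by (auto simp: simple_polygon_def)

lemma nv_pos [simp]: "0 < nv" "vs \<noteq> []"
  using nv_ge by auto

lemma side_Int: "i < nv \<Longrightarrow> j < nv \<Longrightarrow> i \<noteq> j \<Longrightarrow>
    side vs i \<inter> side vs j = {vs ! i, next_vertex vs i} \<inter> {vs ! j, next_vertex vs j}"
  using simple by (auto simp: simple_polygon_def)

lemma corner: "i < nv \<Longrightarrow> \<not> collinear {vs ! i, next_vertex vs i, next_vertex vs (Suc i mod nv)}"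
  using simple by (auto simp: simple_polygon_def next_vertex_def mod_Suc_eq)

lemma next_neq: "i < nv \<Longrightarrow> next_vertex vs i \<noteq> vs ! i"
  using corner[of i] by (metis collinear_2 insert_absorb2)

lemma next_in: "next_vertex vs i \<in> set vs"
  by (simp add: next_vertex_def)

lemma side_normal_nz: "i < nv \<Longrightarrow> side_normal vs i \<noteq> 0"
  using next_neq by (simp add: side_normal_eq)

lemma vertex_in_side [simp]: "vs ! i \<in> side vs i" "next_vertex vs i \<in> side vs i"
  by (auto simp: side_def)

section \<open>The outline as a Jordan curve\<close>

lemma compact_outline: "compact (outline vs)"
  unfolding outline_def side_def by (intro compact_UN) auto

lemma closed_outline: "closed (outline vs)"
  using compact_outline compact_imp_closed by blast

lemma set_vs_outline: "set vs \<subseteq> outline vs"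
  unfolding outline_def using vertex_in_side by (force simp: in_set_conv_nth)

text \<open>The sides are joined one by one. A new side meets the earlier ones only in its initial
  point, because sides share only common vertices and its final vertex has not occurred yet.\<close>

lemma arc_outline:
  "Suc k < nv \<Longrightarrow> \<exists>g. arc g \<and> pathstart g = vs ! 0 \<and> pathfinish g = vs ! Suc k \<and>
     path_image g = (\<Union>i\<le>k. side vs i)"
proof (induction k)
  case 0
  then have "vs ! 0 \<noteq> vs ! 1"
    using distinct_vs by (metis One_nat_def nth_eq_iff_index_eq nv_pos(1) zero_neq_one)
  then show ?case
    using 0 by (intro exI[of _ "linepath (vs ! 0) (vs ! 1)"])
      (auto simp: side_def next_vertex_def)
next
  case (Suc k)
  then obtain g where g: "arc g" "pathstart g = vs ! 0" "pathfinish g = vs ! Suc k"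
    "path_image g = (\<Union>i\<le>k. side vs i)" by auto
  have nx: "next_vertex vs i = vs ! Suc i" if "i \<le> Suc k" for i
    using that Suc.prems by (simp add: next_vertex_def)
  have ne: "vs ! i \<noteq> vs ! j" if "i \<noteq> j" "i \<le> Suc (Suc k)" "j \<le> Suc (Suc k)" for i j
    using that Suc.prems distinct_vs by (simp add: nth_eq_iff_index_eq)
  let ?l = "linepath (vs ! Suc k) (vs ! Suc (Suc k))"
  have im: "path_image ?l = side vs (Suc k)"
    by (simp add: side_def nx)
  have "side vs i \<inter> side vs (Suc k) \<subseteq> {vs ! Suc k}" if "i \<le> k" for i
  proof -
    have "side vs i \<inter> side vs (Suc k) = {vs ! i, vs ! Suc i} \<inter> {vs ! Suc k, vs ! Suc (Suc k)}"
      using side_Int[of i "Suc k"] that Suc.prems by (simp add: nx)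
    then show ?thesis using ne[of i "Suc (Suc k)"] ne[of "Suc i" "Suc (Suc k)"] that by auto
  qed
  then have "path_image g \<inter> path_image ?l \<subseteq> {pathstart ?l}"
    unfolding g(4) im by auto
  moreover have "arc ?l" by (simp add: ne)
  ultimately have "arc (g +++ ?l)"
    using g by (intro arc_join) auto
  moreover have "path_image (g +++ ?l) = (\<Union>i\<le>Suc k. side vs i)"
    by (subst path_image_join) (auto simp: g im atMost_Suc simp del: path_image_linepath)
  ultimately show ?case
    using g by (intro exI[of _ "g +++ ?l"]) auto
qed

text \<open>The last side meets the arc of all other sides at both of its ends and nowhere else,
  which is the situation of joining two arcs to a loop.\<close>

lemma outline_loop:
  obtains g where "simple_path g" "pathfinish g = pathstart g" "path_image g = outline vs"
proof -
  define k where "k = nv - 2"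
  have k: "nv = Suc (Suc k)" using nv_ge by (simp add: k_def)
  obtain g where g: "arc g" "pathstart g = vs ! 0" "pathfinish g = vs ! Suc k"
    "path_image g = (\<Union>i\<le>k. side vs i)" using arc_outline[of k] k by auto
  have nx: "next_vertex vs (Suc k) = vs ! 0" using k by (simp add: next_vertex_def)
  let ?l = "linepath (vs ! Suc k) (vs ! 0)"
  have im: "path_image ?l = side vs (Suc k)" by (simp add: side_def nx)
  have "vs ! Suc k \<noteq> vs ! 0" using distinct_vs k by (simp add: nth_eq_iff_index_eq)
  then have "arc ?l" by simp
  have "side vs i \<inter> side vs (Suc k) \<subseteq> {vs ! 0, vs ! Suc k}" if "i \<le> k" for i
    using side_Int[of i "Suc k"] that k nx by auto
  then have int: "path_image g \<inter> path_image ?l \<subseteq> {pathstart g, pathstart ?l}"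
    unfolding g im by auto
  have "simple_path (g +++ ?l)"
    by (rule simple_path_join_loop[OF g(1) \<open>arc ?l\<close> _ _ int]) (simp_all add: g)
  moreover have "path_image (g +++ ?l) = outline vs"
    by (subst path_image_join) (auto simp: g im k outline_def lessThan_Suc_atMost atMost_Suc simp del: path_image_linepath)
  ultimately show ?thesis using that[of "g +++ ?l"] g by simp
qed

text \<open>Simple closed paths are compared with a circle in the complex plane, whereas
  Jordan-Brouwer separation asks for a sphere in the ambient space; hence the passage between the
  two circles.\<close>

lemma outline_homeomorphic_circle: "outline vs homeomorphic sphere (0::real^2) 1"
proof -
  obtain g where g: "simple_path g" "pathfinish g = pathstart g" "path_image g = outline vs"
    by (rule outline_loop)
  then have "outline vs homeomorphic sphere (0::complex) 1"
    using homeomorphic_simple_path_image_circle[of g 1 0] by simp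
  moreover have "sphere (0::complex) 1 homeomorphic sphere (0::real^2) 1"
    by (rule homeomorphic_spheres_gen) auto
  ultimately show ?thesis by (rule homeomorphic_trans)
qed

lemma not_connected_compl_outline: "\<not> connected (- outline vs)"
  using Jordan_Brouwer_separation[OF outline_homeomorphic_circle] by simp

lemma frontier_component: "C \<in> components (- outline vs) \<Longrightarrow> frontier C = outline vs"
  using Jordan_Brouwer_frontier[OF outline_homeomorphic_circle] by simp

lemma outside_component: "outside (outline vs) \<in> components (- outline vs)"
proof -
  have "bounded (outline vs)" using compact_outline compact_imp_bounded by blast
  then have "connected (outside (outline vs))" "outside (outline vs) \<noteq> {}"
    using connected_outside[of "outline vs"] outside_bounded_nonempty by auto
  then show ?thesis by (simp add: outside_in_components)
qed

lemma inside_nonempty: "inside (outline vs) \<noteq> {}"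
proof
  assume "inside (outline vs) = {}"
  then have "outside (outline vs) = - outline vs"
    using inside_Un_outside by (metis Un_empty_left)
  then show False
    using outside_component not_connected_compl_outline in_components_connected by metis
qed

section \<open>The polygon near an inner point of a side\<close>

lemma disc_meets_only_side:
  assumes i: "i < nv" and p: "p \<in> side vs i" "p \<noteq> vs ! i" "p \<noteq> next_vertex vs i"
  obtains r where "0 < r" "ball p r \<inter> outline vs \<subseteq> side vs i"
proof -
  let ?S = "\<Union>j\<in>{..<nv} - {i}. side vs j"
  have "closed ?S" unfolding side_def by (intro closed_UN) auto
  moreover have "p \<notin> ?S"
  proof
    assume "p \<in> ?S"
    then obtain j where j: "j < nv" "j \<noteq> i" "p \<in> side vs j" by auto
    then have "p \<in> side vs i \<inter> side vs j" using p by auto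
    then show False using side_Int[of i j] i j p by auto
  qed
  ultimately obtain r where r: "0 < r" "ball p r \<subseteq> - ?S"
    by (metis ComplI open_Compl open_contains_ball)
  then show ?thesis
    by (intro that[of r]) (auto simp: outline_def subset_iff)
qed

lemma open_not_in_line:
  assumes "open U" "U \<noteq> {}" and i: "i < nv"
  obtains x where "x \<in> U" "side_form vs i x \<noteq> 0"
proof -
  obtain x r where x: "x \<in> U" "0 < r" "ball x r \<subseteq> U"
    using assms by (metis ex_in_conv openE)
  show ?thesis
  proof (cases "side_form vs i x = 0")
    case False then show ?thesis using that x by auto
  next
    case True
    let ?n = "side_normal vs i"
    define e where "e = r / (2 * norm ?n)"
    have n: "norm ?n > 0" using side_normal_nz[OF i] by simp
    then have e: "e > 0" "e * norm ?n < r" using x by (auto simp: e_def)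
    then have "x + e *\<^sub>R ?n \<in> U" using x by (auto simp: dist_norm subset_iff)
    moreover have "side_form vs i (x + e *\<^sub>R ?n) \<noteq> 0"
      using True e n by (simp add: side_form_add)
    ultimately show ?thesis using that by blast
  qed
qed

lemma half_disc_nonempty:
  assumes i: "i < nv" and p: "p \<in> side vs i" and r: "0 < r" and e: "e = 1 \<or> e = -1"
  shows "ball p r \<inter> {x. 0 < e * side_form vs i x} \<noteq> {}"
proof -
  let ?n = "side_normal vs i"
  have n: "norm ?n > 0" using side_normal_nz[OF i] by simp
  define t where "t = r / (2 * norm ?n)"
  have t: "t > 0" "t * norm ?n < r" using n r by (auto simp: t_def)
  have ee: "e * e = 1" "\<bar>e\<bar> = 1" using e by auto
  have nn: "?n \<bullet> ?n > 0" using n by simp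
  have "e * side_form vs i (p + (e * t) *\<^sub>R ?n) = (e * e) * (t * (?n \<bullet> ?n))"
    using side_form_side[OF p] by (simp only: side_form_add) (simp add: algebra_simps)
  then have "0 < e * side_form vs i (p + (e * t) *\<^sub>R ?n)" using ee t nn by simp
  moreover have "p + (e * t) *\<^sub>R ?n \<in> ball p r"
    using t ee by (simp add: dist_norm abs_mult)
  ultimately show ?thesis by blast
qed

lemma half_disc_disjoint:
  assumes "ball p r \<inter> outline vs \<subseteq> side vs i"
  shows "ball p r \<inter> {x. 0 < e * side_form vs i x} \<subseteq> - outline vs"
  using assms side_form_side by fastforce

text \<open>The whole outline is the frontier of every component, so the component reaches into the
  disc. Each open half disc is connected and misses the outline, so a component meeting it contains
  it.\<close>

lemma half_disc_in_component:
  assumes i: "i < nv" and p: "p \<in> side vs i" and r: "0 < r" "ball p r \<inter> outline vs \<subseteq> side vs i"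
    and C: "C \<in> components (- outline vs)"
  obtains e where "e = 1 \<or> e = -1" "ball p r \<inter> {x. 0 < e * side_form vs i x} \<subseteq> C"
proof -
  have "open C" using C closed_outline open_components by blast
  moreover have "p \<in> closure C"
    using frontier_component[OF C] p i by (auto simp: outline_def frontier_def)
  then have "ball p r \<inter> C \<noteq> {}"
    using r(1) open_Int_closure_eq_empty[of "ball p r" C] centre_in_ball by blast
  ultimately obtain x where x: "x \<in> ball p r" "x \<in> C" "side_form vs i x \<noteq> 0"
    using open_not_in_line[of "ball p r \<inter> C" i] i by (metis Int_iff open_Int open_ball)
  define e :: real where "e = (if 0 < side_form vs i x then 1 else -1)"
  have "connected (ball p r \<inter> {x. 0 < e * side_form vs i x})"
    by (intro convex_connected convex_Int convex_side_form_pos) auto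
  moreover have "x \<in> ball p r \<inter> {x. 0 < e * side_form vs i x}"
    using x by (auto simp: e_def)
  ultimately have "ball p r \<inter> {x. 0 < e * side_form vs i x} \<subseteq> C"
    using half_disc_disjoint[OF r(2)] C x(2)
    by (intro components_maximal[OF C]) auto
  moreover have "e = 1 \<or> e = -1" by (simp add: e_def)
  ultimately show ?thesis using that by blast
qed

lemma mid_side:
  assumes "i < nv"
  obtains p where "p \<in> side vs i" "p \<noteq> vs ! i" "p \<noteq> next_vertex vs i"
proof -
  have "vs ! i \<noteq> next_vertex vs i" using next_neq[OF assms] by auto
  then show ?thesis
    by (intro that[of "midpoint (vs ! i) (next_vertex vs i)"])
       (auto simp: side_def midpoint_eq_endpoint)
qed

text \<open>The disc about an inner point of a side has only two halves, and the outside occupies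
  one. Every other component must contain the other half, so all points of the inside lie in a
  single component.\<close>

lemma inside_component: "inside (outline vs) \<in> components (- outline vs)"
proof -
  obtain p where p: "p \<in> side vs 0" "p \<noteq> vs ! 0" "p \<noteq> next_vertex vs 0"
    using mid_side[of 0] by auto
  obtain r where r: "0 < r" "ball p r \<inter> outline vs \<subseteq> side vs 0"
    using disc_meets_only_side[of 0 p] p by auto
  note h = half_disc_in_component[OF _ p(1) r, simplified]
  obtain e where e: "e = 1 \<or> e = -1" 
    "ball p r \<inter> {x. 0 < e * side_form vs 0 x} \<subseteq> outside (outline vs)"
    using h[OF outside_component] by auto
  have two: "ball p r \<inter> {x. 0 < (-e) * side_form vs 0 x} \<subseteq> C"
    if C: "C \<in> components (- outline vs)" "C \<noteq> outside (outline vs)" for C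
  proof -
    obtain e' where e': "e' = 1 \<or> e' = -1" "ball p r \<inter> {x. 0 < e' * side_form vs 0 x} \<subseteq> C"
      using h[OF C(1)] by auto
    have dj: "C \<inter> outside (outline vs) = {}"
      using C outside_component components_nonoverlap by blast
    have "e' \<noteq> e"
    proof
      assume "e' = e"
      then have "ball p r \<inter> {x. 0 < e * side_form vs 0 x} = {}" using e e' dj by blast
      then show False using half_disc_nonempty[OF _ p(1) r(1) e(1)] by auto
    qed
    then have "e' = -e" using e(1) e'(1) by auto
    then show ?thesis using e' by simp
  qed
  obtain x where x: "x \<in> inside (outline vs)" using inside_nonempty by auto
  define C where "C = connected_component_set (- outline vs) x"
  have xC: "x \<in> - outline vs" using x inside_no_overlap by blast
  have C: "C \<in> components (- outline vs)" unfolding C_def components_def using xC by blast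
  have nO: "D \<noteq> outside (outline vs)" if "y \<in> D" "y \<in> inside (outline vs)" for D y
    using that inside_Int_outside by blast
  have xin: "x \<in> C" using xC by (simp add: C_def)
  have "inside (outline vs) = C"
  proof
    show "C \<subseteq> inside (outline vs)"
      using inside_same_component[of "outline vs" x] x unfolding C_def by auto
  next
    show "inside (outline vs) \<subseteq> C"
    proof
      fix y assume y: "y \<in> inside (outline vs)"
      define D where "D = connected_component_set (- outline vs) y"
      have yD: "y \<in> - outline vs" using y inside_no_overlap by blast
      have D: "D \<in> components (- outline vs)" unfolding D_def components_def using yD by blast
      have yin: "y \<in> D" using yD by (simp add: D_def)
      have "ball p r \<inter> {x. 0 < (-e) * side_form vs 0 x} \<noteq> {}"
        using half_disc_nonempty[OF _ p(1) r(1), of "-e"] e(1) by auto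
      then have "C \<inter> D \<noteq> {}"
        using two[OF C nO[OF xin x]] two[OF D nO[OF yin y]] by blast
      then have "C = D" using components_nonoverlap[OF C D] by blast
      then show "y \<in> C" using yin by simp
    qed
  qed
  then show ?thesis using C by simp
qed

lemma connected_inside: "connected (inside (outline vs))"
  using inside_component in_components_connected by blast

lemma open_inside_outline: "open (inside (outline vs))"
  by (simp add: closed_outline open_inside)

lemma frontier_inside: "frontier (inside (outline vs)) = outline vs"
  using inside_component frontier_component by blast

lemma region_eq_closure: "region vs = closure (inside (outline vs))"
  using frontier_inside by (metis closure_Un_frontier region_def Un_commute)

lemma closed_region: "closed (region vs)"
  by (simp add: region_eq_closure)

lemma bounded_region: "bounded (region vs)"
proof -
  have "bounded (inside (outline vs))"
    using compact_outline by (intro bounded_inside compact_imp_bounded)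
  then show ?thesis by (simp add: region_eq_closure bounded_closure)
qed

lemma compact_region: "compact (region vs)"
  using closed_region bounded_region compact_eq_bounded_closed by blast

lemma interior_region: "interior (region vs) = inside (outline vs)"
proof
  show "inside (outline vs) \<subseteq> interior (region vs)"
    using open_inside_outline by (intro interior_maximal) (auto simp: region_def)
  show "interior (region vs) \<subseteq> inside (outline vs)"
  proof
    fix x assume x: "x \<in> interior (region vs)"
    show "x \<in> inside (outline vs)"
    proof (rule ccontr)
      assume "x \<notin> inside (outline vs)"
      then have "x \<in> outline vs" using x interior_subset by (auto simp: region_def)
      \<comment> \<open>The outline is the frontier of the outside as well, so no neighbourhood of
        one of its points stays within the region.\<close>
      then have "x \<in> closure (outside (outline vs))"
        using frontier_component[OF outside_component] by (auto simp: frontier_def)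
      then have "interior (region vs) \<inter> outside (outline vs) \<noteq> {}"
        using x open_Int_closure_eq_empty[of "interior (region vs)" "outside (outline vs)"] by auto
      then show False
        using interior_subset[of "region vs"] inside_Int_outside[of "outline vs"] outside_no_overlap[of "outline vs"]
        unfolding region_def by blast
    qed
  qed
qed

lemma half_discs:
  assumes i: "i < nv" and p: "p \<in> side vs i" and r: "0 < r" "ball p r \<inter> outline vs \<subseteq> side vs i"
  obtains e where "e = 1 \<or> e = -1"
    "ball p r \<inter> {x. 0 < e * side_form vs i x} \<subseteq> inside (outline vs)"
    "ball p r \<inter> {x. 0 < - e * side_form vs i x} \<subseteq> outside (outline vs)"
proof -
  obtain e where e: "e = 1 \<or> e = -1" 
    "ball p r \<inter> {x. 0 < e * side_form vs i x} \<subseteq> inside (outline vs)"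
    using half_disc_in_component[OF i p r inside_component] by auto
  obtain e' where e': "e' = 1 \<or> e' = -1" 
    "ball p r \<inter> {x. 0 < e' * side_form vs i x} \<subseteq> outside (outline vs)"
    using half_disc_in_component[OF i p r outside_component] by auto
  have "e' \<noteq> e"
    using half_disc_nonempty[OF i p r(1) e(1)] e e' inside_Int_outside[of "outline vs"] by blast
  then have "e' = -e" using e(1) e'(1) by auto
  then show ?thesis using that[of e] e e' by auto
qed

end

subsection \<open>Groups generated by reflections\<close>

lemma generated_comp:
  assumes "g' \<in> generated S" "g \<in> generated S"
  shows "g \<circ> g' \<in> generated S"
  using assms
proof (induction)
  case gen_id then show ?case by simp
next
  case (gen_step g' s)
  then show ?case using generated.gen_step[of "g \<circ> g'" S s] by (simp only: o_assoc)
qed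

lemma generated_single: "s \<in> S \<Longrightarrow> s \<in> generated S"
  using generated.gen_step[OF generated.gen_id, of s S] by simp

lemma generated_inverse:
  assumes "\<And>s. s \<in> S \<Longrightarrow> s \<circ> s = id" "g \<in> generated S"
  shows "\<exists>g'\<in>generated S. g \<circ> g' = id \<and> g' \<circ> g = id"
  using assms(2)
proof (induction)
  case gen_id then show ?case using generated.gen_id[of S] by (intro bexI[of _ id]) simp_all
next
  case (gen_step g s)
  from gen_step.IH obtain g' where g': "g' \<in> generated S" "g \<circ> g' = id" "g' \<circ> g = id" by blast
  have ss: "s \<circ> s = id" by (rule assms(1)[OF gen_step.hyps(2)])
  have "(g \<circ> s) \<circ> (s \<circ> g') = g \<circ> (s \<circ> s) \<circ> g'" by (simp only: o_assoc)
  moreover have "(s \<circ> g') \<circ> (g \<circ> s) = s \<circ> (g' \<circ> g) \<circ> s" by (simp only: o_assoc)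
  ultimately show ?case
    unfolding ss g' comp_id
    using generated_comp[OF g'(1) generated_single[OF gen_step.hyps(2)]] by (metis ss)
qed

text \<open>The head of the list is applied first; this matches \<open>gen_step\<close>, which
  attaches generators on the right. Countability of the group is needed later to discard nongeneric
  starting points.\<close>

primrec comp_list :: "('a \<Rightarrow> 'a) list \<Rightarrow> 'a \<Rightarrow> 'a" where
  "comp_list [] = id"
| "comp_list (s # l) = comp_list l \<circ> s"

lemma countable_generated:
  assumes "countable S" shows "countable (generated S)"
proof (rule countable_subset)
  show "generated S \<subseteq> comp_list ` lists S"
  proof
    fix g assume "g \<in> generated S"
    then show "g \<in> comp_list ` lists S"
    proof induction
      case gen_id show ?case by (rule image_eqI[of _ _ "[]"]) simp_all
    next
      case (gen_step g s)
      from gen_step.IH obtain l where "l \<in> lists S" "g = comp_list l" by (elim imageE)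
      then show ?case using gen_step.hyps(2) by (intro image_eqI[of _ _ "s # l"]) simp_all
    qed
  qed
  show "countable (comp_list ` lists S)"
    using assms by simp
qed

lemma linear_reflect: "linear (reflect n)"
  by (rule linearI) (simp_all add: reflect_def inner_add_left algebra_simps add_divide_distrib)

lemma reflect_inner: "reflect n x \<bullet> n = - (x \<bullet> n)"
  by (cases "n = 0") (simp_all add: reflect_def inner_diff_left)

lemma reflect_involution [simp]: "reflect n (reflect n x) = x"
  unfolding reflect_def[of n "reflect n x"] reflect_inner by (simp add: reflect_def)

lemma norm_reflect [simp]: "norm (reflect n x) = norm x"
proof (cases "n = 0")
  case True then show ?thesis by (simp add: reflect_def)
next
  case False
  define k where "k = 2 * (x \<bullet> n) / (n \<bullet> n)"
  have k: "k * (n \<bullet> n) = 2 * (x \<bullet> n)" using False by (simp add: k_def)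
  have "reflect n x \<bullet> reflect n x = x \<bullet> x - 2 * k * (x \<bullet> n) + k * (k * (n \<bullet> n))"
    unfolding reflect_def k_def[symmetric]
    by (simp add: inner_diff_left inner_diff_right inner_commute algebra_simps)
  also have "\<dots> = x \<bullet> x" by (simp add: k)
  finally show ?thesis by (simp add: norm_eq)
qed

lemma orthogonal_transformation_reflect: "orthogonal_transformation (reflect n)"
  by (simp add: orthogonal_transformation linear_reflect)

definition lin_part :: "('a::real_vector \<Rightarrow> 'a) \<Rightarrow> 'a \<Rightarrow> 'a" where
  "lin_part g x = g x - g 0"

definition rigid :: "('a::euclidean_space \<Rightarrow> 'a) \<Rightarrow> bool" where
  "rigid g \<longleftrightarrow> orthogonal_transformation (lin_part g)"

lemma rigid_linear: "rigid g \<Longrightarrow> linear (lin_part g)"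
  by (simp add: rigid_def orthogonal_transformation_linear)

lemma lin_part_add:
  assumes "rigid g" shows "g (x + t *\<^sub>R v) = g x + t *\<^sub>R lin_part g v"
proof -
  have "lin_part g (x + t *\<^sub>R v) = lin_part g x + t *\<^sub>R lin_part g v"
    using rigid_linear[OF assms] by (simp add: linear_add linear_scale)
  then show ?thesis by (simp add: lin_part_def algebra_simps)
qed

lemma lin_part_diff:
  assumes "rigid g" shows "g x - g y = lin_part g (x - y)"
  using lin_part_add[OF assms, of y 1 "x - y"] by simp

lemma rigid_dist: "rigid g \<Longrightarrow> dist (g x) (g y) = dist x y"
  by (simp add: dist_norm lin_part_diff rigid_def orthogonal_transformation_norm)

lemma rigid_combo:
  assumes "rigid g" shows "g ((1 - u) *\<^sub>R x + u *\<^sub>R y) = (1 - u) *\<^sub>R g x + u *\<^sub>R g y"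
proof -
  have "g ((1 - u) *\<^sub>R x + u *\<^sub>R y) = g (x + u *\<^sub>R (y - x))"
    by (simp add: algebra_simps)
  also have "\<dots> = g x + u *\<^sub>R (g y - g x)"
    by (simp only: lin_part_add[OF assms] lin_part_diff[OF assms, symmetric])
  finally show ?thesis by (simp add: algebra_simps)
qed

lemma lin_part_comp:
  assumes "rigid g" shows "lin_part (g \<circ> f) = lin_part g \<circ> lin_part f"
  by (rule ext) (simp add: lin_part_def[of "g \<circ> f"] lin_part_diff[OF assms] lin_part_def[of f])

lemma rigid_comp: "rigid g \<Longrightarrow> rigid f \<Longrightarrow> rigid (g \<circ> f)"
  unfolding rigid_def using lin_part_comp[of g f]
  by (simp add: rigid_def orthogonal_transformation_compose)

lemma lin_part_id [simp]: "lin_part id = id"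
  by (auto simp: lin_part_def)

lemma rigid_id [simp]: "rigid id"
  unfolding rigid_def lin_part_id unfolding id_def by (rule orthogonal_transformation_id)

lemma lin_part_reflect_at [simp]: "lin_part (reflect_at a n) = reflect n"
proof
  fix x
  have "reflect n (x - a) - reflect n (0 - a) = reflect n x"
    using linear_diff[OF linear_reflect, of n "x - a" "0 - a"] by simp
  then show "lin_part (reflect_at a n) x = reflect n x"
    by (simp add: lin_part_def reflect_at_def)
qed

lemma rigid_reflect_at: "rigid (reflect_at a n)"
  by (simp add: rigid_def orthogonal_transformation_reflect)

lemma reflect_at_involution: "reflect_at a n \<circ> reflect_at a n = id"
  by (auto simp: reflect_at_def)

lemma reflect_at_fixed: "(x - a) \<bullet> n = 0 \<Longrightarrow> reflect_at a n x = x"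
  by (simp add: reflect_at_def reflect_def)

lemma rigid_generated:
  assumes "\<And>s. s \<in> S \<Longrightarrow> rigid s" "g \<in> generated S"
  shows "rigid g"
  using assms(2)
proof induction
  case gen_id show ?case by (rule rigid_id)
next
  case (gen_step g s)
  then show ?case using rigid_comp[OF gen_step.IH assms(1)[OF gen_step.hyps(2)]] by blast
qed

lemma rigid_image: "g ` S = (+) (g 0) ` lin_part g ` S"
  by (auto simp: lin_part_def image_image)

lemma rigid_interior:
  assumes "rigid g" shows "interior (g ` S) = g ` interior S"
proof -
  have "interior (lin_part g ` S) = lin_part g ` interior S"
    using assms by (intro interior_injective_linear_image)
      (auto simp: rigid_linear rigid_def orthogonal_transformation_inj)
  then show ?thesis
    by (subst (1 2) rigid_image) (simp only: interior_translation)
qed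

lemma rigid_inj: "rigid g \<Longrightarrow> inj g"
  by (metis injI rigid_dist dist_eq_0_iff)

lemma rigid_continuous: "rigid g \<Longrightarrow> continuous_on S g"
  unfolding continuous_on_iff by (metis rigid_dist)

lemma rigid_segment:
  assumes "rigid g" shows "g ` closed_segment a b = closed_segment (g a) (g b)"
  unfolding closed_segment_def by (force simp: rigid_combo[OF assms, symmetric])

subsection \<open>Tiling polygons\<close>

locale tiling =
  fixes vs :: "(real^2) list"
  assumes tiling: "tiling_polygon vs"

sublocale tiling \<subseteq> polygon vs
  using tiling by unfold_locales (simp add: tiling_polygon_def)

context tiling
begin

abbreviation "core \<equiv> inside (outline vs)"
abbreviation "rf i \<equiv> reflect_at (vs ! i) (side_normal vs i)"
abbreviation "PU \<equiv> plane_unfoldings vs"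

lemma PU_id: "id \<in> PU"
  by (simp add: plane_unfoldings_def generated.gen_id)

lemma PU_rf: "i < nv \<Longrightarrow> rf i \<in> PU"
  by (auto simp: plane_unfoldings_def intro: generated_single)

lemma PU_comp: "g \<in> PU \<Longrightarrow> f \<in> PU \<Longrightarrow> g \<circ> f \<in> PU"
  by (simp add: plane_unfoldings_def generated_comp)

lemma PU_inverse:
  assumes "g \<in> PU" obtains g' where "g' \<in> PU" "g \<circ> g' = id" "g' \<circ> g = id"
  using generated_inverse[of "rf ` {..<nv}" g] assms reflect_at_involution
  unfolding plane_unfoldings_def by force

lemma PU_rigid: "g \<in> PU \<Longrightarrow> rigid g"
  unfolding plane_unfoldings_def by (rule rigid_generated) (auto simp: rigid_reflect_at)

lemma countable_PU: "countable PU"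
  unfolding plane_unfoldings_def by (intro countable_generated) auto

lemma tiles_disjoint:
  "g \<in> PU \<Longrightarrow> f \<in> PU \<Longrightarrow> g ` region vs = f ` region vs \<or> g ` core \<inter> f ` core = {}"
  using tiling rigid_interior[OF PU_rigid, of g "region vs"] rigid_interior[OF PU_rigid, of f "region vs"]
  unfolding tiling_polygon_def interior_region by metis

lemma tiles_cover: obtains g where "g \<in> PU" "x \<in> g ` region vs"
  using tiling unfolding tiling_polygon_def by blast

lemma core_eq_of_region_eq:
  "g \<in> PU \<Longrightarrow> f \<in> PU \<Longrightarrow> g ` region vs = f ` region vs \<Longrightarrow> g ` core = f ` core"
  using rigid_interior[OF PU_rigid, of g "region vs"] rigid_interior[OF PU_rigid, of f "region vs"]
  unfolding interior_region by metis

section \<open>Convexity from the tiling property\<close>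

lemma side_form_rf: "side_form vs i (rf i x) = - side_form vs i x"
  by (simp add: side_form_def reflect_at_def reflect_inner)

lemma rf_fixed: "side_form vs i x = 0 \<Longrightarrow> rf i x = x"
  by (simp add: reflect_at_fixed side_form_def)

lemma rf_rf [simp]: "rf i (rf i x) = x"
  using reflect_at_involution[of "vs ! i" "side_normal vs i"] by (metis comp_apply id_apply)

lemma rf_ball:
  assumes "side_form vs i p = 0" "x \<in> ball p r" shows "rf i x \<in> ball p r"
  using assms rigid_dist[OF rigid_reflect_at, of "vs ! i" "side_normal vs i" p x] rf_fixed[of i p] by simp

text \<open>Near an inner point of the side the polygon fills exactly one half disc, and the
  reflection exchanges the halves. The tiling condition allows copies to coincide, so this case must
  be excluded before disjointness of interiors can be used.\<close>

lemma rf_region_neq: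
  assumes i: "i < nv" shows "rf i ` region vs \<noteq> region vs"
proof
  assume eq: "rf i ` region vs = region vs"
  obtain p where p: "p \<in> side vs i" "p \<noteq> vs ! i" "p \<noteq> next_vertex vs i"
    using mid_side[OF i] by auto
  obtain r where r: "0 < r" "ball p r \<inter> outline vs \<subseteq> side vs i"
    using disc_meets_only_side[OF i p] by auto
  obtain e where e: "e = 1 \<or> e = -1"
    "ball p r \<inter> {x. 0 < e * side_form vs i x} \<subseteq> core"
    "ball p r \<inter> {x. 0 < - e * side_form vs i x} \<subseteq> outside (outline vs)"
    using half_discs[OF i p(1) r] by blast
  obtain x where x: "x \<in> ball p r" "0 < e * side_form vs i x"
    using half_disc_nonempty[OF i p(1) r(1) e(1)] by auto
  have "rf i x \<in> ball p r \<inter> {x. 0 < - e * side_form vs i x}"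
    using rf_ball[OF side_form_side[OF p(1)] x(1)] x(2) by (simp add: side_form_rf)
  then have "rf i x \<in> outside (outline vs)" using e by auto
  moreover have "x \<in> region vs" using x e(2) by (auto simp: region_def)
  then have "rf i x \<in> region vs" using eq by blast
  ultimately show False
    using inside_Int_outside[of "outline vs"] outside_no_overlap[of "outline vs"]
    unfolding region_def by blast
qed

text \<open>A point of the interior on the line through a side would be fixed by the reflection
  in that side, so the reflected copy would overlap the polygon. This is what makes a
  tiling polygon convex.\<close>

lemma core_off_lines:
  assumes i: "i < nv" and x: "x \<in> core" shows "side_form vs i x \<noteq> 0"
proof
  assume "side_form vs i x = 0"
  then have "x \<in> rf i ` core" using x rf_fixed by (metis image_eqI)
  moreover have "rf i ` core \<inter> id ` core = {}"
    using tiles_disjoint[OF PU_rf[OF i] PU_id] rf_region_neq[OF i] by simp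
  ultimately show False using x by auto
qed

lemma core_one_side:
  assumes i: "i < nv"
  obtains e where "e = 1 \<or> e = -1" "\<And>x. x \<in> core \<Longrightarrow> 0 < e * side_form vs i x"
proof -
  have c: "connected (side_form vs i ` core)"
    by (intro connected_continuous_image continuous_on_side_form connected_inside)
  have nz: "0 \<notin> side_form vs i ` core" using core_off_lines[OF i] by auto
  have *: "\<not> (side_form vs i x < 0 \<and> 0 < side_form vs i y)" if "x \<in> core" "y \<in> core" for x y
    using connectedD_interval[OF c, of "side_form vs i x" "side_form vs i y" 0] that nz by auto
  show ?thesis
  proof (cases "\<exists>x\<in>core. 0 < side_form vs i x")
    case True
    then show ?thesis using * core_off_lines[OF i] by (intro that[of 1]) force+
  next
    case False
    then show ?thesis using core_off_lines[OF i] by (intro that[of "-1"]) force+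
  qed
qed

text \<open>The inward normal of a side, as long as the side itself. The sign is taken by choice
  because the vertex list may run in either sense.\<close>

definition inn :: "nat \<Rightarrow> real^2" where
  "inn i = (SOME e. (e = 1 \<or> e = -1) \<and> (\<forall>x\<in>core. 0 < e * side_form vs i x)) *\<^sub>R side_normal vs i"

definition ht :: "nat \<Rightarrow> real^2 \<Rightarrow> real" where
  "ht i x = (x - vs ! i) \<bullet> inn i"

lemma inn_cases:
  assumes "i < nv"
  obtains e where "e = 1 \<or> e = -1" "inn i = e *\<^sub>R side_normal vs i" "\<And>x. ht i x = e * side_form vs i x"
    "\<And>x. x \<in> core \<Longrightarrow> 0 < e * side_form vs i x"
proof -
  define e :: real where "e = (SOME e. (e = 1 \<or> e = -1) \<and> (\<forall>x\<in>core. 0 < e * side_form vs i x))"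
  have "(e = 1 \<or> e = -1) \<and> (\<forall>x\<in>core. 0 < e * side_form vs i x)"
    unfolding e_def using core_one_side[OF assms] by (intro someI_ex[where P="\<lambda>e. (e = 1 \<or> e = -1) \<and> (\<forall>x\<in>core. 0 < e * side_form vs i x)"]) metis
  moreover have "inn i = e *\<^sub>R side_normal vs i" by (simp add: inn_def e_def)
  ultimately show ?thesis
    using that[of e] by (auto simp: ht_def side_form_def)
qed

lemma ht_zero_iff: "i < nv \<Longrightarrow> ht i x = 0 \<longleftrightarrow> side_form vs i x = 0"
  by (rule inn_cases[of i]) auto

lemma ht_side [simp]: "i < nv \<Longrightarrow> x \<in> side vs i \<Longrightarrow> ht i x = 0"
  by (simp add: ht_zero_iff side_form_side)

lemma ht_rf: "i < nv \<Longrightarrow> ht i (rf i x) = - ht i x"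
  by (rule inn_cases[of i]) (auto simp: side_form_rf)

lemma ht_combo: "ht i ((1 - u) *\<^sub>R x + u *\<^sub>R y) = (1 - u) * ht i x + u * ht i y"
  by (simp add: ht_def algebra_simps)

lemma ht_add: "ht i (x + t *\<^sub>R y) = ht i x + t * (y \<bullet> inn i)"
  by (simp add: ht_def algebra_simps)

text \<open>The intersection of the open half-planes is convex, hence connected, and misses the
  outline. It contains the interior, which is a component of the complement, so maximality of
  components forces equality.\<close>

lemma core_iff: "x \<in> core \<longleftrightarrow> (\<forall>i<nv. 0 < ht i x)"
proof -
  let ?D = "{x. \<forall>i<nv. 0 < ht i x}"
  have "0 < ht i x" if "x \<in> core" "i < nv" for x i
    by (rule inn_cases[OF that(2)]) (use that(1) in auto)
  then have sub: "core \<subseteq> ?D" by blast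
  have "?D = (\<Inter>i\<in>{..<nv}. {x. 0 < ht i x})" by auto
  moreover have "convex {x. 0 < ht i x}" if "i < nv" for i
    by (rule inn_cases[OF that]) (simp add: convex_side_form_pos)
  ultimately have "convex ?D" by (auto intro: convex_INT)
  moreover have "?D \<subseteq> - outline vs"
  proof
    fix x assume x: "x \<in> ?D"
    show "x \<in> - outline vs"
    proof
      assume "x \<in> outline vs"
      then obtain i where "i < nv" "x \<in> side vs i" by (auto simp: outline_def)
      then show False using x ht_side by fastforce
    qed
  qed
  ultimately have "?D \<subseteq> core"
    using sub inside_nonempty convex_connected
    by (intro components_maximal[OF inside_component]) auto
  then show ?thesis using sub by auto
qed

lemma region_iff: "x \<in> region vs \<longleftrightarrow> (\<forall>i<nv. 0 \<le> ht i x)"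
proof
  assume x: "x \<in> region vs"
  show "\<forall>i<nv. 0 \<le> ht i x"
  proof (intro allI impI)
    fix i assume i: "i < nv"
    have "closed {x. 0 \<le> ht i x}" unfolding ht_def by (intro closed_Collect_le continuous_intros)
    moreover have "core \<subseteq> {x. 0 \<le> ht i x}" using core_iff i by force
    ultimately show "0 \<le> ht i x" using x closure_minimal by (auto simp: region_eq_closure)
  qed
next
  assume x: "\<forall>i<nv. 0 \<le> ht i x"
  obtain q where q: "q \<in> core" using inside_nonempty by auto
  have "\<exists>y\<in>core. dist y x < e" if e: "0 < e" for e
  proof -
    \<comment> \<open>A step of relative length \<open>t\<close> from \<open>x\<close> towards the
      inner point \<open>q\<close> stays within distance \<open>e\<close>; the summand 1 covers the
      case \<open>q = x\<close>.\<close>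
    define t where "t = min 1 (e / (2 * (norm (q - x) + 1)))"
    have p1: "norm (q - x) + 1 > 0" by (simp add: add_nonneg_pos)
    have t: "0 < t" "t \<le> 1" "t \<le> e / (2 * (norm (q - x) + 1))" using e p1 by (auto simp: t_def)
    have "t * (2 * (norm (q - x) + 1)) \<le> e" using t(3) p1 by (simp add: field_simps)
    then have "2 * (t * norm (q - x)) + 2 * t \<le> e" by (simp add: algebra_simps)
    then have "t * norm (q - x) < e" using t(1) mult_nonneg_nonneg[OF less_imp_le[OF t(1)] norm_ge_zero[of "q - x"]] by linarith
    moreover have "(1 - t) *\<^sub>R x + t *\<^sub>R q - x = t *\<^sub>R (q - x)" by (simp add: algebra_simps)
    ultimately have "dist ((1 - t) *\<^sub>R x + t *\<^sub>R q) x < e" using t(1) by (simp add: dist_norm)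
    moreover have "(1 - t) *\<^sub>R x + t *\<^sub>R q \<in> core"
      unfolding core_iff ht_combo
      using q x t by (auto simp: core_iff intro!: add_nonneg_pos)
    ultimately show ?thesis by blast
  qed
  then show "x \<in> region vs" by (simp add: region_eq_closure closure_approachable)
qed

lemma convex_core: "convex core"
  unfolding convex_alt
proof (intro ballI allI impI)
  fix x y and u :: real assume "x \<in> core" "y \<in> core" "0 \<le> u \<and> u \<le> 1"
  then show "(1 - u) *\<^sub>R x + u *\<^sub>R y \<in> core"
    unfolding core_iff ht_combo
    by (cases "u = 0") (auto intro!: add_nonneg_pos)
qed

lemma convex_region: "convex (region vs)"
  by (simp add: region_eq_closure convex_closure convex_core)

lemma side_region: "i < nv \<Longrightarrow> side vs i \<subseteq> region vs"
  by (auto simp: region_def outline_def)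

text \<open>Both sides of a side belong to known tiles, the polygon and its mirror image. This
  identifies any tile that has points near an inner point of the side.\<close>

lemma half_disc_core:
  assumes i: "i < nv" and p: "p \<in> side vs i" "p \<noteq> vs ! i" "p \<noteq> next_vertex vs i"
  obtains r where "0 < r" "\<And>x. x \<in> ball p r \<Longrightarrow> 0 < ht i x \<Longrightarrow> x \<in> core"
    "\<And>x. x \<in> ball p r \<Longrightarrow> ht i x < 0 \<Longrightarrow> x \<in> rf i ` core"
proof -
  obtain r where r: "0 < r" "ball p r \<inter> outline vs \<subseteq> side vs i"
    using disc_meets_only_side[OF i p] by auto
  obtain e where e: "e = 1 \<or> e = -1"
    "ball p r \<inter> {x. 0 < e * side_form vs i x} \<subseteq> core"
    "ball p r \<inter> {x. 0 < - e * side_form vs i x} \<subseteq> outside (outline vs)"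
    by (rule half_discs[OF i p(1) r])
  obtain d where d: "d = 1 \<or> d = -1" "inn i = d *\<^sub>R side_normal vs i" "\<And>x. ht i x = d * side_form vs i x"
    "\<And>x. x \<in> core \<Longrightarrow> 0 < d * side_form vs i x" by (rule inn_cases[OF i]) blast
  obtain x where "x \<in> ball p r" "0 < e * side_form vs i x"
    using half_disc_nonempty[OF i p(1) r(1) e(1)] by auto
  then have "0 < d * side_form vs i x" "0 < e * side_form vs i x" using e d by auto
  then have "d = e" using e(1) d(1) by auto
  then have 1: "x \<in> core" if "x \<in> ball p r" "0 < ht i x" for x using that e d by auto
  have "x \<in> rf i ` core" if "x \<in> ball p r" "ht i x < 0" for x
  proof -
    have "rf i x \<in> core"
      using that ht_rf[OF i] rf_ball[OF side_form_side[OF p(1)]] by (intro 1) auto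
    then show ?thesis by (metis rf_rf image_eqI)
  qed
  with 1 r(1) show ?thesis using that by blast
qed

text \<open>This is the absence of flat angles in linear form: consecutive sides span the plane. It
  makes vertices extreme points and makes motions determined by their action on vertices.\<close>

lemma corner_indep:
  assumes "i < nv"
  shows "(next_vertex vs i - vs ! i) \<bullet> side_normal vs (Suc i mod nv) \<noteq> 0"
proof
  let ?j = "Suc i mod nv"
  assume 0: "(next_vertex vs i - vs ! i) \<bullet> side_normal vs ?j = 0"
  let ?d = "next_vertex vs ?j - vs ! ?j"
  have j: "?j < nv" by simp
  have v: "vs ! ?j = next_vertex vs i" by (simp add: next_vertex_def)
  have "?d \<noteq> 0" using next_neq[OF j] by simp
  then have "next_vertex vs i - vs ! i = ((next_vertex vs i - vs ! i) \<bullet> ?d / (?d \<bullet> ?d)) *\<^sub>R ?d"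
    using 0 by (intro parallel_of_inner_perp_0) (auto simp: side_normal_eq)
  then obtain a where a: "next_vertex vs i - vs ! i = a *\<^sub>R ?d" by blast
  then have "a \<noteq> 0" using next_neq[OF assms] by auto
  then have "?d = (- 1 / a) *\<^sub>R (vs ! i - next_vertex vs i)"
    using arg_cong[OF a, of "\<lambda>x. (1 / a) *\<^sub>R x"] by (simp add: algebra_simps)
  then have "collinear {0, vs ! i - next_vertex vs i, next_vertex vs ?j - next_vertex vs i}"
    unfolding collinear_lemma v by blast
  then have "collinear {vs ! i, next_vertex vs i, next_vertex vs ?j}"
    by (simp add: collinear_3)
  then show False using corner[OF assms] by simp
qed

text \<open>The heights above the two sides at \<open>v\<close> vanish at \<open>v\<close> and are
  nonnegative on the polygon, so they vanish at \<open>x\<close> too. The two lines meet only in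
  \<open>v\<close>, since the angle is not flat.\<close>

lemma vertex_extreme:
  assumes v: "v \<in> set vs" and xy: "x \<in> region vs" "y \<in> region vs"
    and u: "0 < u" "u < 1" "v = (1 - u) *\<^sub>R x + u *\<^sub>R y"
  shows "x = v"
proof -
  obtain k where k: "k < nv" "v = vs ! k" using v by (metis in_set_conv_nth)
  \<comment> \<open>The cyclic predecessor of \<open>k\<close>; adding \<open>nv\<close> keeps the
    subtraction on natural numbers faithful at \<open>k = 0\<close>.\<close>
  define i where "i = (k + nv - 1) mod nv"
  have i: "i < nv" by (simp add: i_def)
  have "Suc i mod nv = (Suc (k + nv - 1)) mod nv" unfolding i_def by (rule mod_Suc_eq)
  then have ki: "Suc i mod nv = k" using k nv_pos by simp
  then have vn: "v = next_vertex vs i" using k by (simp add: next_vertex_def)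
  have z: "side_form vs j x = 0" if j: "j < nv" "v \<in> side vs j" for j
  proof -
    have "(1 - u) * ht j x + u * ht j y = 0"
      using j by (metis ht_combo ht_side u(3))
    moreover have "0 \<le> ht j x" "0 \<le> ht j y" using xy j by (auto simp: region_iff)
    ultimately have "ht j x = 0" using u
      by (metis add_nonneg_eq_0_iff diff_gt_0_iff_gt less_eq_real_def mult_eq_0_iff mult_nonneg_nonneg order_less_irrefl)
    then show ?thesis using ht_zero_iff j by simp
  qed
  have 1: "(x - v) \<bullet> side_normal vs i = 0"
    using z[OF i] side_form_next[of vs i] vn side_form_diff[of vs i x v] by simp
  have 2: "(x - v) \<bullet> side_normal vs k = 0"
    using z[OF k(1)] k side_form_diff[of vs k x v] by simp
  have "x - v = ((x - v) \<bullet> (next_vertex vs i - vs ! i) / ((next_vertex vs i - vs ! i) \<bullet> (next_vertex vs i - vs ! i))) *\<^sub>R (next_vertex vs i - vs ! i)"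
    using 1 next_neq[OF i] by (intro parallel_of_inner_perp_0) (auto simp: side_normal_eq)
  then obtain a where a: "x - v = a *\<^sub>R (next_vertex vs i - vs ! i)" by blast
  have "a = 0" using 2 corner_indep[OF i] ki a by simp
  with a have "x - v = 0" by simp
  then show ?thesis by simp
qed

text \<open>A vertex of the copy is an extreme point of it and so cannot lie strictly within a
  segment contained in that copy.\<close>

lemma vertex_on_side:
  assumes g: "rigid g" and v: "v \<in> set vs" and i: "i < nv"
    and s: "side vs i \<subseteq> g ` region vs" and gv: "g v \<in> side vs i"
  shows "g v = vs ! i \<or> g v = next_vertex vs i"
proof (rule ccontr)
  assume n: "\<not> ?thesis"
  obtain a b where ab: "a \<in> region vs" "b \<in> region vs" "g a = vs ! i" "g b = next_vertex vs i"
  proof -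
    have "vs ! i \<in> g ` region vs" "next_vertex vs i \<in> g ` region vs" using s by auto
    then show ?thesis using that by auto
  qed
  obtain u where u: "0 \<le> u" "u \<le> 1" "g v = (1 - u) *\<^sub>R g a + u *\<^sub>R g b"
    using gv ab by (auto simp: side_def in_segment)
  have "u \<noteq> 0" "u \<noteq> 1" using u n ab by auto
  then have u': "0 < u" "u < 1" using u by auto
  have "g v = g ((1 - u) *\<^sub>R a + u *\<^sub>R b)" using u g by (simp add: rigid_combo)
  then have "v = (1 - u) *\<^sub>R a + u *\<^sub>R b" using rigid_inj[OF g] by (meson injD)
  then have "a = v" using vertex_extreme[OF v ab(1,2) u'] by simp
  then show False using n ab by auto
qed

end

section \<open>Local finiteness and the finite group of linear parts\<close>

lemma separated_bounded_finite:
  fixes S :: "'a::heine_borel set"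
  assumes "bounded S" "0 < e" and sep: "\<And>x y. x \<in> S \<Longrightarrow> y \<in> S \<Longrightarrow> dist x y < e \<Longrightarrow> x = y"
  shows "finite S"
proof (rule ccontr)
  assume "infinite S"
  then obtain l where "l islimpt S"
    using bounded_infinite_imp_islimpt[OF subset_refl] assms(1) by auto
  have cl: "closed T" if "T \<subseteq> S" for T
    using sep that by (intro discrete_imp_closed[OF \<open>0 < e\<close>]) (auto simp: dist_commute)
  \<comment> \<open>A limit point of \<open>S\<close> is still one after deleting it from
    \<open>S\<close>, but separation makes the remaining set closed.\<close>
  then have "l \<in> S - {l}" using \<open>l islimpt S\<close> cl[of "S - {l}"]
    by (metis Diff_subset closed_limpt islimpt_punctured)
  then show False by simp
qed

lemma cramer_2: "(a \<bullet> perp b) *\<^sub>R x = (x \<bullet> perp b) *\<^sub>R a - (x \<bullet> perp a) *\<^sub>R b"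
  by (simp add: vec2_eq_iff inner_2 algebra_simps)

text \<open>In complex notation, multiplication by \<open>\<alpha> + i \<beta>\<close>. The pair is
  the cosine and sine of the angle when the map is orthogonal, but no such condition is
  imposed.\<close>

definition rotation_by :: "real \<Rightarrow> real \<Rightarrow> real^2 \<Rightarrow> real^2" where
  "rotation_by \<alpha> \<beta> x = \<alpha> *\<^sub>R x + \<beta> *\<^sub>R perp x"

lemma perp_add: "perp (x + y) = perp x + perp y" and perp_scaleR: "perp (c *\<^sub>R x) = c *\<^sub>R perp x"
  and perp_perp [simp]: "perp (perp x) = - x"
  by (simp_all add: vec2_eq_iff)

lemma norm_perp [simp]: "norm (perp x) = norm x"
  by (simp add: norm_eq)

lemma rotation_by_inject: "rotation_by a b = rotation_by c d \<longleftrightarrow> a = c \<and> b = d"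
proof
  assume "rotation_by a b = rotation_by c d"
  then have "rotation_by a b (vector [1, 0]) = rotation_by c d (vector [1, 0])" by simp
  then show "a = c \<and> b = d" by (simp add: rotation_by_def vec2_eq_iff)
qed simp

text \<open>The images of the two basis vectors are orthonormal, so the second is plus or minus
  \<open>perp\<close> of the first. The orientation reversing case is recorded as anticommuting with
  \<open>perp\<close>, the form that conjugation of rotations needs.\<close>

lemma orthogonal_plane_cases:
  fixes f :: "real^2 \<Rightarrow> real^2"
  assumes f: "orthogonal_transformation f"
  obtains \<alpha> \<beta> where "f = rotation_by \<alpha> \<beta>" | "\<forall>x. f (perp x) = - perp (f x)"
proof -
  let ?e = "vector [1, 0] :: real^2"
  have lin: "linear f" using f by (simp add: orthogonal_transformation_linear)
  have ip: "f x \<bullet> f y = x \<bullet> y" for x y using f by (simp add: orthogonal_transformation_def)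
  define a where "a = f ?e"
  define b where "b = f (perp ?e)"
  have aa: "a \<bullet> a = 1" and ab: "b \<bullet> a = 0" and bb: "b \<bullet> b = 1"
    unfolding a_def b_def ip by (simp_all add: inner_2)
  have b: "b = (b \<bullet> perp a) *\<^sub>R perp a" using perp_decomp[of a b] aa ab by simp
  define s where "s = b \<bullet> perp a"
  have bs: "b = s *\<^sub>R perp a" using b by (simp add: s_def)
  then have "s * s = 1" using bb aa by simp
  then have s: "s = 1 \<or> s = -1" by (simp add: square_eq_1_iff)
  have fx: "f x = x $ 1 *\<^sub>R a + x $ 2 *\<^sub>R b" for x
  proof -
    have "x = x $ 1 *\<^sub>R ?e + x $ 2 *\<^sub>R perp ?e" by (simp add: vec2_eq_iff)
    then have "f x = f (x $ 1 *\<^sub>R ?e + x $ 2 *\<^sub>R perp ?e)" by simp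
    also have "\<dots> = x $ 1 *\<^sub>R a + x $ 2 *\<^sub>R b"
      using lin by (simp add: linear_add linear_scale a_def b_def)
    finally show ?thesis .
  qed
  show ?thesis
  proof (cases "s = 1")
    case True
    have "f = rotation_by (a $ 1) (a $ 2)"
      unfolding fun_eq_iff rotation_by_def fx bs True by (simp add: vec2_eq_iff algebra_simps)
    then show ?thesis using that by blast
  next
    case False
    then have "s = -1" using s by simp
    then have "f (perp x) = - perp (f x)" for x
      unfolding fx bs by (simp add: vec2_eq_iff algebra_simps)
    then show ?thesis using that by blast
  qed
qed

context tiling
begin

lemma region_core_closure: "g \<in> PU \<Longrightarrow> g ` region vs \<subseteq> closure (g ` core)"
  unfolding region_eq_closure
  by (intro image_closure_subset rigid_continuous PU_rigid) (auto intro: closure_subset[THEN subsetD])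

lemma open_tile_core: "g \<in> PU \<Longrightarrow> open (g ` core)"
  by (metis interior_region open_interior rigid_interior PU_rigid)

lemma core_subset_region: "core \<subseteq> region vs"
  by (auto simp: region_def)

lemma tile_eq_of_open_meet:
  assumes "g \<in> PU" "f \<in> PU" "open U" "U \<subseteq> g ` core" "x \<in> U" "x \<in> f ` region vs"
  shows "g ` region vs = f ` region vs"
proof -
  have "U \<inter> f ` core \<noteq> {}"
    using assms(5,6) region_core_closure[OF assms(2)] open_Int_closure_eq_empty[OF assms(3), of "f ` core"]
    by blast
  then have "\<not> (g ` core \<inter> f ` core = {})" using assms(4) by blast
  then show ?thesis using tiles_disjoint[OF assms(1,2)] by blast
qed

text \<open>A point of the outline of a tile is a limit of its interior, so the two tiles would
  overlap and hence coincide; the point would then be both inside and on the outline.\<close>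

lemma core_not_outline:
  assumes "g \<in> PU" "f \<in> PU" "x \<in> g ` core" shows "x \<notin> f ` outline vs"
proof
  assume x: "x \<in> f ` outline vs"
  then have "x \<in> f ` region vs" by (auto simp: region_def)
  then have "g ` region vs = f ` region vs"
    using tile_eq_of_open_meet[OF assms(1,2) open_tile_core[OF assms(1)] subset_refl assms(3)] by simp
  then have "x \<in> f ` core" using core_eq_of_region_eq[OF assms(1,2)] assms(3) by simp
  then obtain y where y: "x = f y" "y \<in> core" by (elim imageE)
  from x obtain z where z: "x = f z" "z \<in> outline vs" by (elim imageE)
  have "y = z" using rigid_inj[OF PU_rigid[OF assms(2)]] y(1) z(1) by (metis injD)
  with y z have "y \<in> core \<inter> outline vs" by blast
  then show False unfolding inside_no_overlap by (rule emptyE)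
qed

lemma rf_side: "x \<in> side vs i \<Longrightarrow> rf i x = x"
  by (simp add: rf_fixed side_form_side)

text \<open>The tiling is edge-to-edge. If a foreign vertex lay strictly within a side, its tile
  would have points in the polygon or in its mirror image at that side, hence would be one of these
  two. Both contain the whole side, contradicting extremality of vertices.\<close>

lemma vertex_in_region:
  assumes v: "v \<in> set vs" and g: "g \<in> PU" and gv: "g v \<in> region vs"
  shows "g v \<in> set vs"
proof -
  have "g v \<in> g ` outline vs" using v set_vs_outline by auto
  then have "g v \<notin> id ` core" using core_not_outline[OF PU_id g, of "g v"] by auto
  then obtain i where i: "i < nv" "g v \<in> side vs i" using gv by (auto simp: region_def outline_def)
  show ?thesis
  proof (cases "g v = vs ! i \<or> g v = next_vertex vs i")
    case True then show ?thesis using i next_in by (metis nth_mem)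
  next
    case False
    obtain r where r: "0 < r" "\<And>x. x \<in> ball (g v) r \<Longrightarrow> 0 < ht i x \<Longrightarrow> x \<in> core"
      "\<And>x. x \<in> ball (g v) r \<Longrightarrow> ht i x < 0 \<Longrightarrow> x \<in> rf i ` core"
      using half_disc_core[OF i] False by blast
    have "g v \<in> closure (g ` core)" using region_core_closure[OF g] v set_vs_outline by (auto simp: region_def)
    then have "ball (g v) r \<inter> g ` core \<noteq> {}"
      using r(1) open_Int_closure_eq_empty[of "ball (g v) r" "g ` core"] by (metis IntI centre_in_ball empty_iff open_ball)
    then obtain y where y: "y \<in> ball (g v) r" "y \<in> g ` core" "side_form vs i y \<noteq> 0"
      using open_not_in_line[of "ball (g v) r \<inter> g ` core" i] i(1) open_tile_core[OF g] by blast
    have "ht i y \<noteq> 0" using y(3) ht_zero_iff[OF i(1)] by simp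
    then consider "y \<in> id ` core" | "y \<in> rf i ` core"
      using r(2,3)[OF y(1)] by (cases "0 < ht i y") auto
    then have "side vs i \<subseteq> g ` region vs"
    proof cases
      case 1
      then have "g ` region vs = region vs" using tiles_disjoint[OF g PU_id] y(2) by auto
      then show ?thesis using side_region[OF i(1)] by simp
    next
      case 2
      then have "g ` region vs = rf i ` region vs" using tiles_disjoint[OF g PU_rf[OF i(1)]] y(2) by auto
      moreover have "x \<in> rf i ` region vs" if "x \<in> side vs i" for x
        by (rule image_eqI[of _ _ x]) (use rf_side[OF that] side_region[OF i(1)] that in auto)
      ultimately show ?thesis by blast
    qed
    then have False using vertex_on_side[OF PU_rigid[OF g] v i(1) _ i(2)] False by blast
    then show ?thesis ..
  qed
qed

lemma rigid_eq_on_vertices: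
  assumes g: "rigid g" and f: "rigid f" and eq: "\<And>v. v \<in> set vs \<Longrightarrow> g v = f v"
  shows "g = f"
proof
  fix x
  let ?j = "Suc 0 mod nv"
  define a where "a = next_vertex vs 0 - vs ! 0"
  define b where "b = next_vertex vs ?j - vs ! ?j"
  have ab: "a \<bullet> perp b \<noteq> 0" using corner_indep[of 0] by (simp add: a_def b_def side_normal_eq)
  have vin: "vs ! 0 \<in> set vs" "vs ! ?j \<in> set vs" using nv_ge by (auto intro!: nth_mem)
  have la: "lin_part g a = lin_part f a" "lin_part g b = lin_part f b"
    unfolding a_def b_def by (simp_all only: lin_part_diff[OF g, symmetric] lin_part_diff[OF f, symmetric] eq vin next_in)
  have "lin_part g y = lin_part f y" for y
  proof -
    have lg: "linear (lin_part g)" and lf: "linear (lin_part f)" using g f by (auto intro: rigid_linear)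
    have "(a \<bullet> perp b) *\<^sub>R lin_part g y = lin_part g ((y \<bullet> perp b) *\<^sub>R a - (y \<bullet> perp a) *\<^sub>R b)"
      using lg by (simp only: cramer_2[symmetric] linear_scale)
    also have "\<dots> = lin_part f ((y \<bullet> perp b) *\<^sub>R a - (y \<bullet> perp a) *\<^sub>R b)"
      by (simp only: linear_diff[OF lg] linear_diff[OF lf] linear_scale[OF lg] linear_scale[OF lf] la)
    also have "\<dots> = (a \<bullet> perp b) *\<^sub>R lin_part f y"
      using lf by (simp only: cramer_2[symmetric] linear_scale)
    finally show ?thesis using ab by simp
  qed
  then show "g x = f x"
    using lin_part_diff[OF g, of x "vs ! 0"] lin_part_diff[OF f, of x "vs ! 0"] eq[OF vin(1)] by (metis diff_add_cancel)
qed

text \<open>A motion preserving the polygon maps vertices to vertices, and it is determined by these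
  values.\<close>

lemma finite_stabilizer: "finite {g \<in> PU. g ` region vs = region vs}"
proof -
  let ?S = "{g \<in> PU. g ` region vs = region vs}"
  have "inj_on (\<lambda>g. restrict g (set vs)) ?S"
  proof (rule inj_onI)
    fix g f assume *: "g \<in> ?S" "f \<in> ?S" "restrict g (set vs) = restrict f (set vs)"
    have "g v = f v" if "v \<in> set vs" for v using fun_cong[OF *(3), of v] that by simp
    then show "g = f" using * PU_rigid by (intro rigid_eq_on_vertices) auto
  qed
  moreover have "(\<lambda>g. restrict g (set vs)) ` ?S \<subseteq> PiE (set vs) (\<lambda>_. set vs)"
  proof -
    have "g v \<in> set vs" if "g \<in> ?S" "v \<in> set vs" for g v
    proof (rule vertex_in_region[of v g])
      have "v \<in> region vs" using that set_vs_outline by (auto simp: region_def)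
      then show "g v \<in> region vs" using that by blast
    qed (use that in auto)
    then show ?thesis by auto
  qed
  moreover have "finite (PiE (set vs) (\<lambda>_. set vs))" by (intro finite_PiE) auto
  ultimately show ?thesis using finite_imageD finite_subset by blast
qed

text \<open>The summand 1 makes the bound strict and the constant positive.\<close>

definition diam :: real where "diam = diameter (region vs) + 1"

lemma diam_bound: "x \<in> region vs \<Longrightarrow> y \<in> region vs \<Longrightarrow> dist x y < diam"
  using diameter_bounded_bound[OF bounded_region] by (force simp: diam_def)

lemma diam_pos: "0 < diam"
  using diameter_ge_0[OF bounded_region] by (simp add: diam_def)

lemma tile_diam: "g \<in> PU \<Longrightarrow> x \<in> g ` region vs \<Longrightarrow> y \<in> g ` region vs \<Longrightarrow> dist x y < diam"
  using diam_bound rigid_dist[OF PU_rigid] by force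

text \<open>Tiles are counted through the images of an inner point \<open>q\<close>: if two of them
  are closer than the radius of a disc about \<open>q\<close> in the interior, their tiles overlap
  and coincide. The group elements yielding one tile form a coset of the finite stabilizer.\<close>

lemma locally_finite: "finite {g \<in> PU. g ` region vs \<inter> cball p R \<noteq> {}}"
proof -
  let ?A = "{g \<in> PU. g ` region vs \<inter> cball p R \<noteq> {}}"
  let ?T = "(\<lambda>g. g ` region vs) ` ?A"
  obtain q where q: "q \<in> core" using inside_nonempty by auto
  obtain e where e: "0 < e" "ball q e \<subseteq> core"
    using q open_inside_outline open_contains_ball by metis
  define rep where "rep \<tau> = (SOME g. g \<in> ?A \<and> g ` region vs = \<tau>)" for \<tau>
  have rep: "rep \<tau> \<in> ?A \<and> rep \<tau> ` region vs = \<tau>" if "\<tau> \<in> ?T" for \<tau>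
    unfolding rep_def using that by (intro someI_ex[where P="\<lambda>g. g \<in> ?A \<and> g ` region vs = \<tau>"]) blast
  have close: "g ` region vs = f ` region vs" if g: "g \<in> PU" and f: "f \<in> PU" and d: "dist (g q) (f q) < e" for g f
  proof -
    obtain g' where g': "g' \<in> PU" "g \<circ> g' = id" "g' \<circ> g = id" by (rule PU_inverse[OF g])
    have gg: "g (g' y) = y" for y using g'(2) by (metis comp_apply id_apply)
    have "dist q (g' (f q)) = dist (g q) (g (g' (f q)))"
      by (simp add: rigid_dist[OF PU_rigid[OF g]])
    also have "\<dots> < e" using d by (simp only: gg)
    finally have "g' (f q) \<in> core" using e by auto
    then have "f q \<in> g ` core" using gg by (metis image_eqI)
    moreover have "f q \<in> f ` core" using q by simp
    ultimately show ?thesis using tiles_disjoint[OF g f] by blast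
  qed
  have fin: "finite ((\<lambda>\<tau>. rep \<tau> q) ` ?T)"
  proof (rule separated_bounded_finite[OF _ e(1)])
    show "bounded ((\<lambda>\<tau>. rep \<tau> q) ` ?T)"
      unfolding bounded_def
    proof (intro exI)
    show "\<forall>x\<in>(\<lambda>\<tau>. rep \<tau> q) ` ?T. dist p x \<le> R + diam"
    proof
      fix x assume "x \<in> (\<lambda>\<tau>. rep \<tau> q) ` ?T"
      then obtain \<tau> where \<tau>: "\<tau> \<in> ?T" "x = rep \<tau> q" by blast
      have "rep \<tau> ` region vs \<inter> cball p R \<noteq> {}" using rep[OF \<tau>(1)] by blast
      then obtain y where y: "y \<in> rep \<tau> ` region vs" "y \<in> cball p R" by blast
      have "x \<in> rep \<tau> ` region vs" using \<tau> q core_subset_region by blast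
      then have "dist y x < diam" using tile_diam[of "rep \<tau>"] rep[OF \<tau>(1)] y by blast
      then show "dist p x \<le> R + diam" using y(2) dist_triangle[of p x y] by simp
    qed
    qed
  next
    fix x y assume xy: "x \<in> (\<lambda>\<tau>. rep \<tau> q) ` ?T" "y \<in> (\<lambda>\<tau>. rep \<tau> q) ` ?T" "dist x y < e"
    then obtain s t where st: "s \<in> ?T" "t \<in> ?T" "x = rep s q" "y = rep t q" by blast
    have "rep s ` region vs = rep t ` region vs"
      using xy(3) st rep[OF st(1)] rep[OF st(2)] by (intro close) blast+
    then have "s = t" using rep[OF st(1)] rep[OF st(2)] by metis
    then show "x = y" using st by simp
  qed
  have "inj_on (\<lambda>\<tau>. rep \<tau> q) ?T"
  proof (rule inj_onI)
    fix s t assume st: "s \<in> ?T" "t \<in> ?T" "rep s q = rep t q"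
    have "dist (rep s q) (rep t q) < e" using st(3) e(1) by simp
    then have "rep s ` region vs = rep t ` region vs"
      using rep[OF st(1)] rep[OF st(2)] by (intro close) blast+
    then show "s = t" using rep[OF st(1)] rep[OF st(2)] by metis
  qed
  then have finT: "finite ?T" using fin finite_imageD by blast
  have "finite {g \<in> ?A. g ` region vs = \<tau>}" if \<tau>: "\<tau> \<in> ?T" for \<tau>
  proof -
    have r: "rep \<tau> \<in> PU" "rep \<tau> ` region vs = \<tau>" using rep[OF \<tau>] by auto
    obtain r' where r': "r' \<in> PU" "rep \<tau> \<circ> r' = id" "r' \<circ> rep \<tau> = id" by (rule PU_inverse[OF r(1)])
    have "{g \<in> ?A. g ` region vs = \<tau>} \<subseteq> (\<lambda>s. rep \<tau> \<circ> s) ` {g \<in> PU. g ` region vs = region vs}"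
    proof
      fix g assume g: "g \<in> {g \<in> ?A. g ` region vs = \<tau>}"
      have "(r' \<circ> g) ` region vs = (r' \<circ> rep \<tau>) ` region vs"
        using g r by (simp only: image_comp[symmetric] mem_Collect_eq)
      then have "r' \<circ> g \<in> {g \<in> PU. g ` region vs = region vs}"
        using g PU_comp[OF r'(1)] r'(3) by auto
      moreover have "g = rep \<tau> \<circ> (r' \<circ> g)" by (simp only: o_assoc r'(2) id_comp)
      ultimately show "g \<in> (\<lambda>s. rep \<tau> \<circ> s) ` {g \<in> PU. g ` region vs = region vs}" by blast
    qed
    then show ?thesis using finite_stabilizer finite_subset by blast
  qed
  then have "finite (\<Union>\<tau>\<in>?T. {g \<in> ?A. g ` region vs = \<tau>})" using finT by blast
  moreover have "?A \<subseteq> (\<Union>\<tau>\<in>?T. {g \<in> ?A. g ` region vs = \<tau>})" by blast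
  ultimately show ?thesis using finite_subset by blast
qed

lemma rotation_fixed_point:
  assumes g: "rigid g" "lin_part g = rotation_by \<alpha> \<beta>" and ne: "(\<alpha>, \<beta>) \<noteq> (1, 0)"
  obtains c where "g c = c"
proof -
  define D where "D = (1 - \<alpha>) * (1 - \<alpha>) + \<beta> * \<beta>"
  have "D \<noteq> 0" using ne unfolding D_def by (auto simp: sum_squares_eq_zero_iff)
  \<comment> \<open>The centre solves a linear system with matrix identity minus rotation.
    \<open>D\<close> is its determinant and \<open>d\<close> the adjugate matrix applied to
    \<open>g 0\<close>, so the centre is \<open>d\<close> divided by \<open>D\<close>.\<close>
  define d where "d = (1 - \<alpha>) *\<^sub>R g 0 + \<beta> *\<^sub>R perp (g 0)"
  have key: "D *\<^sub>R g 0 + rotation_by \<alpha> \<beta> d = d"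
    unfolding d_def D_def rotation_by_def by (simp add: vec2_eq_iff algebra_simps)
  have "g ((1 / D) *\<^sub>R d) = g 0 + (1 / D) *\<^sub>R rotation_by \<alpha> \<beta> d"
    using lin_part_add[OF g(1), of 0 "1 / D" d] g(2) by simp
  also have "\<dots> = (1 / D) *\<^sub>R (D *\<^sub>R g 0 + rotation_by \<alpha> \<beta> d)"
    using \<open>D \<noteq> 0\<close> by (simp add: algebra_simps)
  finally show ?thesis using key that by metis
qed

text \<open>A rotation in the group is conjugate to one whose centre lies in the polygon itself, and
  conjugation preserves the angle up to sign. So only finitely many angles occur.\<close>

lemma finite_lin_part: "finite (lin_part ` PU)"
proof -
  obtain q where q: "q \<in> core" using inside_nonempty by auto
  define F where "F = {g \<in> PU. g ` region vs \<inter> cball q diam \<noteq> {}}"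
  have finF: "finite F" unfolding F_def by (rule locally_finite)
  define B where "B = {(\<alpha>, \<beta>). rotation_by \<alpha> \<beta> \<in> lin_part ` F}"
  have inj: "inj (\<lambda>(a, b). rotation_by a b)" by (auto simp: inj_def rotation_by_inject)
  have "B = (\<lambda>(a, b). rotation_by a b) -` (lin_part ` F)" by (auto simp: B_def)
  then have finB: "finite B" using finite_vimageI[OF _ inj] finF by simp
  \<comment> \<open>The pair \<open>(1, 0)\<close> stands for translations, which have no centre.
    The pairs \<open>(a, - b)\<close> occur because an orientation reversing conjugation reverses
    the angle.\<close>
  let ?B = "insert (1, 0) (B \<union> (\<lambda>(a, b). (a, - b)) ` B)"
  have rot: "f \<in> (\<lambda>(a, b). rotation_by a b) ` ?B" if f: "f \<in> lin_part ` PU" "f = rotation_by \<alpha> \<beta>" for f \<alpha> \<beta>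
  proof (cases "(\<alpha>, \<beta>) = (1, 0)")
    case True then show ?thesis using f by auto
  next
    case False
    obtain g where g: "g \<in> PU" "lin_part g = rotation_by \<alpha> \<beta>" using f by auto
    obtain c where c: "g c = c" using rotation_fixed_point[OF PU_rigid[OF g(1)] g(2) False] by auto
    obtain k where k: "k \<in> PU" "c \<in> k ` region vs" by (rule tiles_cover)
    then obtain y where y: "y \<in> region vs" "c = k y" by blast
    obtain k' where k': "k' \<in> PU" "k \<circ> k' = id" "k' \<circ> k = id" by (rule PU_inverse[OF k(1)])
    have k'k: "k' (k x) = x" for x using k'(3) by (metis comp_apply id_apply)
    have rk: "rigid k" "rigid k'" "rigid g" using PU_rigid k k' g by auto
    have lk: "lin_part k' (lin_part k x) = x" for x
      using lin_part_comp[OF rk(2), of k] k'(3) by (metis comp_apply id_apply lin_part_id)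
    define g' where "g' = k' \<circ> (g \<circ> k)"
    have g'P: "g' \<in> PU" unfolding g'_def by (intro PU_comp k k' g)
    have "g' y = y" unfolding g'_def using y c k'k by simp
    then have "y \<in> g' ` region vs \<inter> cball q diam"
      using y diam_bound[of q y] q core_subset_region by (metis IntI image_eqI less_imp_le mem_cball subsetD)
    then have g'F: "g' \<in> F" using g'P by (auto simp: F_def)
    have lg': "lin_part g' x = lin_part k' (\<alpha> *\<^sub>R lin_part k x + \<beta> *\<^sub>R perp (lin_part k x))" for x
      unfolding g'_def using lin_part_comp[OF rk(2)] lin_part_comp[OF rk(3)] g(2)
      by (metis comp_apply rotation_by_def)
    have lin': "linear (lin_part k')" by (rule rigid_linear[OF rk(2)])
    have "orthogonal_transformation (lin_part k)" using rk by (simp add: rigid_def)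
    then consider (rot) a b where "lin_part k = rotation_by a b" | (refl) "\<forall>x. lin_part k (perp x) = - perp (lin_part k x)"
      by (rule orthogonal_plane_cases)
    then show ?thesis
    proof cases
      case rot
      have "perp (lin_part k x) = lin_part k (perp x)" for x
        unfolding rot rotation_by_def by (simp add: perp_add perp_scaleR)
      then have "lin_part g' = rotation_by \<alpha> \<beta>"
        unfolding fun_eq_iff lg' rotation_by_def
        by (simp add: linear_add[OF lin'] linear_scale[OF lin'] lk)
      then have "(\<alpha>, \<beta>) \<in> B" using g'F by (auto simp: B_def intro: rev_image_eqI)
      then show ?thesis using f by auto
    next
      case refl
      have "perp (lin_part k x) = lin_part k (- perp x)" for x
        using spec[OF refl, of x] linear_neg[OF rigid_linear[OF rk(1)], of "perp x"] by simp
      then have "lin_part g' = rotation_by \<alpha> (- \<beta>)"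
        unfolding fun_eq_iff lg' rotation_by_def
        by (simp add: linear_add[OF lin'] linear_scale[OF lin'] lk)
      then have "(\<alpha>, - \<beta>) \<in> B" using g'F by (auto simp: B_def intro: rev_image_eqI)
      then have "(\<alpha>, \<beta>) \<in> (\<lambda>(a, b). (a, - b)) ` B" by force
      then show ?thesis using f by auto
    qed
  qed
  define X where "X = (\<lambda>(a, b). rotation_by a b) ` ?B"
  have finX: "finite X" using finB by (simp add: X_def)
  define Y where "Y = {f \<in> lin_part ` PU. \<forall>x. f (perp x) = - perp (f x)}"
  have "lin_part ` PU \<subseteq> X \<union> Y"
  proof
    fix f assume f: "f \<in> lin_part ` PU"
    then have "orthogonal_transformation f" using PU_rigid by (auto simp: rigid_def)
    then show "f \<in> X \<union> Y"
      by (cases rule: orthogonal_plane_cases) (use rot f in \<open>auto simp: X_def Y_def\<close>)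
  qed
  moreover have "finite Y"
  proof (cases "Y = {}")
    case False
    then obtain f0 where f0: "f0 \<in> Y" by blast
    then obtain g0 where g0: "g0 \<in> PU" "f0 = lin_part g0" by (auto simp: Y_def)
    \<comment> \<open>Composition with one fixed orientation reversing element \<open>f0\<close>
      maps all such elements injectively to rotations, of which there are finitely many.\<close>
    have inj: "inj_on (\<lambda>f. f0 \<circ> f) Y"
    proof (rule inj_onI)
      fix f f' assume "f0 \<circ> f = f0 \<circ> f'"
      then have "f0 (f x) = f0 (f' x)" for x by (metis comp_apply)
      moreover have "inj f0" using PU_rigid[OF g0(1)] g0(2) by (simp add: rigid_def orthogonal_transformation_inj)
      ultimately show "f = f'" by (intro ext) (meson injD)
    qed
    moreover have "(\<lambda>f. f0 \<circ> f) ` Y \<subseteq> X"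
    proof
      fix u assume "u \<in> (\<lambda>f. f0 \<circ> f) ` Y"
      then obtain f g where f: "u = f0 \<circ> f" "f \<in> Y" "g \<in> PU" "f = lin_part g" by (auto simp: Y_def)
      have u: "u = lin_part (g0 \<circ> g)" using f g0 lin_part_comp[OF PU_rigid[OF g0(1)]] by simp
      then have uP: "u \<in> lin_part ` PU" using PU_comp[OF g0(1) f(3)] by blast
      have "orthogonal_transformation u" using u PU_rigid[OF PU_comp[OF g0(1) f(3)]] by (simp add: rigid_def)
      then show "u \<in> X"
      proof (cases rule: orthogonal_plane_cases)
        case (1 \<alpha> \<beta>) then show ?thesis using rot[OF uP] by (simp add: X_def)
      next
        case 2
        have l0: "linear f0" using g0 PU_rigid rigid_linear by blast
        have fp: "f (perp x) = - perp (f x)" "f0 (perp x) = - perp (f0 x)" for x using f(2) f0 by (auto simp: Y_def)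
        \<comment> \<open>Two orientation reversals cancel. Together with the assumption of this
          case, \<open>u\<close> would have to kill a unit vector.\<close>
        have "u (perp x) = perp (u x)" for x
          unfolding f(1) comp_apply fp(1) using linear_neg[OF l0, of "perp (f x)"] fp(2) by simp
        then have "perp (u x) = - perp (u x)" for x using 2 by metis
        then have "u (vector [1, 0]) = 0" by (simp add: vec2_eq_iff)
        then have "norm (vector [1, 0] :: real^2) = 0"
          using \<open>orthogonal_transformation u\<close> orthogonal_transformation_norm by (metis norm_zero)
        then show ?thesis by (simp add: vec2_eq_iff)
      qed
    qed
    ultimately show ?thesis using finX finite_subset finite_imageD by blast
  qed simp
  ultimately show ?thesis using finX finite_subset by blast
qed

end

subsection \<open>Lattice points and vertices in a strip\<close>

text \<open>Pigeonhole: lattice points near equally spaced points of the line have bounded offsets,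
  so two of them agree in offset up to \<open>\<epsilon>\<close>. Their difference is long in the
  direction \<open>\<theta>\<close>, hence nonzero, and \<open>nz\<close> makes its offset
  nonzero.\<close>

lemma lattice_thin_strip:
  fixes L :: "(real^2) set"
  assumes diff: "\<forall>a\<in>L. \<forall>b\<in>L. a - b \<in> L"
    and dense: "\<forall>p. \<exists>b\<in>L. dist p b \<le> R"
    and nz: "\<forall>b\<in>L. b \<bullet> perp \<theta> = 0 \<longrightarrow> b = 0"
    and \<theta>: "\<theta> \<noteq> 0" and \<epsilon>: "0 < \<epsilon>" and T: "0 \<le> T"
  obtains b where "b \<in> L" "0 < b \<bullet> perp \<theta>" "b \<bullet> perp \<theta> < \<epsilon>" "T < \<bar>b \<bullet> \<theta>\<bar>"
proof -
  define n where "n = norm \<theta>"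
  have n: "0 < n" using \<theta> by (simp add: n_def)
  have R: "0 \<le> R" using spec[OF dense, of 0] zero_le_dist order_trans by blast
  \<comment> \<open>The spacing contributes \<open>2 * R * n + T + 1\<close> to the advance; the
    approximation errors at both ends cost at most \<open>2 * R * n\<close>, which leaves more than
    \<open>T\<close>.\<close>
  define c where "c = (2 * R * n + T + 1) / (n * n)"
  have c: "c * (n * n) = 2 * R * n + T + 1" using n by (simp add: c_def)
  obtain b where b: "b k \<in> L" "dist ((c * real k) *\<^sub>R \<theta>) (b k) \<le> R" for k
  proof -
    have "\<forall>k. \<exists>b. b \<in> L \<and> dist ((c * real k) *\<^sub>R \<theta>) b \<le> R" using dense by blast
    from choice[OF this] show ?thesis using that by blast
  qed
  have s: "\<bar>b k \<bullet> perp \<theta>\<bar> \<le> R * n" for k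
  proof -
    have "b k \<bullet> perp \<theta> = (b k - (c * real k) *\<^sub>R \<theta>) \<bullet> perp \<theta>" by (simp add: inner_diff_left)
    also have "\<bar>\<dots>\<bar> \<le> norm (b k - (c * real k) *\<^sub>R \<theta>) * norm (perp \<theta>)"
      by (rule Cauchy_Schwarz_ineq2)
    also have "\<dots> \<le> R * n"
      using b(2)[of k] by (intro mult_mono) (auto simp: n_def dist_norm norm_minus_commute R)
    finally show ?thesis .
  qed
  have t: "\<bar>b k \<bullet> \<theta> - c * real k * (n * n)\<bar> \<le> R * n" for k
  proof -
    have "b k \<bullet> \<theta> - c * real k * (n * n) = (b k - (c * real k) *\<^sub>R \<theta>) \<bullet> \<theta>"
      by (simp add: inner_diff_left n_def power2_norm_eq_inner[symmetric] power2_eq_square)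
    also have "\<bar>\<dots>\<bar> \<le> norm (b k - (c * real k) *\<^sub>R \<theta>) * norm \<theta>"
      by (rule Cauchy_Schwarz_ineq2)
    also have "\<dots> \<le> R * n"
      using b(2)[of k] by (intro mult_mono) (auto simp: n_def dist_norm norm_minus_commute R)
    finally show ?thesis .
  qed
  have gap: "T < \<bar>(b k - b j) \<bullet> \<theta>\<bar>" if "j < k" for j k
  proof -
    have "c * (n * n) * 1 \<le> c * (n * n) * (real k - real j)"
      using that c n R T by (intro mult_left_mono) auto
    then have "2 * R * n + T + 1 \<le> c * real k * (n * n) - c * real j * (n * n)"
    proof -
      have "c * real k * (n * n) - c * real j * (n * n) = c * (n * n) * (real k - real j)"
        by (simp add: algebra_simps)
      then show ?thesis using \<open>c * (n * n) * 1 \<le> _\<close> c by linarith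
    qed
    then show ?thesis using t[of k] t[of j] by (simp add: inner_diff_left)
  qed
  let ?f = "\<lambda>k. \<lfloor>(b k \<bullet> perp \<theta>) / \<epsilon>\<rfloor>"
  have "range ?f \<subseteq> {\<lfloor>- (R * n) / \<epsilon>\<rfloor>..\<lfloor>(R * n) / \<epsilon>\<rfloor>}"
  proof -
    have "- (R * n) \<le> b k \<bullet> perp \<theta>" "b k \<bullet> perp \<theta> \<le> R * n" for k
      using s[of k] by linarith+
    then have "- (R * n) / \<epsilon> \<le> b k \<bullet> perp \<theta> / \<epsilon>" "b k \<bullet> perp \<theta> / \<epsilon> \<le> R * n / \<epsilon>" for k
      using less_imp_le[OF \<epsilon>] by (intro divide_right_mono; blast)+
    then show ?thesis by (auto intro!: floor_mono simp del: minus_divide_left)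
  qed
  then have "finite (range ?f)" using finite_subset by blast
  then have "\<not> inj ?f" using finite_imageD by blast
  then obtain i j where ij: "i \<noteq> j" "?f i = ?f j" by (auto simp: inj_def)
  note fin = that
  have main: ?thesis if "j < k" "?f j = ?f k" for j k
  proof -
    define a where "a = b k - b j"
    have a: "a \<in> L" using diff b by (simp add: a_def)
    have tg: "T < \<bar>a \<bullet> \<theta>\<bar>" using gap[OF that(1)] by (simp add: a_def)
    then have "a \<bullet> perp \<theta> \<noteq> 0" using nz a T by auto
    have "\<bar>(b k \<bullet> perp \<theta>) / \<epsilon> - (b j \<bullet> perp \<theta>) / \<epsilon>\<bar> < 1" using that(2) by linarith
    then have "\<bar>a \<bullet> perp \<theta>\<bar> / \<epsilon> < 1"
      using \<epsilon> by (simp add: a_def inner_diff_left diff_divide_distrib[symmetric])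
    then have small: "\<bar>a \<bullet> perp \<theta>\<bar> < \<epsilon>" using \<epsilon> by simp
    show ?thesis
    proof (cases "0 < a \<bullet> perp \<theta>")
      case True then show ?thesis using a tg small by (intro fin[of a]) auto
    next
      case False
      have "a - a \<in> L" "(a - a) - a \<in> L" using diff a by blast+
      then have "- a \<in> L" by simp
      then show ?thesis using False \<open>a \<bullet> perp \<theta> \<noteq> 0\<close> tg small by (intro fin[of "- a"]) auto
    qed
  qed
  show ?thesis using main[of i j] main[of j i] ij by (cases "i < j") auto
qed

text \<open>A second vector \<open>b'\<close> is taken with smaller offset and longer advance than
  \<open>b\<close>. If both advance in the wrong sense, \<open>b - b'\<close> advances in the right
  one, and its offset is still positive and small. Negating the backward vector gives
  \<open>\<nu>\<close>.\<close>

lemma lattice_steps: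
  fixes L :: "(real^2) set"
  assumes diff: "\<forall>a\<in>L. \<forall>b\<in>L. a - b \<in> L"
    and dense: "\<forall>p. \<exists>b\<in>L. dist p b \<le> R"
    and nz: "\<forall>b\<in>L. b \<bullet> perp \<theta> = 0 \<longrightarrow> b = 0"
    and \<theta>: "\<theta> \<noteq> 0" and \<epsilon>: "0 < \<epsilon>"
  obtains \<mu> \<nu> where "\<mu> \<in> L" "\<nu> \<in> L" "0 < \<mu> \<bullet> perp \<theta>" "\<mu> \<bullet> perp \<theta> < \<epsilon>" "0 < \<mu> \<bullet> \<theta>"
    "- \<epsilon> < \<nu> \<bullet> perp \<theta>" "\<nu> \<bullet> perp \<theta> < 0" "0 < \<nu> \<bullet> \<theta>"
proof -
  note thin = lattice_thin_strip[OF diff dense nz \<theta>]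
  have "\<exists>a\<in>L. 0 < a \<bullet> perp \<theta> \<and> a \<bullet> perp \<theta> < \<epsilon> \<and> 0 < e * (a \<bullet> \<theta>)" if e: "e = 1 \<or> e = -1" for e :: real
  proof -
    obtain b where b: "b \<in> L" "0 < b \<bullet> perp \<theta>" "b \<bullet> perp \<theta> < \<epsilon>" "0 < \<bar>b \<bullet> \<theta>\<bar>"
      using thin[OF \<epsilon> order_refl] by blast
    obtain b' where b': "b' \<in> L" "0 < b' \<bullet> perp \<theta>" "b' \<bullet> perp \<theta> < b \<bullet> perp \<theta>" "\<bar>b \<bullet> \<theta>\<bar> < \<bar>b' \<bullet> \<theta>\<bar>"
      using thin[OF b(2), of "\<bar>b \<bullet> \<theta>\<bar>"] by auto
    have d: "b - b' \<in> L" "0 < (b - b') \<bullet> perp \<theta>" "(b - b') \<bullet> perp \<theta> < \<epsilon>"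
      using diff b b' by (auto simp: inner_diff_left)
    show ?thesis
    proof (cases "0 < e * (b \<bullet> \<theta>) \<or> 0 < e * (b' \<bullet> \<theta>)")
      case True
      then show ?thesis
      proof
        assume "0 < e * (b \<bullet> \<theta>)" then show ?thesis using b by blast
      next
        assume "0 < e * (b' \<bullet> \<theta>)" then show ?thesis using b b' by (intro bexI[of _ b']) auto
      qed
    next
      case False
      then have "0 < e * ((b - b') \<bullet> \<theta>)" using e b(4) b'(4) by (auto simp: inner_diff_left)
      then show ?thesis using d by blast
    qed
  qed
  from this[of 1] this[of "-1"] obtain a a' where a: "a \<in> L" "0 < a \<bullet> perp \<theta>" "a \<bullet> perp \<theta> < \<epsilon>" "0 < a \<bullet> \<theta>"
    and a': "a' \<in> L" "0 < a' \<bullet> perp \<theta>" "a' \<bullet> perp \<theta> < \<epsilon>" "a' \<bullet> \<theta> < 0" by auto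
  have "(a' - a') - a' \<in> L" using diff a' by blast
  then have "- a' \<in> L" by simp
  then show ?thesis using a a' by (intro that[of a "- a'"]) auto
qed

text \<open>A steered walk: \<open>\<nu>\<close> is added at positive offset and
  \<open>\<mu>\<close> otherwise. As each step changes the offset by less than
  \<open>\<epsilon>\<close> towards the other side, the walk stays in the strip; it advances
  strictly, by at most \<open>\<tau>\<close> each time, so its points are distinct and reach only
  linear depth.\<close>

lemma strip_points:
  fixes L V :: "(real^2) set"
  assumes diff: "\<forall>a\<in>L. \<forall>b\<in>L. a - b \<in> L"
    and dense: "\<forall>p. \<exists>b\<in>L. dist p b \<le> R"
    and nz: "\<forall>b\<in>L. b \<bullet> perp \<theta> = 0 \<longrightarrow> b = 0"
    and \<theta>: "\<theta> \<noteq> 0" and \<epsilon>: "0 < \<epsilon>"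
    and V: "v \<in> V" "\<forall>a\<in>V. \<forall>b\<in>L. a + b \<in> V"
  obtains t\<^sub>0 \<tau> where "0 < t\<^sub>0" "0 < \<tau>"
    "\<And>K. \<exists>W\<subseteq>V. finite W \<and> card W = K \<and>
       (\<forall>w\<in>W. \<bar>(w - q) \<bullet> perp \<theta>\<bar> < \<epsilon> \<and> 0 < (w - q) \<bullet> \<theta> \<and> (w - q) \<bullet> \<theta> \<le> t\<^sub>0 + real K * \<tau>)"
proof -
  obtain \<mu> \<nu> where mn: "\<mu> \<in> L" "\<nu> \<in> L" "0 < \<mu> \<bullet> perp \<theta>" "\<mu> \<bullet> perp \<theta> < \<epsilon>" "0 < \<mu> \<bullet> \<theta>"
    "- \<epsilon> < \<nu> \<bullet> perp \<theta>" "\<nu> \<bullet> perp \<theta> < 0" "0 < \<nu> \<bullet> \<theta>"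
    by (rule lattice_steps[OF diff dense nz \<theta> \<epsilon>])
  let ?s = "\<lambda>w. (w - q) \<bullet> perp \<theta>" and ?t = "\<lambda>w. (w - q) \<bullet> \<theta>"
  have st: "?s (w + a) = ?s w + a \<bullet> perp \<theta>" "?t (w + a) = ?t w + a \<bullet> \<theta>" for w a
    by (simp_all add: inner_diff_left inner_add_left)
  have mult: "w + real k *\<^sub>R a \<in> V" if "w \<in> V" "a \<in> L" for w a and k :: nat
  proof (induction k)
    case (Suc k)
    then have "(w + real k *\<^sub>R a) + a \<in> V" using V(2) that by blast
    then show ?case by (simp add: algebra_simps)
  qed (use that in simp)
  \<comment> \<open>A lattice vector close to a remote point of the line pushes \<open>v\<close>
    past \<open>q\<close>; \<open>c\<close> is large enough to outweigh both the initial position of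
    \<open>v\<close> and the error \<open>R\<close>.\<close>
  obtain v1 where v1: "v1 \<in> V" "0 < ?t v1"
  proof -
    define c where "c = (\<bar>?t v\<bar> + R * norm \<theta> + 1) / (norm \<theta> * norm \<theta>)"
    have c: "c * (norm \<theta> * norm \<theta>) = \<bar>?t v\<bar> + R * norm \<theta> + 1" using \<theta> by (simp add: c_def)
    obtain b where b: "b \<in> L" "dist (c *\<^sub>R \<theta>) b \<le> R" using dense by blast
    have "\<bar>(b - c *\<^sub>R \<theta>) \<bullet> \<theta>\<bar> \<le> norm (b - c *\<^sub>R \<theta>) * norm \<theta>" by (rule Cauchy_Schwarz_ineq2)
    also have "\<dots> \<le> R * norm \<theta>" using b(2) by (intro mult_right_mono) (auto simp: dist_norm norm_minus_commute)
    finally have "b \<bullet> \<theta> \<ge> c * (norm \<theta> * norm \<theta>) - R * norm \<theta>"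
      by (simp add: inner_diff_left power2_norm_eq_inner[symmetric] power2_eq_square abs_le_iff)
    then have "0 < ?t (v + b)" unfolding st c by linarith
    then show ?thesis using that V b by blast
  qed
  \<comment> \<open>Entering the strip: steps of one kind reduce the offset of \<open>v1\<close>,
    and rounding their ideal number \<open>r\<close> down leaves less than one step.\<close>
  obtain w0 where w0: "w0 \<in> V" "0 < ?t w0" "\<bar>?s w0\<bar> < \<epsilon>"
  proof -
    define d where "d = (if 0 < ?s v1 then \<nu> else \<mu>)"
    have dL: "d \<in> L" "0 < d \<bullet> \<theta>" "d \<bullet> perp \<theta> \<noteq> 0" "\<bar>d \<bullet> perp \<theta>\<bar> < \<epsilon>" using mn by (auto simp: d_def)
    define r where "r = - ?s v1 / (d \<bullet> perp \<theta>)"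
    have r: "0 \<le> r" "?s v1 = - r * (d \<bullet> perp \<theta>)"
      using mn dL(3) by (auto simp: r_def d_def divide_le_0_iff zero_le_divide_iff)
    define k where "k = nat \<lfloor>r\<rfloor>"
    have k: "real k \<le> r" "r < real k + 1" using r(1) by (auto simp: k_def)
    have "?s (v1 + real k *\<^sub>R d) = (real k - r) * (d \<bullet> perp \<theta>)"
      unfolding st r(2) by (simp add: algebra_simps)
    moreover have "\<bar>(real k - r) * (d \<bullet> perp \<theta>)\<bar> \<le> 1 * \<bar>d \<bullet> perp \<theta>\<bar>"
      unfolding abs_mult using k by (intro mult_right_mono) auto
    ultimately have "\<bar>?s (v1 + real k *\<^sub>R d)\<bar> < \<epsilon>" using dL(4) by simp
    moreover have "0 < ?t (v1 + real k *\<^sub>R d)"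
      unfolding st using v1(2) dL(2) by (simp add: add_pos_nonneg)
    ultimately show ?thesis using that mult[OF v1(1) dL(1)] by blast
  qed
  define step where "step w = (if 0 < ?s w then w + \<nu> else w + \<mu>)" for w
  define w where "w n = (step ^^ n) w0" for n
  define \<tau> where "\<tau> = max (\<mu> \<bullet> \<theta>) (\<nu> \<bullet> \<theta>)"
  have w_Suc: "w (Suc n) = step (w n)" for n by (simp add: w_def)
  have w: "w n \<in> V \<and> \<bar>?s (w n)\<bar> < \<epsilon> \<and> 0 < ?t (w n) \<and> ?t (w n) \<le> ?t w0 + real n * \<tau>" for n
  proof (induction n)
    case 0 then show ?case using w0 by (simp add: w_def)
  next
    case (Suc n)
    then have "w (Suc n) \<in> V" using V(2) mn by (simp add: w_Suc step_def)
    moreover have "\<bar>?s (step (w n))\<bar> < \<epsilon>"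
      using Suc mn by (auto simp: step_def st)
    moreover have "?t (w n) < ?t (step (w n)) \<and> ?t (step (w n)) \<le> ?t (w n) + \<tau>"
      using mn by (auto simp: step_def st \<tau>_def)
    ultimately show ?case using Suc by (auto simp: w_Suc algebra_simps)
  qed
  have "?t (w n) < ?t (w (Suc n))" for n
    using mn by (auto simp: w_Suc step_def st)
  then have "strict_mono (\<lambda>n. ?t (w n))" by (rule strict_mono_Suc_iff[THEN iffD2, rule_format])
  then have injw: "inj w" by (metis injI strict_mono_eq)
  have \<tau>: "0 < \<tau>" using mn by (simp add: \<tau>_def less_max_iff_disj)
  show ?thesis
  proof (rule that[OF w0(2) \<tau>])
    fix K
    have "?t (w n) \<le> ?t w0 + real K * \<tau>" if "n < K" for n
    proof -
      have "real n * \<tau> \<le> real K * \<tau>" using that \<tau> by (intro mult_right_mono) auto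
      then show ?thesis using w[of n] by linarith
    qed
    then show "\<exists>W\<subseteq>V. finite W \<and> card W = K \<and>
       (\<forall>w\<in>W. \<bar>?s w\<bar> < \<epsilon> \<and> 0 < ?t w \<and> ?t w \<le> ?t w0 + real K * \<tau>)"
      using w injw by (intro exI[of _ "w ` {..<K}"])
        (auto simp: card_image inj_on_subset)
  qed
qed

context tiling
begin

section \<open>Skeleton, vertices and translations of the plane tiling\<close>

definition Skel :: "(real^2) set" where "Skel = (\<Union>g\<in>PU. g ` outline vs)"
definition Vert :: "(real^2) set" where "Vert = (\<Union>g\<in>PU. g ` set vs)"
definition Lat :: "(real^2) set" where "Lat = {b. (\<lambda>x. x + b) \<in> PU}"

lemma countable_Vert: "countable Vert"
  unfolding Vert_def using countable_PU by (intro countable_UN countable_image) (auto intro: countable_finite)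

lemma Skel_image:
  assumes "g \<in> PU" "x \<in> Skel" shows "g x \<in> Skel"
proof -
  obtain f y where f: "f \<in> PU" "y \<in> outline vs" "x = f y" using assms(2) by (auto simp: Skel_def)
  then have "g x = (g \<circ> f) y" by simp
  then show ?thesis unfolding Skel_def using PU_comp[OF assms(1) f(1)] f(2) by blast
qed

lemma Vert_image:
  assumes "g \<in> PU" "x \<in> Vert" shows "g x \<in> Vert"
proof -
  obtain f y where f: "f \<in> PU" "y \<in> set vs" "x = f y" using assms(2) by (auto simp: Vert_def)
  then have "g x = (g \<circ> f) y" by simp
  then show ?thesis unfolding Vert_def using PU_comp[OF assms(1) f(1)] f(2) by blast
qed

lemma tile_core_not_Skel: "g \<in> PU \<Longrightarrow> x \<in> g ` core \<Longrightarrow> x \<notin> Skel"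
  using core_not_outline by (auto simp: Skel_def)

lemma core_not_Skel: "x \<in> core \<Longrightarrow> x \<notin> Skel"
  using tile_core_not_Skel[OF PU_id, of x] by simp

lemma outline_Skel: "outline vs \<subseteq> Skel"
proof -
  have "id ` outline vs \<subseteq> Skel" unfolding Skel_def using PU_id by blast
  then show ?thesis by simp
qed

lemma vertex_Vert: "set vs \<subseteq> Vert"
proof -
  have "id ` set vs \<subseteq> Vert" unfolding Vert_def using PU_id by blast
  then show ?thesis by simp
qed

lemma Skel_region: "x \<in> region vs \<Longrightarrow> x \<in> Skel \<longleftrightarrow> x \<in> outline vs"
  using core_not_Skel outline_Skel by (auto simp: region_def)

lemma Vert_region: "x \<in> region vs \<Longrightarrow> x \<in> Vert \<longleftrightarrow> x \<in> set vs"
  using vertex_in_region vertex_Vert unfolding Vert_def by blast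

text \<open>A segment that misses the skeleton cannot leave the tile in which it starts, and a tile
  is too small to contain it.\<close>

lemma skel_hit:
  assumes "diam \<le> dist x y"
  obtains u where "0 \<le> u" "u \<le> 1" "x + u *\<^sub>R (y - x) \<in> Skel"
proof (rule ccontr)
  assume c: "\<not> thesis"
  note hit = that
  have "x + u *\<^sub>R (y - x) \<notin> Skel" if u: "0 \<le> u" "u \<le> 1" for u
    using c hit[OF u] by blast
  then have seg: "z \<notin> Skel" if z: "z \<in> closed_segment x y" for z
  proof -
    obtain u where u: "z = (1 - u) *\<^sub>R x + u *\<^sub>R y" "0 \<le> u" "u \<le> 1"
      using z unfolding closed_segment_def by blast
    have "z = x + u *\<^sub>R (y - x)" unfolding u(1) by (simp add: algebra_simps)
    then show ?thesis using \<open>\<And>u. 0 \<le> u \<Longrightarrow> u \<le> 1 \<Longrightarrow> x + u *\<^sub>R (y - x) \<notin> Skel\<close> u by blast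
  qed
  obtain g where g: "g \<in> PU" "x \<in> g ` region vs" by (rule tiles_cover)
  have c: "closed (g ` region vs)"
    by (intro compact_imp_closed compact_continuous_image rigid_continuous PU_rigid g compact_region)
  have "frontier (g ` region vs) \<subseteq> g ` outline vs"
    unfolding frontier_def rigid_interior[OF PU_rigid[OF g(1)]] interior_region closure_closed[OF c]
    by (auto simp: region_def)
  then have "frontier (g ` region vs) \<inter> closed_segment x y = {}" using seg g(1) by (auto simp: Skel_def)
  moreover have "closed_segment x y \<inter> g ` region vs \<noteq> {}" using g(2) by auto
  ultimately have "closed_segment x y - g ` region vs = {}"
    using connected_Int_frontier[of "closed_segment x y" "g ` region vs"] by (metis Int_commute connected_segment(1))
  then have "y \<in> g ` region vs" by (metis Diff_eq_empty_iff ends_in_segment(2) subsetD)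
  then show False using tile_diam[OF g] assms by fastforce
qed

lemma Lat_Vert: "v \<in> Vert \<Longrightarrow> b \<in> Lat \<Longrightarrow> v + b \<in> Vert"
  using Vert_image[of "\<lambda>x. x + b" v] by (simp add: Lat_def)

lemma Lat_diff: assumes "a \<in> Lat" "b \<in> Lat" shows "a - b \<in> Lat"
proof -
  have ab: "(\<lambda>x. x + a) \<in> PU" "(\<lambda>x. x + b) \<in> PU" using assms by (auto simp: Lat_def)
  obtain g where g: "g \<in> PU" "(\<lambda>x. x + b) \<circ> g = id" by (rule PU_inverse[OF ab(2)])
  have "g x + b = x" for x using fun_cong[OF g(2), of x] by simp
  then have "g = (\<lambda>x. x - b)" by (simp add: fun_eq_iff eq_diff_eq)
  then have "(\<lambda>x. x + a) \<circ> (\<lambda>x. x - b) \<in> PU" using PU_comp[OF ab(1) g(1)] by simp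
  moreover have "(\<lambda>x. x + a) \<circ> (\<lambda>x. x - b) = (\<lambda>x. x + (a - b))" by (simp add: fun_eq_iff)
  ultimately show ?thesis by (simp add: Lat_def)
qed

text \<open>One group element is fixed for each of the finitely many linear parts. An element whose
  tile contains \<open>p\<close> differs from the fixed one with the same linear part by a
  translation, so \<open>R\<close> only has to bound the finitely many fixed tiles.\<close>

lemma Lat_dense: obtains R where "\<And>p. \<exists>b\<in>Lat. dist p b \<le> R"
proof -
  define rep where "rep A = (SOME g. g \<in> PU \<and> lin_part g = A)" for A
  have rep: "rep A \<in> PU \<and> lin_part (rep A) = A" if "A \<in> lin_part ` PU" for A
    unfolding rep_def using that by (intro someI_ex[where P="\<lambda>g. g \<in> PU \<and> lin_part g = A"]) blast
  let ?K = "\<Union>A\<in>lin_part ` PU. rep A ` region vs"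
  have "bounded ?K"
    using finite_lin_part rep by (intro bounded_UN ballI compact_imp_bounded compact_continuous_image compact_region rigid_continuous PU_rigid) auto
  then obtain R where R: "\<And>x. x \<in> ?K \<Longrightarrow> norm x \<le> R" by (metis bounded_iff)
  have "\<exists>b\<in>Lat. dist p b \<le> R" for p
  proof -
    obtain g where g: "g \<in> PU" "p \<in> g ` region vs" by (rule tiles_cover)
    then obtain y where y: "y \<in> region vs" "p = g y" by blast
    let ?f = "rep (lin_part g)"
    have f: "?f \<in> PU" "lin_part ?f = lin_part g" using rep g(1) by auto
    obtain f' where f': "f' \<in> PU" "?f \<circ> f' = id" "f' \<circ> ?f = id" by (rule PU_inverse[OF f(1)])
    define b where "b = (g \<circ> f') 0"
    have ff: "f' (?f x) = x" for x using f'(3) by (metis comp_apply id_apply)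
    have "lin_part (g \<circ> f') = lin_part (?f \<circ> f')"
      by (simp only: lin_part_comp PU_rigid f g(1))
    then have l: "lin_part (g \<circ> f') = id" by (simp only: f' lin_part_id)
    have gf: "(g \<circ> f') x = x + b" for x
      using fun_cong[OF l, of x] by (simp add: lin_part_def b_def algebra_simps)
    then have "g \<circ> f' = (\<lambda>x. x + b)" by blast
    then have "b \<in> Lat" using PU_comp[OF g(1) f'(1)] by (simp add: Lat_def)
    moreover have "p = ?f y + b" using gf[of "?f y"] ff y by simp
    moreover have "norm (?f y) \<le> R" using R y g(1) by blast
    ultimately show ?thesis by (intro bexI[of _ b]) (auto simp: dist_norm)
  qed
  then show ?thesis using that by blast
qed

end

subsection \<open>The prism and its unfoldings\<close>

locale prism_table = tiling vs for vs +
  fixes h :: real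
  assumes height_pos: "0 < h"
begin

abbreviation "SU \<equiv> space_unfoldings vs h"
abbreviation "P \<equiv> prism vs h"
abbreviation "sf f \<equiv> reflect_at (face_point vs h f) (face_normal vs f)"

text \<open>The normal form of an unfolding: a planar unfolding times an element of the infinite
  dihedral group generated by the reflections at heights 0 and \<open>h\<close>. The sign
  \<open>s\<close> will be 1 or -1.\<close>

definition prod_map :: "(real^2 \<Rightarrow> real^2) \<Rightarrow> int \<Rightarrow> int \<Rightarrow> space \<Rightarrow> space" where
  "prod_map \<gamma> s k = (\<lambda>(x, z). (\<gamma> x, of_int s * z + 2 * of_int k * h))"

lemma prod_map_apply [simp]: "prod_map \<gamma> s k (x, z) = (\<gamma> x, of_int s * z + 2 * of_int k * h)"
  by (simp add: prod_map_def)

lemma sf_Side: "sf (Side i) = prod_map (rf i) 1 0"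
  by (auto simp: reflect_at_def reflect_def fun_eq_iff)

lemma sf_Bottom: "sf Bottom = prod_map id (-1) 0"
  by (auto simp: reflect_at_def reflect_def fun_eq_iff)

lemma sf_Top: "sf Top = prod_map id (-1) 1"
  by (auto simp: reflect_at_def reflect_def fun_eq_iff)

lemma prod_map_comp: "prod_map \<gamma> s k \<circ> prod_map \<gamma>' s' k' = prod_map (\<gamma> \<circ> \<gamma>') (s * s') (s * k' + k)"
  by (auto simp: fun_eq_iff algebra_simps)

lemma faces_cases:
  assumes "f \<in> faces vs"
  obtains i where "i < nv" "f = Side i" | "f = Bottom" | "f = Top"
  using assms by (auto simp: faces_def)

lemma faces_simps [simp]: "Side i \<in> faces vs \<longleftrightarrow> i < nv" "Bottom \<in> faces vs" "Top \<in> faces vs"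
  by (auto simp: faces_def)

lemma finite_faces: "finite (faces vs)"
  by (simp add: faces_def)

lemma SU_cases:
  assumes "g \<in> SU"
  obtains \<gamma> s k where "\<gamma> \<in> PU" "s = 1 \<or> s = -1" "g = prod_map \<gamma> s k"
proof -
  have "\<exists>\<gamma> s k. \<gamma> \<in> PU \<and> (s = 1 \<or> s = -1) \<and> g = prod_map \<gamma> s k"
    using assms unfolding space_unfoldings_def
  proof induction
    case gen_id
    have "id = prod_map id 1 0" by (auto simp: fun_eq_iff)
    then show ?case using PU_id by blast
  next
    case (gen_step g s)
    from gen_step.IH obtain \<gamma> \<sigma> k where g: "\<gamma> \<in> PU" "\<sigma> = 1 \<or> \<sigma> = -1" "g = prod_map \<gamma> \<sigma> k" by blast
    from gen_step.hyps(2) obtain f where f: "f \<in> faces vs" "s = sf f" by blast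
    from f(1) show ?case
    proof (cases rule: faces_cases)
      case (1 i)
      have "g \<circ> s = prod_map (\<gamma> \<circ> rf i) (\<sigma> * 1) (\<sigma> * 0 + k)"
        unfolding f 1 g sf_Side prod_map_comp ..
      then show ?thesis using PU_comp[OF g(1) PU_rf[OF 1(1)]] g(2) by (metis mult_1_right)
    next
      case 2
      have "g \<circ> s = prod_map \<gamma> (- \<sigma>) k"
        unfolding f 2 g sf_Bottom prod_map_comp by simp
      then show ?thesis using g by (metis add.inverse_inverse)
    next
      case 3
      have "g \<circ> s = prod_map \<gamma> (- \<sigma>) (\<sigma> + k)"
        unfolding f 3 g sf_Top prod_map_comp by simp
      then show ?thesis using g by (metis add.inverse_inverse)
    qed
  qed
  then show ?thesis using that by blast
qed

lemma SU_id: "id \<in> SU"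
  by (simp add: space_unfoldings_def generated.gen_id)

lemma SU_comp: "g \<in> SU \<Longrightarrow> f \<in> SU \<Longrightarrow> g \<circ> f \<in> SU"
  by (simp add: space_unfoldings_def generated_comp)

lemma SU_sf: "f \<in> faces vs \<Longrightarrow> sf f \<in> SU"
  by (auto simp: space_unfoldings_def intro: generated_single)

lemma SU_rigid: "g \<in> SU \<Longrightarrow> rigid g"
  unfolding space_unfoldings_def by (rule rigid_generated) (auto simp: rigid_reflect_at)

lemma SU_inverse:
  assumes "g \<in> SU" obtains g' where "g' \<in> SU" "g \<circ> g' = id" "g' \<circ> g = id"
  using generated_inverse[of "sf ` faces vs" g] assms reflect_at_involution
  unfolding space_unfoldings_def by blast

lemma SU_plane: "\<gamma> \<in> PU \<Longrightarrow> prod_map \<gamma> 1 0 \<in> SU"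
  unfolding plane_unfoldings_def
proof (induction rule: generated.induct)
  case gen_id
  have "prod_map id 1 0 = id" by (auto simp: fun_eq_iff)
  then show ?case using SU_id by metis
next
  case (gen_step g s)
  then obtain i where i: "i < nv" "s = rf i" by blast
  have "prod_map (g \<circ> s) 1 0 = prod_map g 1 0 \<circ> sf (Side i)"
    unfolding sf_Side prod_map_comp i by simp
  then show ?case using SU_comp[OF gen_step.IH SU_sf[OF faces_simps(1)[THEN iffD2, OF i(1)]]] by metis
qed

text \<open>The reflections in top and bottom compose to the translation by \<open>2 * h\<close>,
  upwards or downwards according to the order.\<close>

lemma SU_translation: "prod_map id 1 k \<in> SU"
proof -
  have up: "prod_map id 1 (int n) \<in> SU" for n
  proof (induction n)
    case 0 show ?case unfolding of_nat_0 minus_zero by (rule SU_plane[OF PU_id])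
  next
    case (Suc n)
    have "prod_map id 1 (int (Suc n)) = prod_map id 1 (int n) \<circ> (sf Top \<circ> sf Bottom)"
      unfolding sf_Top sf_Bottom prod_map_comp by (simp add: add.commute)
    then show ?case using Suc SU_comp SU_sf faces_simps(2,3) by metis
  qed
  have dn: "prod_map id 1 (- int n) \<in> SU" for n
  proof (induction n)
    case 0 show ?case unfolding of_nat_0 minus_zero by (rule SU_plane[OF PU_id])
  next
    case (Suc n)
    have "prod_map id 1 (- int (Suc n)) = prod_map id 1 (- int n) \<circ> (sf Bottom \<circ> sf Top)"
      unfolding sf_Top sf_Bottom prod_map_comp by (simp add: algebra_simps)
    then show ?case using Suc SU_comp SU_sf faces_simps(2,3) by metis
  qed
  show ?thesis using up[of "nat k"] dn[of "nat (- k)"] by (cases "0 \<le> k") auto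
qed

lemma SU_intro:
  assumes "\<gamma> \<in> PU" "s = 1 \<or> s = -1" shows "prod_map \<gamma> s k \<in> SU"
proof -
  have 1: "prod_map \<gamma> 1 k \<in> SU"
    using SU_comp[OF SU_translation[of k] SU_plane[OF assms(1)]] by (simp add: prod_map_comp)
  have "prod_map \<gamma> (-1) k \<in> SU"
    using SU_comp[OF 1 SU_sf[of Bottom]] unfolding sf_Bottom prod_map_comp by simp
  then show ?thesis using 1 assms(2) by auto
qed

lemma lin_part_prod_map: "lin_part (prod_map \<gamma> s k) (v, c) = (lin_part \<gamma> v, of_int s * c)"
  by (simp add: lin_part_def zero_prod_def)

lemma mem_P: "(x, z) \<in> P \<longleftrightarrow> x \<in> region vs \<and> 0 \<le> z \<and> z \<le> h"
  by (auto simp: prism_def)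

lemma interior_P: "interior P = core \<times> {0<..<h}"
  by (simp add: prism_def interior_Times interior_region interior_atLeastAtMost_real)

lemma mem_interior_P: "(x, z) \<in> interior P \<longleftrightarrow> x \<in> core \<and> 0 < z \<and> z < h"
  by (auto simp: interior_P)

lemma compact_P: "compact P"
  unfolding prism_def by (intro compact_Times compact_region) auto

lemma closed_P: "closed P"
  using compact_P compact_imp_closed by blast

lemma convex_P: "convex P"
  unfolding prism_def by (intro convex_Times convex_region) auto

definition edge_set :: "space set" where
  "edge_set = {(x, z). x \<in> outline vs \<and> (z = 0 \<or> z = h) \<or> x \<in> set vs \<and> 0 \<le> z \<and> z \<le> h}"

lemma mem_edge_set: "(x, z) \<in> edge_set \<longleftrightarrow> x \<in> outline vs \<and> (z = 0 \<or> z = h) \<or> x \<in> set vs \<and> 0 \<le> z \<and> z \<le> h"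
  by (simp add: edge_set_def)

lemma Union_edges: "\<Union>(edges vs h) = edge_set"
proof (intro set_eqI iffI)
  fix p assume "p \<in> \<Union>(edges vs h)"
  then show "p \<in> edge_set"
    by (cases p) (auto simp: edges_def mem_edge_set outline_def)
next
  fix p assume "p \<in> edge_set"
  then obtain x z where p: "p = (x, z)" "x \<in> outline vs \<and> (z = 0 \<or> z = h) \<or> x \<in> set vs \<and> 0 \<le> z \<and> z \<le> h"
    by (cases p) (auto simp: mem_edge_set)
  from p(2) show "p \<in> \<Union>(edges vs h)"
  proof
    assume "x \<in> outline vs \<and> (z = 0 \<or> z = h)"
    then obtain i where "i < nv" "x \<in> side vs i" "z = 0 \<or> z = h" by (auto simp: outline_def)
    then have "p \<in> side vs i \<times> {0} \<or> p \<in> side vs i \<times> {h}" using p by auto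
    then show ?thesis using \<open>i < nv\<close> unfolding edges_def by blast
  next
    assume *: "x \<in> set vs \<and> 0 \<le> z \<and> z \<le> h"
    then obtain i where "i < nv" "x = vs ! i" by (auto simp: in_set_conv_nth)
    then have "p \<in> {vs ! i} \<times> {0..h}" using p * by auto
    then show ?thesis using \<open>i < nv\<close> unfolding edges_def by blast
  qed
qed

text \<open>The union of all unfolded edges in coordinates: copies of the outline at all multiples
  of \<open>h\<close>, and complete vertical lines over all vertices of the plane tiling.\<close>

definition grid :: "space set" where
  "grid = {(x, z). x \<in> Skel \<and> (\<exists>k::int. z = of_int k * h) \<or> x \<in> Vert}"

lemma mem_grid: "(x, z) \<in> grid \<longleftrightarrow> x \<in> Skel \<and> (\<exists>k::int. z = of_int k * h) \<or> x \<in> Vert"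
  by (simp add: grid_def)

lemma horizontal_edge:
  assumes "\<gamma> \<in> PU" "i < nv"
  shows "(\<gamma> ` side vs i) \<times> {of_int k * h} \<in> unfolded_edges vs h"
proof -
  have e: "side vs i \<times> {0} \<in> edges vs h" "side vs i \<times> {h} \<in> edges vs h"
    using assms(2) by (auto simp: edges_def)
  show ?thesis
  proof (cases "even k")
    case True
    then obtain m where m: "k = 2 * m" by blast
    have "(\<gamma> ` side vs i) \<times> {of_int k * h} = prod_map \<gamma> 1 m ` (side vs i \<times> {0})"
      by (auto simp: m image_iff)
    then show ?thesis unfolding unfolded_edges_def using e SU_intro[OF assms(1)] by blast
  next
    case False
    then obtain m where m: "k = 2 * m + 1" by (rule oddE)
    have "(\<gamma> ` side vs i) \<times> {of_int k * h} = prod_map \<gamma> 1 m ` (side vs i \<times> {h})"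
      by (auto simp: m image_iff algebra_simps)
    then show ?thesis unfolding unfolded_edges_def using e SU_intro[OF assms(1)] by blast
  qed
qed

lemma vertical_edge:
  assumes "w \<in> Vert"
  shows "{w} \<times> {of_int k * h..of_int (k + 1) * h} \<in> unfolded_edges vs h"
proof -
  obtain \<gamma> i where \<gamma>: "\<gamma> \<in> PU" "i < nv" "w = \<gamma> (vs ! i)" using assms by (auto simp: Vert_def in_set_conv_nth)
  have e: "{vs ! i} \<times> {0..h} \<in> edges vs h" using \<gamma>(2) by (auto simp: edges_def)
  show ?thesis
  proof (cases "even k")
    case True
    then obtain m where m: "k = 2 * m" by blast
    have "{w} \<times> {of_int k * h..of_int (k + 1) * h} = prod_map \<gamma> 1 m ` ({vs ! i} \<times> {0..h})"
    proof (intro set_eqI iffI)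
      fix p assume "p \<in> {w} \<times> {of_int k * h..of_int (k + 1) * h}"
      then obtain z where z: "p = (w, z)" "of_int k * h \<le> z" "z \<le> of_int (k + 1) * h" by auto
      then have "p = prod_map \<gamma> 1 m (vs ! i, z - of_int k * h)" using \<gamma> m by simp
      moreover have "(vs ! i, z - of_int k * h) \<in> {vs ! i} \<times> {0..h}" using z by (simp add: algebra_simps)
      ultimately show "p \<in> prod_map \<gamma> 1 m ` ({vs ! i} \<times> {0..h})" by blast
    qed (auto simp: m \<gamma> algebra_simps)
    then show ?thesis unfolding unfolded_edges_def using e SU_intro[OF \<gamma>(1)] by blast
  next
    case False
    then obtain m where m: "k = 2 * m + 1" by (rule oddE)
    \<comment> \<open>Odd layers hold reflected copies, in which the height is measured downwards
      from \<open>(k + 1) * h\<close>.\<close>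
    have "{w} \<times> {of_int k * h..of_int (k + 1) * h} = prod_map \<gamma> (-1) (m + 1) ` ({vs ! i} \<times> {0..h})"
    proof (intro set_eqI iffI)
      fix p assume "p \<in> {w} \<times> {of_int k * h..of_int (k + 1) * h}"
      then obtain z where z: "p = (w, z)" "of_int k * h \<le> z" "z \<le> of_int (k + 1) * h" by auto
      then have "p = prod_map \<gamma> (-1) (m + 1) (vs ! i, of_int (k + 1) * h - z)" using \<gamma> m by (simp add: algebra_simps)
      moreover have "(vs ! i, of_int (k + 1) * h - z) \<in> {vs ! i} \<times> {0..h}" using z by (simp add: algebra_simps)
      ultimately show "p \<in> prod_map \<gamma> (-1) (m + 1) ` ({vs ! i} \<times> {0..h})" by blast
    qed (auto simp: m \<gamma> algebra_simps)
    then show ?thesis unfolding unfolded_edges_def using e SU_intro[OF \<gamma>(1)] by blast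
  qed
qed

lemma grid_image:
  assumes "g \<in> SU" "p \<in> grid" shows "g p \<in> grid"
proof -
  obtain \<gamma> s k where g: "\<gamma> \<in> PU" "s = 1 \<or> s = -1" "g = prod_map \<gamma> s k" by (rule SU_cases[OF assms(1)])
  obtain x z where p: "p = (x, z)" by (cases p)
  have "\<exists>j::int. of_int s * z + 2 * of_int k * h = of_int j * h" if "z = of_int i * h" for i
    by (rule exI[of _ "s * i + 2 * k"]) (simp add: that algebra_simps)
  then show ?thesis
    using assms(2) Skel_image[OF g(1)] Vert_image[OF g(1)] unfolding p g(3) prod_map_apply mem_grid by blast
qed

lemma grid_iff:
  assumes "g \<in> SU" shows "g p \<in> grid \<longleftrightarrow> p \<in> grid"
proof
  assume gp: "g p \<in> grid"
  obtain g' where g': "g' \<in> SU" "g \<circ> g' = id" "g' \<circ> g = id" by (rule SU_inverse[OF assms])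
  have "g' (g p) = p" using g'(3) by (metis comp_apply id_apply)
  then show "p \<in> grid" using grid_image[OF g'(1) gp] by simp
qed (rule grid_image[OF assms])

lemma edge_set_grid: "edge_set \<subseteq> grid"
proof
  fix p assume "p \<in> edge_set"
  moreover have "0 = of_int 0 * h" "h = of_int 1 * h" by auto
  ultimately show "p \<in> grid"
    using outline_Skel vertex_Vert unfolding edge_set_def grid_def by blast
qed

text \<open>The edge-to-edge property of the plane tiling carries over: no edge of another copy
  enters the prism except along its own edges.\<close>

lemma grid_P:
  assumes "p \<in> grid" "p \<in> P" shows "p \<in> edge_set"
proof -
  obtain x z where xz: "p = (x, z)" by (cases p)
  have x: "x \<in> region vs" "0 \<le> z" "z \<le> h" using assms(2) by (auto simp: xz mem_P)
  from assms(1) consider k :: int where "x \<in> Skel" "z = of_int k * h" | "x \<in> Vert" unfolding xz mem_grid by blast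
  then show ?thesis
  proof cases
    case 1
    then have "0 \<le> of_int k * h" "of_int k * h \<le> 1 * h" using x by auto
    then have "0 \<le> k" "k \<le> 1" using height_pos by (simp_all add: zero_le_mult_iff mult_le_cancel_right)
    then have "k = 0 \<or> k = 1" by linarith
    then show ?thesis using 1 x Skel_region by (auto simp: xz mem_edge_set)
  next
    case 2 then show ?thesis using x Vert_region by (auto simp: xz mem_edge_set)
  qed
qed

lemma grid_interior: "p \<in> interior P \<Longrightarrow> p \<notin> grid"
proof
  assume p: "p \<in> interior P" "p \<in> grid"
  then have e: "p \<in> edge_set" using grid_P interior_subset by blast
  obtain x z where xz: "p = (x, z)" by (cases p)
  have "x \<in> core" "z \<noteq> 0" "z \<noteq> h" using p(1) by (auto simp: xz mem_interior_P)
  moreover from this have "x \<notin> outline vs" using core_not_Skel outline_Skel by blast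
  ultimately show False using e set_vs_outline by (auto simp: xz mem_edge_set)
qed

subsection \<open>Faces\<close>

text \<open>Inward normals. The vectors \<open>face_normal\<close> have no consistent orientation,
  so they cannot tell an approach to a face from a departure.\<close>

primrec finn :: "face \<Rightarrow> space" where
  "finn (Side i) = (inn i, 0)"
| "finn Bottom = (0, 1)"
| "finn Top = (0, -1)"

definition fht :: "face \<Rightarrow> space \<Rightarrow> real" where
  "fht f p = (p - face_point vs h f) \<bullet> finn f"

lemma fht_simps [simp]: "fht (Side i) (x, z) = ht i x" "fht Bottom (x, z) = z" "fht Top (x, z) = h - z"
  by (simp_all add: fht_def ht_def)

lemma fht_add: "fht f (p + t *\<^sub>R v) = fht f p + t * (v \<bullet> finn f)"
  by (simp add: fht_def inner_diff_left inner_add_left)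

lemma fht_face: "f \<in> faces vs \<Longrightarrow> p \<in> face_set vs h f \<Longrightarrow> fht f p = 0"
  by (cases p) (auto elim!: faces_cases)

lemma face_subset_P: "f \<in> faces vs \<Longrightarrow> face_set vs h f \<subseteq> P"
  using side_region height_pos by (fastforce elim!: faces_cases simp: mem_P)

lemma interior_fht: "f \<in> faces vs \<Longrightarrow> p \<in> interior P \<Longrightarrow> 0 < fht f p"
  by (cases p) (auto elim!: faces_cases simp: mem_interior_P core_iff)

lemma finn_reflect:
  assumes "f \<in> faces vs"
  shows "reflect (face_normal vs f) v \<bullet> finn f = - (v \<bullet> finn f)"
proof -
  obtain e where "finn f = e *\<^sub>R face_normal vs f"
    using assms
  proof (cases rule: faces_cases)
    case (1 i)
    obtain e where "inn i = e *\<^sub>R side_normal vs i" by (rule inn_cases[OF 1(1)])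
    then show ?thesis using that[of e] 1 by simp
  next
    case 2 then show ?thesis using that[of 1] by simp
  next
    case 3 then show ?thesis using that[of "-1"] by simp
  qed
  then show ?thesis by (simp add: reflect_inner)
qed

lemma sf_face:
  assumes "f \<in> faces vs" "p \<in> face_set vs h f"
  shows "sf f (p + t *\<^sub>R v) = p + t *\<^sub>R reflect (face_normal vs f) v"
proof -
  have "sf f p = p"
    using assms
    by (cases rule: faces_cases) (auto simp: sf_Side sf_Bottom sf_Top rf_side simp del: face_normal.simps face_point.simps)
  then show ?thesis by (simp add: lin_part_add[OF rigid_reflect_at])
qed

lemma face_rel_cases:
  assumes "f \<in> faces vs" "p \<in> face_set vs h f" "p \<notin> edge_set"
  obtains i x z where "i < nv" "f = Side i" "p = (x, z)" "x \<in> side vs i" "x \<notin> set vs" "0 < z" "z < h"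
  | x where "f = Bottom" "p = (x, 0)" "x \<in> core"
  | x where "f = Top" "p = (x, h)" "x \<in> core"
proof -
  obtain x z where p: "p = (x, z)" by (cases p)
  from assms(1) show ?thesis
  proof (cases rule: faces_cases)
    case (1 i)
    have x: "x \<in> side vs i" "0 \<le> z" "z \<le> h" using assms(2) 1 p by auto
    then have "x \<in> outline vs" using 1 by (auto simp: outline_def)
    then have "z \<noteq> 0" "z \<noteq> h" "x \<notin> set vs" using assms(3) x unfolding p mem_edge_set by auto
    then show ?thesis using that(1) 1 p x by force
  next
    case 2
    then have "x \<in> region vs" "z = 0" using assms(2) p by auto
    moreover from this have "x \<notin> outline vs" using assms(3) unfolding p mem_edge_set by auto
    ultimately show ?thesis using that(2) 2 p by (auto simp: region_def)
  next
    case 3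
    then have "x \<in> region vs" "z = h" using assms(2) p by auto
    moreover from this have "x \<notin> outline vs" using assms(3) unfolding p mem_edge_set by auto
    ultimately show ?thesis using that(3) 3 p by (auto simp: region_def)
  qed
qed

lemma side_point_unique:
  assumes "i < nv" "j < nv" "x \<in> side vs i" "x \<in> side vs j" "x \<notin> set vs"
  shows "i = j"
proof (rule ccontr)
  assume "i \<noteq> j"
  then have "x \<in> {vs ! i, next_vertex vs i}" using side_Int[OF assms(1,2)] assms(3,4) by blast
  then show False using assms(1,5) next_in by auto
qed

lemma face_unique:
  assumes f: "f \<in> faces vs" "p \<in> face_set vs h f" "f' \<in> faces vs" "p \<in> face_set vs h f'" and p: "p \<notin> edge_set"
  shows "f = f'"
proof -
  have side: "x \<notin> core" if "x \<in> side vs i" "i < nv" for x i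
    using that core_not_Skel outline_Skel by (auto simp: outline_def)
  show ?thesis
    using face_rel_cases[OF f(1,2) p]
  proof cases
    case (1 i x z)
    from face_rel_cases[OF f(3,4) p] show ?thesis
      by cases (use 1 side_point_unique in auto)
  next
    case (2 x)
    from face_rel_cases[OF f(3,4) p] show ?thesis
      by cases (use 2 height_pos in auto)
  next
    case (3 x)
    from face_rel_cases[OF f(3,4) p] show ?thesis
      by cases (use 3 height_pos in auto)
  qed
qed

text \<open>At a face point off the edges the prism locally is a half-space, so a direction with
  positive inward component enters the interior at once.\<close>

lemma inward:
  assumes f: "f \<in> faces vs" "p \<in> face_set vs h f" "p \<notin> edge_set" and v: "0 < v \<bullet> finn f"
  obtains t where "0 < t" "p + t *\<^sub>R v \<in> interior P"
proof -
  obtain y c where vc: "v = (y, c)" by (cases v)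
  have small: "\<exists>t>0. x + t *\<^sub>R y \<in> ball x r \<and> (z = 0 \<and> 0 < c \<longrightarrow> 0 < z + t * c) \<and> (z = h \<and> c < 0 \<longrightarrow> z + t * c < h)
      \<and> (0 < z \<longrightarrow> 0 < z + t * c) \<and> (z < h \<longrightarrow> z + t * c < h)" if "0 < r" for x z r
  proof -
    \<comment> \<open>The default 1 replaces the distance to a bound that the height has already
      reached and that imposes no smallness condition here.\<close>
    define d where "d = Min {if 0 < z then z else 1, if z < h then h - z else 1, r}"
    have d: "0 < d" "d \<le> r" "0 < z \<Longrightarrow> d \<le> z" "z < h \<Longrightarrow> d \<le> h - z" using that by (auto simp: d_def)
    define t where "t = d / (2 * (norm y + \<bar>c\<bar> + 1))"
    have q: "0 < norm y + \<bar>c\<bar> + 1" by (simp add: add_nonneg_pos)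
    have t: "0 < t" using d q by (simp add: t_def)
    have "t * (2 * (norm y + \<bar>c\<bar> + 1)) = d" using q by (simp add: t_def)
    then have "2 * (t * norm y) + 2 * (t * \<bar>c\<bar>) + 2 * t = d" by (simp add: algebra_simps)
    moreover have "0 \<le> t * norm y" by (rule mult_nonneg_nonneg) (use t in auto)
    moreover have "0 \<le> t * \<bar>c\<bar>" by (rule mult_nonneg_nonneg) (use t in auto)
    ultimately have m: "t * norm y < d" "t * \<bar>c\<bar> < d" using t by linarith+
    have c: "\<bar>t * c\<bar> < d" using m(2) t by (simp add: abs_mult)
    have 1: "x + t *\<^sub>R y \<in> ball x r" using m(1) t d by (simp add: dist_norm)
    have 2: "0 < z \<longrightarrow> 0 < z + t * c" "z < h \<longrightarrow> z + t * c < h" using c d by auto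
    have 3: "z = 0 \<and> 0 < c \<longrightarrow> 0 < z + t * c" "z = h \<and> c < 0 \<longrightarrow> z + t * c < h"
      using t by (simp_all add: mult_pos_neg)
    from t 1 2 3 show ?thesis by blast
  qed
  show ?thesis
    using face_rel_cases[OF f]
  proof cases
    case (1 i x z)
    have xv: "x \<noteq> vs ! i" "x \<noteq> next_vertex vs i" using 1 next_in by auto
    have "\<exists>r>0. \<forall>x'\<in>ball x r. 0 < ht i x' \<longrightarrow> x' \<in> core"
      by (rule half_disc_core[OF 1(1,4) xv]) blast
    then obtain r where r: "0 < r" "\<And>x'. x' \<in> ball x r \<Longrightarrow> 0 < ht i x' \<Longrightarrow> x' \<in> core"
      by blast
    obtain t where t: "0 < t" "x + t *\<^sub>R y \<in> ball x r" "0 < z + t * c" "z + t * c < h"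
      using small[OF r(1), of x z] 1 by blast
    have "0 < ht i (x + t *\<^sub>R y)" using v 1 vc t(1) by (simp add: ht_add)
    then have "p + t *\<^sub>R v \<in> interior P" using r(2)[OF t(2)] t 1 vc by (simp add: mem_interior_P)
    then show ?thesis using that t(1) by blast
  next
    case (2 x)
    obtain r where r: "0 < r" "ball x r \<subseteq> core" using 2 open_inside_outline open_contains_ball by metis
    have "0 < c" using v 2 vc by simp
    then obtain t where "0 < t" "x + t *\<^sub>R y \<in> ball x r" "0 < t * c" "t * c < h"
      using small[OF r(1), of x 0] height_pos by auto
    then have "p + t *\<^sub>R v \<in> interior P" "0 < t" using r(2) 2 vc by (auto simp: mem_interior_P)
    then show ?thesis using that by blast
  next
    case (3 x)
    obtain r where r: "0 < r" "ball x r \<subseteq> core" using 3 open_inside_outline open_contains_ball by metis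
    have "c < 0" using v 3 vc by simp
    then obtain t where "0 < t" "x + t *\<^sub>R y \<in> ball x r" "0 < h + t * c" "h + t * c < h"
      using small[OF r(1), of x h] height_pos by auto
    then have "p + t *\<^sub>R v \<in> interior P" "0 < t" using r(2) 3 vc by (auto simp: mem_interior_P)
    then show ?thesis using that by blast
  qed
qed

lemma frontier_face:
  assumes "p \<in> P" "p \<notin> interior P"
  obtains f where "f \<in> faces vs" "p \<in> face_set vs h f"
proof -
  obtain x z where p: "p = (x, z)" by (cases p)
  have x: "x \<in> region vs" "0 \<le> z" "z \<le> h" using assms(1) by (auto simp: p mem_P)
  show ?thesis
  proof (cases "x \<in> core")
    case True
    then have "z = 0 \<or> z = h" using assms(2) x by (auto simp: p mem_interior_P)
    then show ?thesis using that[of Bottom] that[of Top] x p by auto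
  next
    case False
    then obtain i where "i < nv" "x \<in> side vs i" using x by (auto simp: region_def outline_def)
    then show ?thesis using that[of "Side i"] x p by auto
  qed
qed

text \<open>The line spends a compact set of times in the prism. At the last of them it is on the
  boundary, and off the edges since it misses \<open>grid\<close>; convexity puts everything in
  between into the interior, because the point at time \<open>t0\<close> is there.\<close>

lemma exit_point:
  assumes m: "m \<in> P" and t0: "0 < t0" "m + t0 *\<^sub>R v \<in> interior P" and v: "v \<noteq> 0"
    and av: "\<And>t. m + t *\<^sub>R v \<notin> grid"
  obtains t f where "0 < t" "f \<in> faces vs" "m + t *\<^sub>R v \<in> face_set vs h f" "m + t *\<^sub>R v \<notin> edge_set"
    "open_segment m (m + t *\<^sub>R v) \<subseteq> interior P" "v \<bullet> finn f < 0"
proof -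
  define S where "S = {t. 0 \<le> t \<and> m + t *\<^sub>R v \<in> P}"
  have "closed S"
  proof -
    have "S = {0..} \<inter> (\<lambda>t. m + t *\<^sub>R v) -` P" by (auto simp: S_def)
    moreover have "closed ((\<lambda>t. m + t *\<^sub>R v) -` P)"
      by (intro continuous_closed_vimage closed_P continuous_intros) 
    ultimately show ?thesis by (simp add: closed_Int)
  qed
  moreover have "bounded S"
  proof -
    obtain B where B: "\<And>p. p \<in> P \<Longrightarrow> norm p \<le> B" using compact_P compact_imp_bounded bounded_iff by metis
    have "\<bar>t\<bar> \<le> (B + norm m) / norm v" if "t \<in> S" for t
    proof -
      have "norm (t *\<^sub>R v) \<le> norm (m + t *\<^sub>R v) + norm m"
        using norm_triangle_ineq4[of "m + t *\<^sub>R v" m] by simp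
      also have "\<dots> \<le> B + norm m" using B that by (simp add: S_def)
      finally show ?thesis using v by (simp add: pos_le_divide_eq)
    qed
    then show ?thesis unfolding bounded_iff by (metis real_norm_def)
  qed
  moreover have t0S: "t0 \<in> S" using t0 interior_subset by (auto simp: S_def)
  ultimately obtain t where t: "t \<in> S" "\<And>s. s \<in> S \<Longrightarrow> s \<le> t"
    using compact_attains_sup[of S] compact_eq_bounded_closed by blast
  define p where "p = m + t *\<^sub>R v"
  have pP: "p \<in> P" using t by (simp add: S_def p_def)
  have "t0 \<le> t" using t t0S by blast
  have pI: "p \<notin> interior P"
  proof
    assume "p \<in> interior P"
    then obtain e where e: "0 < e" "ball p e \<subseteq> P" by (meson mem_interior)
    define s where "s = e / (2 * norm v)"
    have s: "0 < s" "s * norm v < e" using e v by (auto simp: s_def)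
    have "p + s *\<^sub>R v \<in> ball p e" using s by (simp add: dist_norm)
    then have "m + (t + s) *\<^sub>R v \<in> P" using e by (auto simp: p_def algebra_simps)
    then have "t + s \<in> S" using t s by (simp add: S_def)
    then show False using t(2) s by force
  qed
  have "t0 \<noteq> t" using pI t0 by (auto simp: p_def)
  then have tt: "t0 < t" using \<open>t0 \<le> t\<close> by simp
  obtain f where f: "f \<in> faces vs" "p \<in> face_set vs h f" by (rule frontier_face[OF pP pI])
  have "p \<notin> grid" using av by (simp add: p_def)
  then have pe: "p \<notin> edge_set" using edge_set_grid by blast
  have seg: "m + s *\<^sub>R v \<in> interior P" if s: "0 < s" "s < t" for s
  proof -
    have conv: "(1 - u) *\<^sub>R q + u *\<^sub>R (m + t0 *\<^sub>R v) \<in> interior P" if "q \<in> P" "0 < u" "u \<le> 1" for q u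
    proof -
      have "q - u *\<^sub>R (q - (m + t0 *\<^sub>R v)) \<in> interior P"
        by (rule mem_interior_closure_convex_shrink[OF convex_P t0(2) _ that(2,3)])
          (use that closure_subset in blast)
      then show ?thesis by (simp add: algebra_simps)
    qed
    show ?thesis
    proof (cases "s \<le> t0")
      case True
      have "m + s *\<^sub>R v = (1 - s / t0) *\<^sub>R m + (s / t0) *\<^sub>R (m + t0 *\<^sub>R v)"
        using t0 by (simp add: algebra_simps)
      then show ?thesis using conv[OF m, of "s / t0"] s t0 True by simp
    next
      case False
      \<comment> \<open>A point after time \<open>t0\<close> is a mixture of the exit point and the
        interior point at \<open>t0\<close>, with positive weight \<open>u\<close> on the
        latter.\<close>
      define u where "u = (t - s) / (t - t0)"
      have u: "0 < u" "u \<le> 1" using s tt False by (auto simp: u_def)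
      have "(1 - u) * t + u * t0 = t - u * (t - t0)" by (simp add: algebra_simps)
      also have "\<dots> = s" using tt by (simp add: u_def)
      finally have "m + s *\<^sub>R v = (1 - u) *\<^sub>R p + u *\<^sub>R (m + t0 *\<^sub>R v)"
        unfolding p_def by (simp add: algebra_simps flip: scaleR_add_left)
      then show ?thesis using conv[OF pP u] by simp
    qed
  qed
  have "open_segment m p \<subseteq> interior P"
  proof
    fix q assume "q \<in> open_segment m p"
    then obtain u where u: "0 < u" "u < 1" "q = (1 - u) *\<^sub>R m + u *\<^sub>R p" by (auto simp: in_segment)
    have "q = m + (u * t) *\<^sub>R v" unfolding u(3) p_def by (simp add: algebra_simps)
    moreover have "0 < u * t" "u * t < t" using u tt t0 by auto
    ultimately show "q \<in> interior P" using seg by simp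
  qed
  moreover have "v \<bullet> finn f < 0"
  proof -
    have "p = (m + t0 *\<^sub>R v) + (t - t0) *\<^sub>R v" by (simp add: p_def algebra_simps)
    then have "fht f (m + t0 *\<^sub>R v) + (t - t0) * (v \<bullet> finn f) = 0"
      using fht_face[OF f] fht_add by metis
    moreover have "0 < fht f (m + t0 *\<^sub>R v)" using interior_fht[OF f(1) t0(2)] .
    ultimately have "(t - t0) * (v \<bullet> finn f) < 0" by linarith
    then show ?thesis using tt by (simp add: mult_less_0_iff)
  qed
  ultimately show ?thesis using that[of t f] f pe t0 tt by (auto simp: p_def)
qed

end

context prism_table
begin

subsection \<open>Orbits and their unfoldings\<close>

text \<open>The whole straight line, for all real times, must miss \<open>grid\<close>. As the grid
  is invariant under the face reflections, this condition passes to the reflected state, so it never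
  has to be checked again along the orbit.\<close>

definition regular :: "state \<Rightarrow> bool" where
  "regular s \<longleftrightarrow> (\<exists>f\<in>faces vs. fst s \<in> face_set vs h f \<and> fst s \<notin> edge_set \<and> 0 < snd s \<bullet> finn f) \<and>
     (\<forall>t. fst s + t *\<^sub>R snd s \<notin> grid)"

lemma billiard_step_iff:
  "billiard_step vs h (m, v) (m', v') \<longleftrightarrow> (\<exists>f\<in>faces vs. \<exists>t>0.
     m' = m + t *\<^sub>R v \<and> open_segment m m' \<subseteq> interior P \<and> m' \<in> face_set vs h f \<and> m' \<notin> edge_set \<and>
     v' = reflect (face_normal vs f) v)"
  unfolding billiard_step_def Union_edges by simp

lemma regular_reflect:
  assumes f: "f \<in> faces vs" "p \<in> face_set vs h f" "p \<notin> edge_set" and v: "v \<bullet> finn f < 0"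
    and av: "\<And>t. p + t *\<^sub>R v \<notin> grid"
  shows "regular (p, reflect (face_normal vs f) v)"
proof -
  have "p + t *\<^sub>R reflect (face_normal vs f) v \<notin> grid" for t
    using av[of t] grid_iff[OF SU_sf[OF f(1)], of "p + t *\<^sub>R v"] sf_face[OF f(1,2), of t v] by simp
  then show ?thesis
    unfolding regular_def using f v finn_reflect[OF f(1), of v] by (auto intro!: bexI[of _ f])
qed

lemma regular_forward:
  assumes "regular s" obtains s' where "billiard_step vs h s s'" "regular s'"
proof -
  obtain m v where s: "s = (m, v)" by (cases s)
  obtain f where f: "f \<in> faces vs" "m \<in> face_set vs h f" "m \<notin> edge_set" "0 < v \<bullet> finn f"
    and av: "\<And>t. m + t *\<^sub>R v \<notin> grid" using assms unfolding regular_def s by auto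
  obtain t0 where t0: "0 < t0" "m + t0 *\<^sub>R v \<in> interior P" by (rule inward[OF f])
  have mP: "m \<in> P" using face_subset_P[OF f(1)] f(2) by blast
  have "v \<noteq> 0" using f(4) by auto
  then obtain t f' where t: "0 < t" "f' \<in> faces vs" "m + t *\<^sub>R v \<in> face_set vs h f'" "m + t *\<^sub>R v \<notin> edge_set"
    "open_segment m (m + t *\<^sub>R v) \<subseteq> interior P" "v \<bullet> finn f' < 0"
    using exit_point[OF mP t0 _ av] by blast
  have "m + t *\<^sub>R v + u *\<^sub>R v \<notin> grid" for u
    using av[of "t + u"] by (simp add: algebra_simps)
  then have "regular (m + t *\<^sub>R v, reflect (face_normal vs f') v)"
    by (rule regular_reflect[OF t(2,3,4,6)])
  moreover have "billiard_step vs h s (m + t *\<^sub>R v, reflect (face_normal vs f') v)"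
    unfolding s billiard_step_iff using t by blast
  ultimately show ?thesis using that by blast
qed

text \<open>The backward step is a forward step after reversing the direction.\<close>

lemma regular_backward:
  assumes "regular s'" obtains s where "billiard_step vs h s s'" "regular s"
proof -
  obtain m v where s: "s' = (m, v)" by (cases s')
  obtain f where f: "f \<in> faces vs" "m \<in> face_set vs h f" "m \<notin> edge_set" "0 < v \<bullet> finn f"
    and av: "\<And>t. m + t *\<^sub>R v \<notin> grid" using assms unfolding regular_def s by auto
  define u where "u = - reflect (face_normal vs f) v"
  have u: "0 < u \<bullet> finn f" using f finn_reflect[OF f(1), of v] by (simp add: u_def)
  have av': "m + t *\<^sub>R u \<notin> grid" for t
    using av[of "- t"] grid_iff[OF SU_sf[OF f(1)], of "m + (- t) *\<^sub>R v"] sf_face[OF f(1,2), of "- t" v]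
    by (simp add: u_def)
  obtain t0 where t0: "0 < t0" "m + t0 *\<^sub>R u \<in> interior P" by (rule inward[OF f(1-3) u])
  have mP: "m \<in> P" using face_subset_P[OF f(1)] f(2) by blast
  have "u \<noteq> 0" using u by auto
  then obtain t f' where t: "0 < t" "f' \<in> faces vs" "m + t *\<^sub>R u \<in> face_set vs h f'" "m + t *\<^sub>R u \<notin> edge_set"
    "open_segment m (m + t *\<^sub>R u) \<subseteq> interior P" "u \<bullet> finn f' < 0"
    using exit_point[OF mP t0 _ av'] by blast
  define p where "p = m + t *\<^sub>R u"
  have "p + r *\<^sub>R (- u) \<notin> grid" for r
    using av'[of "t - r"] by (simp add: p_def algebra_simps)
  then have "regular (p, - u)" unfolding regular_def using t by (auto simp: p_def)
  moreover have "billiard_step vs h (p, - u) (m, v)"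
    unfolding billiard_step_iff
  proof (intro bexI exI conjI)
    show "m = p + t *\<^sub>R (- u)" by (simp add: p_def)
    show "open_segment p m \<subseteq> interior P" using t(5) by (simp add: p_def open_segment_commute)
    show "v = reflect (face_normal vs f) (- u)" by (simp add: u_def)
  qed (use f t in auto)
  ultimately show ?thesis using that s by blast
qed

lemma regular_orbit:
  assumes "regular s" obtains x where "billiard_orbit vs h x" "x 0 = s"
proof -
  have "\<forall>s. \<exists>s'. regular s \<longrightarrow> billiard_step vs h s s' \<and> regular s'" using regular_forward by metis
  then obtain F where F: "\<And>s. regular s \<Longrightarrow> billiard_step vs h s (F s) \<and> regular (F s)" by metis
  have "\<forall>s'. \<exists>s. regular s' \<longrightarrow> billiard_step vs h s s' \<and> regular s" using regular_backward by metis
  then obtain B where B: "\<And>s. regular s \<Longrightarrow> billiard_step vs h (B s) s \<and> regular (B s)" by metis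
  define x where "x k = (if 0 \<le> k then (F ^^ nat k) s else (B ^^ nat (- k)) s)" for k :: int
  have rF: "regular ((F ^^ n) s)" for n using assms F by (induction n) auto
  have rB: "regular ((B ^^ n) s)" for n using assms B by (induction n) auto
  have "billiard_step vs h (x k) (x (k + 1))" for k
  proof (cases "0 \<le> k")
    case True
    then have "nat (k + 1) = Suc (nat k)" by simp
    then show ?thesis using True F[OF rF[of "nat k"]] by (simp add: x_def)
  next
    case False
    then have n: "nat (- k) = Suc (nat (- (k + 1)))" by simp
    have "x (k + 1) = (B ^^ nat (- (k + 1))) s" using False by (cases "k = -1") (auto simp: x_def)
    moreover have "x k = B ((B ^^ nat (- (k + 1))) s)" using False n by (simp add: x_def)
    ultimately show ?thesis using B[OF rB] by simp
  qed
  then show ?thesis using that[of x] by (simp add: billiard_orbit_def x_def)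
qed

text \<open>States live on the boundary, but starting points are more easily chosen inside.
  Following the line backwards to its exit point yields the state, whose direction remains
  \<open>v\<close>.\<close>

lemma orbit_through_interior:
  assumes a: "a \<in> interior P" and v: "v \<noteq> 0" and av: "\<And>t. a + t *\<^sub>R v \<notin> grid"
  obtains x t where "0 < t" "billiard_orbit vs h x" "x 0 = (a - t *\<^sub>R v, v)"
proof -
  have aP: "a \<in> P" using a interior_subset by blast
  obtain e where e: "0 < e" "ball a e \<subseteq> interior P"
    using a open_interior open_contains_ball by metis
  define t0 where "t0 = e / (2 * norm v)"
  have t0: "0 < t0" "t0 * norm v < e" using e v by (auto simp: t0_def)
  have "a + t0 *\<^sub>R (- v) \<in> ball a e" using t0 by (simp add: dist_norm)
  then have i: "a + t0 *\<^sub>R (- v) \<in> interior P" using e by blast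
  have av': "a + t *\<^sub>R (- v) \<notin> grid" for t using av[of "- t"] by simp
  have vnz: "- v \<noteq> 0" using v by simp
  obtain t f where t: "0 < t" "f \<in> faces vs" "a + t *\<^sub>R (- v) \<in> face_set vs h f" "a + t *\<^sub>R (- v) \<notin> edge_set"
    "open_segment a (a + t *\<^sub>R (- v)) \<subseteq> interior P" "(- v) \<bullet> finn f < 0"
    by (rule exit_point[OF aP t0(1) i vnz av'])
  have "a - t *\<^sub>R v + s *\<^sub>R v \<notin> grid" for s
    using av[of "s - t"] by (simp add: algebra_simps)
  then have "regular (a - t *\<^sub>R v, v)"
    unfolding regular_def using t by (auto intro!: bexI[of _ f])
  then show ?thesis using regular_orbit that t(1) by metis
qed

definition face_at :: "(int \<Rightarrow> state) \<Rightarrow> int \<Rightarrow> face" where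
  "face_at x k = (SOME f. f \<in> faces vs \<and> fst (x k) \<in> face_set vs h f)"

definition step_time :: "(int \<Rightarrow> state) \<Rightarrow> int \<Rightarrow> real" where
  "step_time x k = (SOME t. 0 < t \<and> fst (x (k + 1)) = fst (x k) + t *\<^sub>R snd (x k) \<and>
     open_segment (fst (x k)) (fst (x (k + 1))) \<subseteq> interior P)"

context
  fixes x :: "int \<Rightarrow> state"
  assumes orbit: "billiard_orbit vs h x"
begin

lemma orbit_step:
  obtains f t where "f \<in> faces vs" "0 < t" "fst (x (k + 1)) = fst (x k) + t *\<^sub>R snd (x k)"
    "open_segment (fst (x k)) (fst (x (k + 1))) \<subseteq> interior P"
    "fst (x (k + 1)) \<in> face_set vs h f" "fst (x (k + 1)) \<notin> edge_set"
    "snd (x (k + 1)) = reflect (face_normal vs f) (snd (x k))"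
proof -
  have "billiard_step vs h (fst (x k), snd (x k)) (fst (x (k + 1)), snd (x (k + 1)))"
    using orbit by (simp add: billiard_orbit_def)
  then show ?thesis unfolding billiard_step_iff using that by blast
qed

lemma not_edge_at: "fst (x k) \<notin> edge_set"
  using orbit_step[of "k - 1"] by (metis diff_add_cancel)

lemma face_at: "face_at x k \<in> faces vs" "fst (x k) \<in> face_set vs h (face_at x k)"
proof -
  obtain f where "f \<in> faces vs \<and> fst (x k) \<in> face_set vs h f"
    using orbit_step[of "k - 1"] by (metis diff_add_cancel)
  then have "face_at x k \<in> faces vs \<and> fst (x k) \<in> face_set vs h (face_at x k)"
    unfolding face_at_def by (rule someI)
  then show "face_at x k \<in> faces vs" "fst (x k) \<in> face_set vs h (face_at x k)" by auto
qed

lemma face_at_eq: "f \<in> faces vs \<Longrightarrow> fst (x k) \<in> face_set vs h f \<Longrightarrow> face_at x k = f"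
  using face_unique[OF face_at] not_edge_at by blast

lemma orbit_in_P: "fst (x k) \<in> P"
  using face_at[of k] face_subset_P by blast

lemma direction_Suc: "snd (x (k + 1)) = reflect (face_normal vs (face_at x (k + 1))) (snd (x k))"
proof -
  obtain f where "f \<in> faces vs" "fst (x (k + 1)) \<in> face_set vs h f"
    "snd (x (k + 1)) = reflect (face_normal vs f) (snd (x k))"
    by (rule orbit_step[of k])
  then show ?thesis using face_at_eq by simp
qed

lemma step_time:
  "0 < step_time x k" "fst (x (k + 1)) = fst (x k) + step_time x k *\<^sub>R snd (x k)"
  "open_segment (fst (x k)) (fst (x (k + 1))) \<subseteq> interior P"
proof -
  obtain t where "0 < t \<and> fst (x (k + 1)) = fst (x k) + t *\<^sub>R snd (x k) \<and>
     open_segment (fst (x k)) (fst (x (k + 1))) \<subseteq> interior P"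
    using orbit_step[of k] by blast
  then have "0 < step_time x k \<and> fst (x (k + 1)) = fst (x k) + step_time x k *\<^sub>R snd (x k) \<and>
     open_segment (fst (x k)) (fst (x (k + 1))) \<subseteq> interior P"
    unfolding step_time_def by (rule someI)
  then show "0 < step_time x k" "fst (x (k + 1)) = fst (x k) + step_time x k *\<^sub>R snd (x k)"
    "open_segment (fst (x k)) (fst (x (k + 1))) \<subseteq> interior P" by auto
qed

lemma norm_direction: "norm (snd (x k)) = norm (snd (x 0))"
proof (induction k rule: int_induct[of _ 0])
  case (step2 i)
  then show ?case using direction_Suc[of "i - 1"] by simp
qed (simp_all add: direction_Suc)

end

text \<open>The motion carrying the prism to the copy crossed between the hits \<open>i\<close> and
  \<open>i + 1\<close> after time \<open>k\<close>. A new reflection stands on the right, since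
  reflecting the copy \<open>g P\<close> in the image of a face amounts to \<open>g\<close> after
  the reflection of \<open>P\<close> itself.\<close>

primrec unf :: "(int \<Rightarrow> state) \<Rightarrow> int \<Rightarrow> nat \<Rightarrow> space \<Rightarrow> space" where
  "unf x k 0 = id"
| "unf x k (Suc i) = unf x k i \<circ> sf (face_at x (k + int i + 1))"

definition hit :: "(int \<Rightarrow> state) \<Rightarrow> int \<Rightarrow> nat \<Rightarrow> real" where
  "hit x k i = (\<Sum>j<i. step_time x (k + int j))"

lemma hit_0 [simp]: "hit x k 0 = 0" and hit_Suc: "hit x k (Suc i) = hit x k i + step_time x (k + int i)"
  by (simp_all add: hit_def)

lemma unf_cong:
  "(\<And>i. i < n \<Longrightarrow> face_at x (k + int i + 1) = face_at x' (k' + int i + 1)) \<Longrightarrow> i \<le> n \<Longrightarrow> unf x k i = unf x' k' i"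
  by (induction i) auto

context
  fixes x :: "int \<Rightarrow> state"
  assumes orbit: "billiard_orbit vs h x" and dir: "norm (snd (x 0)) = 1"
begin

lemma unf_SU: "unf x k i \<in> SU"
proof (induction i)
  case 0 show ?case unfolding unf.simps by (rule SU_id)
next
  case (Suc i)
  then show ?case using SU_comp[OF Suc SU_sf[OF face_at(1)[OF orbit]]] by (simp only: unf.simps)
qed

text \<open>The added reflection fixes the point hit and cancels the change of direction there; so
  in unfolded form the orbit continues on the same line.\<close>

lemma unf_point:
  "unf x k i (fst (x (k + int i))) = fst (x k) + hit x k i *\<^sub>R snd (x k)"
  "lin_part (unf x k i) (snd (x (k + int i))) = snd (x k)"
proof (induction i)
  case 0
  { case 1 show ?case by simp next case 2 show ?case unfolding unf.simps lin_part_id by simp }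
next
  case (Suc i)
  have k: "k + int (Suc i) = k + int i + 1" by simp
  note st = step_time[OF orbit, of "k + int i"] and fa = face_at[OF orbit, of "k + int i + 1"]
  have r: "rigid (unf x k i)" by (rule SU_rigid[OF unf_SU])
  { case 1
    have "sf (face_at x (k + int i + 1)) (fst (x (k + int i + 1))) = fst (x (k + int i + 1))"
      using sf_face[OF fa, of 0] by simp
    then have "unf x k (Suc i) (fst (x (k + int (Suc i)))) = unf x k i (fst (x (k + int i + 1)))"
      unfolding k unf.simps by simp
    also have "\<dots> = unf x k i (fst (x (k + int i))) + step_time x (k + int i) *\<^sub>R lin_part (unf x k i) (snd (x (k + int i)))"
      unfolding st(2) by (rule lin_part_add[OF r])
    finally show ?case unfolding Suc by (simp add: hit_Suc algebra_simps)
  next case 2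
    have "lin_part (unf x k (Suc i)) (snd (x (k + int (Suc i))))
      = lin_part (unf x k i) (reflect (face_normal vs (face_at x (k + int i + 1))) (snd (x (k + int i + 1))))"
      unfolding k unf.simps lin_part_comp[OF r] by simp
    also have "\<dots> = lin_part (unf x k i) (snd (x (k + int i)))"
      unfolding direction_Suc[OF orbit] by simp
    finally show ?case unfolding Suc . }
qed

lemma unf_between:
  assumes "hit x k i < s" "s < hit x k (Suc i)"
  shows "fst (x k) + s *\<^sub>R snd (x k) \<in> unf x k i ` interior P"
proof -
  note st = step_time[OF orbit, of "k + int i"]
  define u where "u = (s - hit x k i) / step_time x (k + int i)"
  have u: "0 < u" "u < 1" using assms st(1) by (auto simp: u_def hit_Suc)
  have us: "u * step_time x (k + int i) = s - hit x k i" using st(1) by (simp add: u_def)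
  define q where "q = fst (x (k + int i)) + (s - hit x k i) *\<^sub>R snd (x (k + int i))"
  have "q = (1 - u) *\<^sub>R fst (x (k + int i)) + u *\<^sub>R fst (x (k + int i + 1))"
    unfolding st(2) q_def us[symmetric] by (simp add: algebra_simps)
  moreover have "fst (x (k + int i)) \<noteq> fst (x (k + int i + 1))"
    using st dir norm_direction[OF orbit, of "k + int i"] by auto
  ultimately have "q \<in> open_segment (fst (x (k + int i))) (fst (x (k + int i + 1)))"
    using u unfolding in_segment(2) by blast
  then have "q \<in> interior P" using st(3) by blast
  moreover have "unf x k i q = fst (x k) + s *\<^sub>R snd (x k)"
    unfolding q_def lin_part_add[OF SU_rigid[OF unf_SU]] unf_point by (simp add: algebra_simps)
  ultimately show ?thesis by (metis image_eqI)
qed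

lemma unf_face:
  "fst (x k) + hit x k (Suc i) *\<^sub>R snd (x k) \<in> unf x k i ` (face_set vs h (face_at x (k + int i + 1)) - edge_set)"
proof -
  have "unf x k i (fst (x (k + int i + 1))) = fst (x k) + hit x k (Suc i) *\<^sub>R snd (x k)"
    unfolding step_time(2)[OF orbit] lin_part_add[OF SU_rigid[OF unf_SU]] unf_point
    by (simp add: hit_Suc algebra_simps)
  then show ?thesis using face_at[OF orbit] not_edge_at[OF orbit] by (metis DiffI image_eqI)
qed

lemma hit_mono: "i < j \<Longrightarrow> hit x k i < hit x k j"
  by (rule lift_Suc_mono_less) (simp_all add: hit_Suc step_time(1)[OF orbit])

end

subsection \<open>Counting copies along a line\<close>

definition pdiam :: real where "pdiam = diameter P + 1"

lemma pdiam_bound: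
  assumes "x \<in> P" "y \<in> P" shows "dist x y < pdiam"
  unfolding pdiam_def
  using diameter_bounded_bound[OF compact_imp_bounded[OF compact_P] assms] by linarith

lemma pdiam_pos: "0 < pdiam"
  using diameter_ge_0[OF compact_imp_bounded[OF compact_P]] by (simp add: pdiam_def)

lemma SU_cover: obtains g where "g \<in> SU" "p \<in> g ` P"
proof -
  obtain x z where p: "p = (x, z)" by (cases p)
  obtain \<gamma> where \<gamma>: "\<gamma> \<in> PU" "x \<in> \<gamma> ` region vs" by (rule tiles_cover)
  then obtain y where y: "y \<in> region vs" "x = \<gamma> y" by blast
  define k where "k = \<lfloor>z / h\<rfloor>"
  have "of_int k \<le> z / h" "z / h < of_int (k + 1)" unfolding k_def by linarith+
  then have k: "of_int k * h \<le> z" "z \<le> of_int (k + 1) * h"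
    using height_pos by (simp_all add: pos_le_divide_eq pos_divide_less_eq less_imp_le)
  show ?thesis
  proof (cases "even k")
    case True
    then obtain m where m: "k = 2 * m" by blast
    have "p = prod_map \<gamma> 1 m (y, z - of_int k * h)" using p y m by simp
    moreover have "(y, z - of_int k * h) \<in> P" using y k by (simp add: mem_P algebra_simps)
    ultimately show ?thesis using that[OF SU_intro[OF \<gamma>(1), of 1 m]] by blast
  next
    case False
    then obtain m where m: "k = 2 * m + 1" by (rule oddE)
    have "p = prod_map \<gamma> (-1) (m + 1) (y, of_int (k + 1) * h - z)" using p y m by (simp add: algebra_simps)
    moreover have "(y, of_int (k + 1) * h - z) \<in> P" using y k by (simp add: mem_P algebra_simps)
    ultimately show ?thesis using that[OF SU_intro[OF \<gamma>(1), of "-1" "m + 1"]] by blast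
  qed
qed

lemma SU_locally_finite: "finite {g \<in> SU. g ` P \<inter> cball p R \<noteq> {}}"
proof -
  obtain x0 z0 where p: "p = (x0, z0)" by (cases p)
  \<comment> \<open>Bounds the vertical index: a copy near \<open>p\<close> satisfies
    \<open>\<bar>2 * k * h\<bar> \<le> R + \<bar>z0\<bar> + h\<close>.\<close>
  define K where "K = \<lceil>(R + \<bar>z0\<bar> + h) / h\<rceil>"
  have "{g \<in> SU. g ` P \<inter> cball p R \<noteq> {}} \<subseteq>
      (\<lambda>(\<gamma>, s, k). prod_map \<gamma> s k) ` ({\<gamma> \<in> PU. \<gamma> ` region vs \<inter> cball x0 R \<noteq> {}} \<times> {1, -1} \<times> {-K..K})"
  proof
    fix g assume "g \<in> {g \<in> SU. g ` P \<inter> cball p R \<noteq> {}}"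
    then obtain q where g: "g \<in> SU" "q \<in> P" "dist p (g q) \<le> R" by auto
    obtain x z where q: "q = (x, z)" by (cases q)
    obtain \<gamma> s k where \<gamma>: "\<gamma> \<in> PU" "s = 1 \<or> s = -1" "g = prod_map \<gamma> s k" by (rule SU_cases[OF g(1)])
    have x: "x \<in> region vs" "0 \<le> z" "z \<le> h" using g(2) q by (auto simp: mem_P)
    have d: "dist (x0, z0) (\<gamma> x, of_int s * z + 2 * of_int k * h) \<le> R" using g(3) p q \<gamma>(3) by simp
    have 1: "dist x0 (\<gamma> x) \<le> R"
      using dist_fst_le[of "(x0, z0)" "(\<gamma> x, of_int s * z + 2 * of_int k * h)"] d by simp
    have 2: "\<bar>z0 - (of_int s * z + 2 * of_int k * h)\<bar> \<le> R"
      using dist_snd_le[of "(x0, z0)" "(\<gamma> x, of_int s * z + 2 * of_int k * h)"] d by (simp add: dist_real_def)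
    have 3: "\<bar>of_int s * z\<bar> \<le> h" using \<gamma>(2) x by auto
    have "\<bar>2 * of_int k * h\<bar> \<le> R + \<bar>z0\<bar> + h" using 2 3 by linarith
    then have 4: "2 * \<bar>of_int k\<bar> \<le> (R + \<bar>z0\<bar> + h) / h"
      using height_pos by (simp add: pos_le_divide_eq abs_mult)
    have "\<bar>of_int k\<bar> \<le> (of_int K :: real)"
      using 4 le_of_int_ceiling[of "(R + \<bar>z0\<bar> + h) / h"] abs_ge_zero[of "of_int k :: real"] unfolding K_def by linarith
    then have "\<bar>k\<bar> \<le> K" by linarith
    then have "k \<in> {-K..K}" by auto
    moreover have "\<gamma> ` region vs \<inter> cball x0 R \<noteq> {}" using 1 x by auto
    ultimately have "(\<gamma>, s, k) \<in> {\<gamma> \<in> PU. \<gamma> ` region vs \<inter> cball x0 R \<noteq> {}} \<times> {1, -1} \<times> {-K..K}"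
      using \<gamma> by blast
    then show "g \<in> (\<lambda>(\<gamma>, s, k). prod_map \<gamma> s k) ` ({\<gamma> \<in> PU. \<gamma> ` region vs \<inter> cball x0 R \<noteq> {}} \<times> {1, -1} \<times> {-K..K})"
      by (rule rev_image_eqI) (simp add: \<gamma>(3))
  qed
  moreover have "finite ((\<lambda>(\<gamma>, s, k). prod_map \<gamma> s k) ` ({\<gamma> \<in> PU. \<gamma> ` region vs \<inter> cball x0 R \<noteq> {}} \<times> {1, -1} \<times> {-K..K}))"
    using locally_finite by (intro finite_imageI finite_cartesian_product) auto
  ultimately show ?thesis using finite_subset by blast
qed

text \<open>Cocompactness: an unfolding moves \<open>p\<close> into the prism, and a ball about the
  fixed point \<open>q0\<close>, enlarged by \<open>pdiam\<close>, then serves all \<open>p\<close>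
  at once.\<close>

lemma SU_uniform: obtains M where "\<And>p. card {g \<in> SU. g ` P \<inter> cball p R \<noteq> {}} \<le> M"
proof -
  obtain q0 where q0: "q0 \<in> P"
    using inside_nonempty core_subset_region height_pos mem_P by (metis ex_in_conv less_imp_le order_refl subsetD)
  define F where "F = {f \<in> SU. f ` P \<inter> cball q0 (R + pdiam) \<noteq> {}}"
  have finF: "finite F" unfolding F_def by (rule SU_locally_finite)
  have "card {g \<in> SU. g ` P \<inter> cball p R \<noteq> {}} \<le> card F" for p
  proof -
    obtain g where g: "g \<in> SU" "p \<in> g ` P" by (rule SU_cover)
    then obtain q where q: "q \<in> P" "p = g q" by blast
    obtain g' where g': "g' \<in> SU" "g \<circ> g' = id" "g' \<circ> g = id" by (rule SU_inverse[OF g(1)])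
    have gg: "g' (g y) = y" for y using g'(3) by (metis comp_apply id_apply)
    have "{f \<in> SU. f ` P \<inter> cball p R \<noteq> {}} \<subseteq> (\<lambda>f. g \<circ> f) ` F"
    proof
      fix f assume "f \<in> {f \<in> SU. f ` P \<inter> cball p R \<noteq> {}}"
      then obtain y where f: "f \<in> SU" "y \<in> P" "dist p (f y) \<le> R" by auto
      have "dist (g' p) (g' (f y)) \<le> R" using f(3) rigid_dist[OF SU_rigid[OF g'(1)]] by simp
      then have "dist q (g' (f y)) \<le> R" using q gg by simp
      moreover have "dist q0 q < pdiam" by (rule pdiam_bound[OF q0 q(1)])
      ultimately have "dist q0 (g' (f y)) \<le> R + pdiam"
        using dist_triangle[of q0 "g' (f y)" q] by linarith
      then have "(g' \<circ> f) y \<in> cball q0 (R + pdiam)" by simp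
      then have "g' \<circ> f \<in> F" using SU_comp[OF g'(1) f(1)] f(2) unfolding F_def by blast
      moreover have "f = g \<circ> (g' \<circ> f)" by (simp only: o_assoc g'(2) id_comp)
      ultimately show "f \<in> (\<lambda>f. g \<circ> f) ` F" by blast
    qed
    then have "card {f \<in> SU. f ` P \<inter> cball p R \<noteq> {}} \<le> card ((\<lambda>f. g \<circ> f) ` F)"
      using finF by (intro card_mono) auto
    also have "\<dots> \<le> card F" by (rule card_image_le[OF finF])
    finally show ?thesis .
  qed
  then show ?thesis using that by blast
qed

text \<open>The balls are centred on one fixed line per direction, so that all orbits with direction
  \<open>v\<close> share a single finite set of copies. In the radius, one \<open>pdiam\<close> pays
  for the starting point of the orbit and one for rounding the time to a multiple of
  \<open>pdiam\<close>.\<close>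

definition tube :: "space \<Rightarrow> nat \<Rightarrow> (space \<Rightarrow> space) set" where
  "tube v J = {g \<in> SU. \<exists>j\<le>J. g ` P \<inter> cball ((vs ! 0, 0) + (real j * pdiam) *\<^sub>R v) (2 * pdiam) \<noteq> {}}"

lemma tube_eq: "tube v J = (\<Union>j\<le>J. {g \<in> SU. g ` P \<inter> cball ((vs ! 0, 0) + (real j * pdiam) *\<^sub>R v) (2 * pdiam) \<noteq> {}})"
  by (auto simp: tube_def)

lemma finite_tube: "finite (tube v J)"
  unfolding tube_eq by (intro finite_UN_I SU_locally_finite) auto

lemma card_tube: obtains M where "0 < M" "\<And>v J. card (tube v J) \<le> M * (J + 1)"
proof -
  obtain M where M: "\<And>p. card {g \<in> SU. g ` P \<inter> cball p (2 * pdiam) \<noteq> {}} \<le> M" by (rule SU_uniform) blast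
  have "card (tube v J) \<le> Suc M * (J + 1)" for v J
  proof -
    have "card (tube v J) \<le> (\<Sum>j\<le>J. card {g \<in> SU. g ` P \<inter> cball ((vs ! 0, 0) + (real j * pdiam) *\<^sub>R v) (2 * pdiam) \<noteq> {}})"
      unfolding tube_eq by (rule card_UN_le) simp
    also have "\<dots> \<le> (\<Sum>j\<le>J. M)" by (intro sum_mono M)
    also have "\<dots> \<le> Suc M * (J + 1)" by simp
    finally show ?thesis .
  qed
  then show ?thesis using that[of "Suc M"] by blast
qed

lemma tubeI:
  assumes g: "g \<in> SU" "m + s *\<^sub>R v \<in> g ` P" and m: "m \<in> P" and v: "norm v = 1"
    and s: "0 \<le> s" "s \<le> real J * pdiam"
  shows "g \<in> tube v J"
proof -
  define j where "j = nat \<lfloor>s / pdiam\<rfloor>"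
  have q: "0 \<le> s / pdiam" using s pdiam_pos by simp
  then have j: "real j \<le> s / pdiam" "s / pdiam < real j + 1" by (auto simp: j_def)
  have jp: "real j * pdiam \<le> s" "s < real j * pdiam + pdiam"
    using j pdiam_pos by (simp_all add: pos_le_divide_eq pos_divide_less_eq algebra_simps)
  have "real j * pdiam \<le> real J * pdiam" using jp s by linarith
  then have jJ: "j \<le> J" using pdiam_pos by simp
  have v0: "(vs ! 0, 0) \<in> P" using set_vs_outline height_pos by (auto simp: mem_P region_def)
  have "dist ((vs ! 0, 0) + (real j * pdiam) *\<^sub>R v) (m + s *\<^sub>R v) = norm (((vs ! 0, 0) - m) + (real j * pdiam - s) *\<^sub>R v)"
    by (simp add: dist_norm algebra_simps)
  also have "\<dots> \<le> norm ((vs ! 0, 0) - m) + norm ((real j * pdiam - s) *\<^sub>R v)" by (rule norm_triangle_ineq)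
  also have "\<dots> \<le> pdiam + pdiam"
    using pdiam_bound[OF v0 m] jp v by (intro add_mono) (auto simp: dist_norm)
  finally have "m + s *\<^sub>R v \<in> cball ((vs ! 0, 0) + (real j * pdiam) *\<^sub>R v) (2 * pdiam)" by simp
  then show ?thesis using g jJ unfolding tube_def by blast
qed

context
  fixes x :: "int \<Rightarrow> state"
  assumes orbit: "billiard_orbit vs h x" and dir: "norm (snd (x 0)) = 1"
begin

lemma hit_le: "hit x k i \<le> real i * pdiam"
proof (induction i)
  case (Suc i)
  have "step_time x (k + int i) = dist (fst (x (k + int i))) (fst (x (k + int i + 1)))"
    using step_time[OF orbit, of "k + int i"] norm_direction[OF orbit, of "k + int i"] dir by (simp add: dist_norm)
  also have "\<dots> < pdiam" by (intro pdiam_bound orbit_in_P[OF orbit])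
  finally show ?case using Suc by (simp add: hit_Suc algebra_simps)
qed simp

lemma hit_nonneg: "0 \<le> hit x k i"
  using hit_mono[OF orbit dir, of 0 i k] by (cases i) auto

lemma unf_tube:
  assumes "hit x k i \<le> real J * pdiam"
  shows "unf x k i \<in> tube (snd (x k)) J"
proof (rule tubeI[OF unf_SU[OF orbit dir]])
  show "fst (x k) + hit x k i *\<^sub>R snd (x k) \<in> unf x k i ` P"
    using unf_point(1)[OF orbit dir] orbit_in_P[OF orbit] by (metis image_eqI)
qed (use assms hit_nonneg orbit_in_P[OF orbit] norm_direction[OF orbit] dir in auto)

text \<open>If a copy were entered twice, convexity would keep the line in its interior in between,
  although it crosses a face of that copy at the time \<open>T\<close> of leaving it.\<close>

lemma unf_inj: "inj (unf x k)"
proof (rule linorder_injI)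
  fix i j :: nat assume ij: "i < j"
  show "unf x k i \<noteq> unf x k j"
  proof
    assume eq: "unf x k i = unf x k j"
    let ?I = "unf x k i ` interior P"
    obtain si where si: "hit x k i < si" "si < hit x k (Suc i)" using dense hit_mono[OF orbit dir, of i "Suc i"] by blast
    obtain sj where sj: "hit x k j < sj" "sj < hit x k (Suc j)" using dense hit_mono[OF orbit dir, of j "Suc j"] by blast
    have g: "unf x k i \<in> SU" by (rule unf_SU[OF orbit dir])
    have "convex ?I"
    proof -
      have "?I = interior (unf x k i ` P)" by (rule rigid_interior[OF SU_rigid[OF g], symmetric])
      moreover have "convex (unf x k i ` P)"
        unfolding convex_alt
      proof (intro ballI allI impI)
        fix a b and u :: real assume ab: "a \<in> unf x k i ` P" "b \<in> unf x k i ` P" "0 \<le> u \<and> u \<le> 1"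
        then obtain a' b' where "a' \<in> P" "b' \<in> P" "a = unf x k i a'" "b = unf x k i b'" by blast
        then show "(1 - u) *\<^sub>R a + u *\<^sub>R b \<in> unf x k i ` P"
          using convex_P[unfolded convex_alt] ab(3) rigid_combo[OF SU_rigid[OF g]] by (metis image_eqI)
      qed
      ultimately show ?thesis using convex_interior by simp
    qed
    define T where "T = hit x k (Suc i)"
    have "T \<le> hit x k j" using ij hit_mono[OF orbit dir, of "Suc i" j k] by (cases "Suc i = j") (auto simp: T_def)
    then have T: "si < T" "T < sj" using si sj by (auto simp: T_def)
    define u where "u = (T - si) / (sj - si)"
    have u: "0 \<le> u" "u \<le> 1" using T by (auto simp: u_def)
    have "u * (sj - si) = T - si" using T by (simp add: u_def)
    then have "(1 - u) * si + u * sj = T" by (simp add: algebra_simps)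
    then have Teq: "fst (x k) + T *\<^sub>R snd (x k) = (1 - u) *\<^sub>R (fst (x k) + si *\<^sub>R snd (x k)) + u *\<^sub>R (fst (x k) + sj *\<^sub>R snd (x k))"
      by (simp add: algebra_simps flip: scaleR_add_left)
    have "fst (x k) + si *\<^sub>R snd (x k) \<in> ?I" "fst (x k) + sj *\<^sub>R snd (x k) \<in> ?I"
      using unf_between[OF orbit dir si] unf_between[OF orbit dir sj] eq by auto
    then have "fst (x k) + T *\<^sub>R snd (x k) \<in> ?I"
      unfolding Teq using \<open>convex ?I\<close> u unfolding convex_alt by blast
    then obtain q where q: "q \<in> interior P" "unf x k i q = fst (x k) + T *\<^sub>R snd (x k)" by auto
    obtain q' where q': "q' \<in> face_set vs h (face_at x (k + int i + 1))" "unf x k i q' = fst (x k) + T *\<^sub>R snd (x k)"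
      using unf_face[OF orbit dir, of k i] unfolding T_def by auto
    have "q = q'" using q q' rigid_inj[OF SU_rigid[OF g]] by (metis injD)
    then show False
      using fht_face[OF face_at(1)[OF orbit] q'(1)] interior_fht[OF face_at(1)[OF orbit] q(1), of "k + int i + 1"] by simp
  qed
qed

end

end

section \<open>Words of the language and trajectories sharing a word\<close>

context prism_table
begin

lemma language_eq:
  "billiard_language vs h n v =
    {map (\<lambda>i. face_at x (k + int i)) [0..<n] | x k. billiard_orbit vs h x \<and> snd (x 0) = v}"
proof (intro set_eqI iffI)
  fix w assume "w \<in> billiard_language vs h n v"
  then obtain x k where w: "length w = n" "set w \<subseteq> faces vs" and x: "billiard_orbit vs h x" "snd (x 0) = v"
    and f: "\<And>i. i < n \<Longrightarrow> fst (x (k + int i)) \<in> face_set vs h (w ! i)"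
    unfolding billiard_language_def by blast
  have "face_at x (k + int i) = w ! i" if "i < n" for i
    using w that by (intro face_at_eq[OF x(1)] f) (auto intro: nth_mem)
  then have "w = map (\<lambda>i. face_at x (k + int i)) [0..<n]"
    using w(1) by (intro nth_equalityI) auto
  then show "w \<in> {map (\<lambda>i. face_at x (k + int i)) [0..<n] | x k. billiard_orbit vs h x \<and> snd (x 0) = v}"
    using x by blast
next
  fix w assume "w \<in> {map (\<lambda>i. face_at x (k + int i)) [0..<n] | x k. billiard_orbit vs h x \<and> snd (x 0) = v}"
  then obtain x k where w: "w = map (\<lambda>i. face_at x (k + int i)) [0..<n]" and x: "billiard_orbit vs h x" "snd (x 0) = v" by blast
  have "set w \<subseteq> faces vs" using face_at(1)[OF x(1)] by (auto simp: w)
  moreover have "\<forall>i<n. fst (x (k + int i)) \<in> face_set vs h (w ! i)" using face_at(2)[OF x(1)] by (simp add: w)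
  moreover have "length w = n" by (simp add: w)
  ultimately show "w \<in> billiard_language vs h n v" unfolding billiard_language_def using x by blast
qed

lemma finite_language: "finite (billiard_language vs h n v)"
proof (rule finite_subset)
  show "billiard_language vs h n v \<subseteq> {w. set w \<subseteq> faces vs \<and> length w = n}"
    by (auto simp: billiard_language_def)
  show "finite {w. set w \<subseteq> faces vs \<and> length w = n}"
    by (rule finite_lists_length_eq[OF finite_faces])
qed

text \<open>Relative interiors of faces are convex. On a lateral face this uses that a vertex is not
  a proper mixture of points of the polygon.\<close>

lemma face_rel_convex:
  assumes f: "f \<in> faces vs" and p: "p \<in> face_set vs h f" "p \<notin> edge_set" and q: "q \<in> face_set vs h f" "q \<notin> edge_set"
    and u: "0 \<le> u" "u \<le> 1"
  shows "(1 - u) *\<^sub>R p + u *\<^sub>R q \<in> face_set vs h f" "(1 - u) *\<^sub>R p + u *\<^sub>R q \<notin> edge_set"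
proof -
  let ?r = "(1 - u) *\<^sub>R p + u *\<^sub>R q"
  have core: "x \<notin> outline vs" if "x \<in> core" for x using that core_not_Skel outline_Skel by blast
  have "?r \<in> face_set vs h f \<and> ?r \<notin> edge_set"
    using face_rel_cases[OF f p]
  proof cases
    case (1 i x z)
    obtain x' z' where q': "q = (x', z')" "x' \<in> side vs i" "x' \<notin> set vs" "0 < z'" "z' < h"
      using face_rel_cases[OF f q] 1(2) by cases auto
    have r: "?r = ((1 - u) *\<^sub>R x + u *\<^sub>R x', (1 - u) * z + u * z')" using 1 q' by simp
    have xs: "(1 - u) *\<^sub>R x + u *\<^sub>R x' \<in> side vs i"
      using 1 q' u convex_closed_segment unfolding side_def convex_alt by blast
    have z: "0 < (1 - u) * z + u * z'" "(1 - u) * z + u * z' < h"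
      using convexD_alt[of "{0<..<h}" z z' u] 1 q' u by auto
    have "(1 - u) *\<^sub>R x + u *\<^sub>R x' \<notin> set vs"
    proof
      assume v: "(1 - u) *\<^sub>R x + u *\<^sub>R x' \<in> set vs"
      have "u \<noteq> 0" using v 1 by auto
      moreover have "u \<noteq> 1" using v q' by auto
      ultimately have "x = (1 - u) *\<^sub>R x + u *\<^sub>R x'"
        using vertex_extreme[OF v, of x x' u] side_region[OF 1(1)] 1 q' u by auto
      then show False using v 1 by simp
    qed
    then show ?thesis unfolding r 1(2) using xs z by (auto simp: mem_edge_set)
  next
    case (2 x)
    obtain x' where q': "q = (x', 0)" "x' \<in> core" using face_rel_cases[OF f q] 2(1) by cases auto
    have "(1 - u) *\<^sub>R x + u *\<^sub>R x' \<in> core" using convexD_alt[OF convex_core 2(3) q'(2)] u by blast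
    then show ?thesis using core core_subset_region set_vs_outline 2 q' by (auto simp: mem_edge_set)
  next
    case (3 x)
    obtain x' where q': "q = (x', h)" "x' \<in> core" using face_rel_cases[OF f q] 3(1) by cases auto
    have h: "(1 - u) * h + u * h = h" by (simp add: algebra_simps)
    have "(1 - u) *\<^sub>R x + u *\<^sub>R x' \<in> core" using convexD_alt[OF convex_core 3(3) q'(2)] u by blast
    then show ?thesis using core core_subset_region set_vs_outline 3 q' h by (auto simp: mem_edge_set)
  qed
  then show "?r \<in> face_set vs h f" "?r \<notin> edge_set" by auto
qed

text \<open>The distance from the face hit first is affine in time, positive before the hit and zero
  at it, hence decreasing. It is positive at the interior point \<open>a\<close>, so
  \<open>a\<close> is passed earlier.\<close>

lemma interior_before_first_hit:
  assumes x: "billiard_orbit vs h x" "norm (snd (x 0)) = 1" "x 0 = (a - t *\<^sub>R v, v)"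
    and a: "a \<in> interior P" "0 < t"
  shows "t < hit x 0 1"
proof (rule ccontr)
  assume c: "\<not> t < hit x 0 1"
  define T where "T = hit x 0 1"
  have h1: "hit x 0 (Suc 0) = T" by (simp add: T_def)
  have T: "0 < T" using hit_mono[OF x(1,2), of 0 1 0] by (simp add: T_def)
  define f where "f = face_at x (0 + int 0 + 1)"
  have f: "f \<in> faces vs" using face_at(1)[OF x(1)] by (simp add: f_def)
  define \<phi> where "\<phi> s = fht f (a - t *\<^sub>R v + s *\<^sub>R v)" for s
  have aff: "\<phi> s = \<phi> 0 + s * (v \<bullet> finn f)" for s
    unfolding \<phi>_def by (simp add: fht_add)
  have "\<phi> T = 0"
    using unf_face[OF x(1,2), of 0 0] fht_face[OF f] unfolding h1 \<phi>_def x(3) f_def[symmetric] by auto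
  moreover have "0 < \<phi> (T / 2)"
    using unf_between[OF x(1,2), of 0 0 "T / 2"] T interior_fht[OF f] unfolding h1 \<phi>_def x(3) by auto
  moreover have "0 < \<phi> t" using interior_fht[OF f a(1)] by (simp add: \<phi>_def)
  ultimately have e: "\<phi> 0 + T * (v \<bullet> finn f) = 0" "0 < \<phi> 0 + (T / 2) * (v \<bullet> finn f)" "0 < \<phi> 0 + t * (v \<bullet> finn f)"
    using aff by metis+
  then have "T * (v \<bullet> finn f) < (T / 2) * (v \<bullet> finn f)" "T * (v \<bullet> finn f) < t * (v \<bullet> finn f)" by linarith+
  then have "0 < (T / 2 - T) * (v \<bullet> finn f)" "0 < (t - T) * (v \<bullet> finn f)" by (simp_all add: algebra_simps)
  moreover have "T / 2 - T < 0" using T by simp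
  ultimately have "v \<bullet> finn f < 0" "0 < (t - T) * (v \<bullet> finn f)" by (simp_all only: zero_less_mult_iff) linarith+
  moreover have "0 \<le> t - T" using c by (simp add: T_def)
  ultimately show False using mult_nonneg_nonpos[of "t - T" "v \<bullet> finn f"] by linarith
qed

text \<open>Two trajectories with the same word cross the same copies through the same faces. By
  convexity so does every trajectory between them, which hence misses all edges.\<close>

lemma same_word_misses_grid:
  assumes x: "billiard_orbit vs h x" "x 0 = (a - t *\<^sub>R v, v)" "0 < t" "a \<in> interior P"
    and y: "billiard_orbit vs h y" "y 0 = (b - r *\<^sub>R v, v)" "0 < r" "b \<in> interior P"
    and v: "norm v = 1"
    and same: "\<And>i. i < n \<Longrightarrow> face_at x (int i + 1) = face_at y (int i + 1)"
    and u: "0 \<le> u" "u \<le> 1"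
    and s: "0 \<le> s" "s \<le> hit x 0 n - t" "s \<le> hit y 0 n - r"
  shows "(1 - u) *\<^sub>R a + u *\<^sub>R b + s *\<^sub>R v \<notin> grid"
proof -
  have dx: "norm (snd (x 0)) = 1" and dy: "norm (snd (y 0)) = 1" using x(2) y(2) v by auto
  have eqU: "unf x 0 i = unf y 0 i" if "i \<le> n" for i
    using same that by (intro unf_cong[of n]) auto
  \<comment> \<open>Hit times counted from \<open>a\<close> and \<open>b\<close> instead of from the
    boundary states. The entry 0 is reset to 0, since \<open>hit x 0 0 - t\<close> would be
    negative; \<open>\<rho>\<close> collects the corresponding times on the line in between.\<close>
  define \<tau> where "\<tau> i = (if i = 0 then 0 else hit x 0 i - t)" for i
  define \<sigma> where "\<sigma> i = (if i = 0 then 0 else hit y 0 i - r)" for i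
  define \<rho> where "\<rho> i = (1 - u) * \<tau> i + u * \<sigma> i" for i
  have conv_int: "(1 - w) *\<^sub>R p + w *\<^sub>R q \<in> unf x 0 i ` interior P"
    if pq: "p \<in> unf x 0 i ` interior P" "q \<in> unf x 0 i ` interior P" "0 \<le> w" "w \<le> 1" for p q w i
  proof -
    from pq(1) obtain p' where "p = unf x 0 i p'" "p' \<in> interior P" by (elim imageE)
    moreover from pq(2) obtain q' where "q = unf x 0 i q'" "q' \<in> interior P" by (elim imageE)
    moreover from calculation have "(1 - w) *\<^sub>R p' + w *\<^sub>R q' \<in> interior P"
      using convexD_alt[OF convex_interior[OF convex_P]] pq(3,4) by blast
    ultimately show ?thesis using rigid_combo[OF SU_rigid[OF unf_SU[OF x(1) dx]]] by (metis image_eqI)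
  qed
  have free: "p \<notin> grid" if "p \<in> unf x 0 i ` interior P" for p i
    using that grid_iff[OF unf_SU[OF x(1) dx]] grid_interior by blast
  have \<tau>: "\<tau> i < \<tau> (Suc i)" and xin: "\<tau> i < w \<Longrightarrow> w < \<tau> (Suc i) \<Longrightarrow> a + w *\<^sub>R v \<in> unf x 0 i ` interior P" for i w
  proof -
    have 1: "t < hit x 0 (Suc 0)" using interior_before_first_hit[OF x(1) dx x(2,4,3)] by simp
    then show "\<tau> i < \<tau> (Suc i)" using hit_mono[OF x(1) dx, of i "Suc i" 0] by (auto simp: \<tau>_def)
    assume w: "\<tau> i < w" "w < \<tau> (Suc i)"
    have "hit x 0 i < w + t" "w + t < hit x 0 (Suc i)" using w x(3) by (auto simp: \<tau>_def split: if_splits)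
    from unf_between[OF x(1) dx this] show "a + w *\<^sub>R v \<in> unf x 0 i ` interior P"
      by (simp add: x(2) algebra_simps)
  qed
  have \<sigma>: "\<sigma> i < \<sigma> (Suc i)" and yin: "\<sigma> i < w \<Longrightarrow> w < \<sigma> (Suc i) \<Longrightarrow> b + w *\<^sub>R v \<in> unf y 0 i ` interior P" for i w
  proof -
    have 1: "r < hit y 0 (Suc 0)" using interior_before_first_hit[OF y(1) dy y(2,4,3)] by simp
    then show "\<sigma> i < \<sigma> (Suc i)" using hit_mono[OF y(1) dy, of i "Suc i" 0] by (auto simp: \<sigma>_def)
    assume w: "\<sigma> i < w" "w < \<sigma> (Suc i)"
    have "hit y 0 i < w + r" "w + r < hit y 0 (Suc i)" using w y(3) by (auto simp: \<sigma>_def split: if_splits)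
    from unf_between[OF y(1) dy this] show "b + w *\<^sub>R v \<in> unf y 0 i ` interior P"
      by (simp add: y(2) algebra_simps)
  qed
  have xface: "a + \<tau> (Suc i) *\<^sub>R v \<in> unf x 0 i ` (face_set vs h (face_at x (int i + 1)) - edge_set)" for i
    using unf_face[OF x(1) dx, of 0 i] by (simp add: x(2) \<tau>_def algebra_simps)
  have yface: "b + \<sigma> (Suc i) *\<^sub>R v \<in> unf y 0 i ` (face_set vs h (face_at y (int i + 1)) - edge_set)" for i
    using unf_face[OF y(1) dy, of 0 i] by (simp add: y(2) \<sigma>_def algebra_simps)
  have split: "(1 - u) *\<^sub>R a + u *\<^sub>R b + ((1 - u) * p + u * q) *\<^sub>R v = (1 - u) *\<^sub>R (a + p *\<^sub>R v) + u *\<^sub>R (b + q *\<^sub>R v)" for p q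
    by (simp add: algebra_simps)
  show ?thesis
  proof (cases "s = 0")
    case True
    have "(1 - u) *\<^sub>R a + u *\<^sub>R b \<in> interior P"
      by (rule convexD_alt[OF convex_interior[OF convex_P] x(4) y(4) u])
    then show ?thesis using True grid_interior by simp
  next
    case False
    have \<rho>n: "s \<le> \<rho> n"
    proof -
      have "s \<le> \<tau> n \<or> n = 0" "s \<le> \<sigma> n \<or> n = 0" using s by (auto simp: \<tau>_def \<sigma>_def)
      moreover have "n \<noteq> 0" using s False x(3) by (intro notI) simp
      ultimately have "(1 - u) * s \<le> (1 - u) * \<tau> n" "u * s \<le> u * \<sigma> n" using u by (auto intro: mult_left_mono)
      then have "(1 - u) * s + u * s \<le> \<rho> n" unfolding \<rho>_def by linarith
      then show ?thesis by (simp add: algebra_simps)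
    qed
    \<comment> \<open>The first crossing of the intermediate line that is not before time
      \<open>s\<close>; it identifies the copy in which the point at time \<open>s\<close>
      lies.\<close>
    define m where "m = (LEAST i. s \<le> \<rho> i)"
    have m: "s \<le> \<rho> m" "m \<le> n" unfolding m_def using \<rho>n by (auto intro: LeastI Least_le)
    have "m \<noteq> 0" using m(1) False s(1) by (intro notI) (simp add: \<rho>_def \<tau>_def \<sigma>_def)
    then obtain i where i: "m = Suc i" by (cases m) auto
    have "\<rho> i < s" using not_less_Least[of i "\<lambda>i. s \<le> \<rho> i"] i by (simp add: m_def)
    define d where "d = \<rho> (Suc i) - \<rho> i"
    define w where "w = (s - \<rho> i) / d"
    have d: "0 < d" using \<open>\<rho> i < s\<close> m(1) i by (simp add: d_def)
    have w: "0 < w" "w \<le> 1" using \<open>\<rho> i < s\<close> m(1) i d by (auto simp: w_def d_def)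
    \<comment> \<open>The times \<open>p\<close> and \<open>q\<close> have the same relative
      position \<open>w\<close> within the \<open>i\<close>-th pieces of the outer trajectories, and
      they mix to \<open>s\<close>. The point in question is therefore a mixture of two points of
      the same copy.\<close>
    define p where "p = (1 - w) * \<tau> i + w * \<tau> (Suc i)"
    define q where "q = (1 - w) * \<sigma> i + w * \<sigma> (Suc i)"
    have "s = \<rho> i + w * d" using d by (simp add: w_def)
    also have "\<dots> = (1 - u) * p + u * q" by (simp add: p_def q_def d_def \<rho>_def algebra_simps)
    finally have spq: "s = (1 - u) * p + u * q" .
    show ?thesis
    \<comment> \<open>At \<open>w = 1\<close> both outer points lie on the same face off the edges;
      for smaller \<open>w\<close> both are interior.\<close>
    proof (cases "w = 1")
      case True
      have "i < n" using m(2) i by simp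
      define f where "f = face_at x (int i + 1)"
      have f: "f \<in> faces vs" using face_at(1)[OF x(1)] by (simp add: f_def)
      obtain a' where a': "a' \<in> face_set vs h f" "a' \<notin> edge_set" "a + p *\<^sub>R v = unf x 0 i a'"
        using xface[of i] True by (auto simp: f_def p_def)
      obtain b' where b': "b' \<in> face_set vs h f" "b' \<notin> edge_set" "b + q *\<^sub>R v = unf x 0 i b'"
        using yface[of i] True same[OF \<open>i < n\<close>] eqU[of i] \<open>i < n\<close> by (auto simp: f_def q_def)
      define c' where "c' = (1 - u) *\<^sub>R a' + u *\<^sub>R b'"
      have c': "c' \<in> face_set vs h f" "c' \<notin> edge_set"
        unfolding c'_def using face_rel_convex[OF f a'(1,2) b'(1,2) u] by auto
      then have "c' \<notin> grid" using grid_P face_subset_P[OF f] by blast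
      moreover have "(1 - u) *\<^sub>R a + u *\<^sub>R b + s *\<^sub>R v = unf x 0 i c'"
        unfolding spq split a'(3) b'(3) c'_def rigid_combo[OF SU_rigid[OF unf_SU[OF x(1) dx]]] ..
      ultimately show ?thesis using grid_iff[OF unf_SU[OF x(1) dx]] by simp
    next
      case False
      then have w1: "w < 1" using w by simp
      have cc: "A < (1 - w) * A + w * B" "(1 - w) * A + w * B < B" if "A < B" for A B
      proof -
        have "0 < w * (B - A)" "0 < (1 - w) * (B - A)" using that w w1 by auto
        then show "A < (1 - w) * A + w * B" "(1 - w) * A + w * B < B" by (simp_all add: algebra_simps)
      qed
      have "a + p *\<^sub>R v \<in> unf x 0 i ` interior P" unfolding p_def by (rule xin[OF cc[OF \<tau>]])
      moreover have "b + q *\<^sub>R v \<in> unf x 0 i ` interior P"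
        using yin[OF cc[OF \<sigma>]] eqU[of i] m(2) i unfolding q_def by simp
      ultimately have "(1 - u) *\<^sub>R (a + p *\<^sub>R v) + u *\<^sub>R (b + q *\<^sub>R v) \<in> unf x 0 i ` interior P"
        by (rule conv_int[OF _ _ u])
      then show ?thesis unfolding spq split by (rule free)
    qed
  qed
qed

text \<open>The \<open>n + 1\<close> copies visited up to hit \<open>n\<close> are distinct, while a
  tube of length \<open>J\<close> contains at most \<open>M * (J + 1)\<close> copies. So elapsed
  time grows at least linearly in the number of hits, uniformly over all orbits.\<close>

lemma hit_lower_bound:
  obtains M where "0 < M"
    "\<And>x n J. billiard_orbit vs h x \<Longrightarrow> norm (snd (x 0)) = 1 \<Longrightarrow> M * (J + 1) \<le> n \<Longrightarrow> real J * pdiam < hit x 0 n"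
proof -
  obtain M where M: "0 < M" "\<And>v J. card (tube v J) \<le> M * (J + 1)" by (rule card_tube) blast
  have "real J * pdiam < hit x 0 n"
    if x: "billiard_orbit vs h x" "norm (snd (x 0)) = 1" and n: "M * (J + 1) \<le> n" for x n J
  proof (rule ccontr)
    assume "\<not> real J * pdiam < hit x 0 n"
    then have le: "hit x 0 n \<le> real J * pdiam" by simp
    have "unf x 0 ` {..n} \<subseteq> tube (snd (x 0)) J"
    proof
      fix g assume "g \<in> unf x 0 ` {..n}"
      then obtain i where i: "i \<le> n" "g = unf x 0 i" by blast
      have "hit x 0 i \<le> hit x 0 n" using hit_mono[OF x, of i n 0] i by (cases "i = n") auto
      then show "g \<in> tube (snd (x 0)) J" unfolding i(2) using le by (intro unf_tube[OF x]) linarith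
    qed
    then have "card (unf x 0 ` {..n}) \<le> M * (J + 1)"
      using card_mono[OF finite_tube] M(2) order_trans by blast
    moreover have "card (unf x 0 ` {..n}) = Suc n"
      using unf_inj[OF x, of 0] by (simp add: card_image inj_on_subset)
    ultimately show False using n by simp
  qed
  then show ?thesis using that M(1) by blast
qed

end

subsection \<open>Consequences of irrationality\<close>

lemma vertical_segment:
  fixes w :: "'a::real_vector"
  assumes "a \<le> (b::real)" shows "{w} \<times> {a..b} = closed_segment (w, a) (w, b)"
proof (intro set_eqI iffI)
  fix p assume "p \<in> {w} \<times> {a..b}"
  then obtain z where z: "p = (w, z)" "z \<in> closed_segment a b" using assms by (auto simp: closed_segment_eq_real_ivl)
  then obtain u where u: "0 \<le> u" "u \<le> 1" "z = (1 - u) * a + u * b" by (auto simp: in_segment)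
  have "p = (1 - u) *\<^sub>R (w, a) + u *\<^sub>R (w, b)" using z(1) u(3) by (simp add: algebra_simps)
  then show "p \<in> closed_segment (w, a) (w, b)" using u unfolding closed_segment_def by blast
next
  fix p assume "p \<in> closed_segment (w, a) (w, b)"
  then obtain u where u: "0 \<le> u" "u \<le> 1" "p = (1 - u) *\<^sub>R (w, a) + u *\<^sub>R (w, b)" by (auto simp: in_segment)
  have "p = (w, (1 - u) * a + u * b)" unfolding u(3) by (simp add: algebra_simps)
  moreover have "(1 - u) * a + u * b \<in> {a..b}" using convexD_alt[of "{a..b}" a b u] u assms by simp
  ultimately show "p \<in> {w} \<times> {a..b}" by simp
qed

lemma horizontal_segment:
  fixes a b :: "'a::real_vector" and z :: real
  shows "closed_segment a b \<times> {z} = closed_segment (a, z) (b, z)"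
proof (intro set_eqI iffI)
  fix p assume "p \<in> closed_segment a b \<times> {z}"
  then obtain u where u: "0 \<le> u" "u \<le> 1" "p = ((1 - u) *\<^sub>R a + u *\<^sub>R b, z)" by (auto simp: in_segment)
  have "p = (1 - u) *\<^sub>R (a, z) + u *\<^sub>R (b, z)" unfolding u(3) by (simp add: algebra_simps)
  then show "p \<in> closed_segment (a, z) (b, z)" using u unfolding closed_segment_def by blast
next
  fix p assume "p \<in> closed_segment (a, z) (b, z)"
  then obtain u where u: "0 \<le> u" "u \<le> 1" "p = (1 - u) *\<^sub>R (a, z) + u *\<^sub>R (b, z)" by (auto simp: in_segment)
  have "p = ((1 - u) *\<^sub>R a + u *\<^sub>R b, z)" unfolding u(3) by (simp add: algebra_simps)
  then show "p \<in> closed_segment a b \<times> {z}" using u unfolding closed_segment_def by blast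
qed

locale irrational_direction = prism_table vs h for vs h +
  fixes \<theta> :: "real^2" and c :: real
  assumes unit: "norm (\<theta>, c) = 1" and BP: "BP_irrational vs h (\<theta>, c)"
begin

lemma ray_segment:
  fixes p v :: "'a::real_vector"
  assumes "0 \<le> s" "s \<le> t" "0 < t"
  shows "p + s *\<^sub>R v \<in> closed_segment p (p + t *\<^sub>R v)"
proof -
  have "p + s *\<^sub>R v = (1 - s / t) *\<^sub>R p + (s / t) *\<^sub>R (p + t *\<^sub>R v)"
    using assms by (simp add: algebra_simps)
  moreover have "0 \<le> s / t" "s / t \<le> 1" using assms by auto
  ultimately show ?thesis unfolding closed_segment_def by blast
qed

lemma no_parallel_pair:
  assumes e: "e \<in> unfolded_edges vs h" "e' \<in> unfolded_edges vs h" "e \<noteq> e'" "parallel_edges e e'"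
    and p: "p \<in> e" "p + t *\<^sub>R (\<theta>, c) \<in> e'" "0 < t"
  shows False
proof -
  have "diagonal vs h (\<theta>, c) (closed_segment p (p + t *\<^sub>R (\<theta>, c)))"
    unfolding diagonal_def using e p by blast
  moreover have "closed_segment p (p + t *\<^sub>R (\<theta>, c)) \<inter> e \<noteq> {}" "closed_segment p (p + t *\<^sub>R (\<theta>, c)) \<inter> e' \<noteq> {}"
    using p by auto
  ultimately show False using BP e unfolding BP_irrational_def by blast
qed

lemma no_three_edges:
  assumes e: "e1 \<in> unfolded_edges vs h" "e2 \<in> unfolded_edges vs h" "e3 \<in> unfolded_edges vs h"
    and ne: "e1 \<noteq> e2" "e1 \<noteq> e3" "e2 \<noteq> e3"
    and p: "p \<in> e1" "p + s *\<^sub>R (\<theta>, c) \<in> e2" "p + t *\<^sub>R (\<theta>, c) \<in> e3" "0 < s" "s < t"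
  shows False
proof -
  let ?v = "(\<theta>, c)"
  have d: "diagonal vs h ?v (closed_segment p (p + t *\<^sub>R ?v))"
    unfolding diagonal_def using e p order.strict_trans by blast
  have "p + s *\<^sub>R ?v \<in> closed_segment p (p + t *\<^sub>R ?v)" using p by (intro ray_segment) auto
  then have i: "closed_segment p (p + t *\<^sub>R ?v) \<inter> e1 \<noteq> {}" "closed_segment p (p + t *\<^sub>R ?v) \<inter> e2 \<noteq> {}"
    "closed_segment p (p + t *\<^sub>R ?v) \<inter> e3 \<noteq> {}"
    using p by auto
  have "\<not> parallel_edges e1 e2" using no_parallel_pair[OF e(1,2) ne(1) _ p(1,2,4)] by blast
  moreover have "\<not> parallel_edges e1 e3"
  proof
    assume par: "parallel_edges e1 e3"
    show False by (rule no_parallel_pair[OF e(1,3) ne(2) par p(1,3)]) (use p in linarith)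
  qed
  moreover have "\<not> parallel_edges e2 e3"
  proof
    assume par: "parallel_edges e2 e3"
    have p3: "p + s *\<^sub>R ?v + (t - s) *\<^sub>R ?v \<in> e3"
      using p(3) by (simp only: add.assoc scaleR_add_left[symmetric]) simp
    show False by (rule no_parallel_pair[OF e(2,3) ne(3) par p(2) p3]) (use p(5) in linarith)
  qed
  ultimately show False using BP d i e unfolding BP_irrational_def by blast
qed

text \<open>A vertical line joins points of a bottom edge and of the parallel top edge above
  it.\<close>

lemma \<theta>_nz: "\<theta> \<noteq> 0"
proof
  assume 0: "\<theta> = 0"
  then have c: "\<bar>c\<bar> = 1" using unit by (simp add: norm_Pair)
  have par: "parallel_edges (side vs 0 \<times> {z}) (side vs 0 \<times> {z'})" for z z' :: real
    unfolding parallel_edges_def side_def horizontal_segment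
    using next_neq[of 0] by (intro exI[of _ "(vs ! 0, z)"] exI[of _ "(next_vertex vs 0, z)"]
      exI[of _ "(vs ! 0, z')"] exI[of _ "(next_vertex vs 0, z')"] exI[of _ 1]) auto
  have e: "side vs 0 \<times> {0} \<in> unfolded_edges vs h" "side vs 0 \<times> {h} \<in> unfolded_edges vs h"
    using horizontal_edge[OF PU_id, of 0 0] horizontal_edge[OF PU_id, of 0 1] by simp_all
  have v: "vs ! 0 \<in> side vs 0" by simp
  have ne: "side vs 0 \<times> {0} \<noteq> side vs 0 \<times> {h}"
  proof
    assume eq: "side vs 0 \<times> {0} = side vs 0 \<times> {h}"
    have "(vs ! 0, 0) \<in> side vs 0 \<times> {0}" using v by blast
    then have "(vs ! 0, 0) \<in> side vs 0 \<times> {h}" by (rule subsetD[OF equalityD1[OF eq]])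
    then show False using height_pos by simp
  qed
  show False
  proof (cases "0 < c")
    case True
    then show False using no_parallel_pair[OF e ne par, of "(vs ! 0, 0)" h] v height_pos 0 c by simp
  next
    case False
    then show False using no_parallel_pair[OF e(2,1) ne[symmetric] par, of "(vs ! 0, h)" h] v height_pos 0 c by simp
  qed
qed

text \<open>The spatial line starting at height 0 over \<open>w\<close> passes over the second
  vertex at height \<open>t * c\<close>. Its layer \<open>k\<close> determines a vertical edge
  there, parallel to the one over \<open>w\<close>.\<close>

lemma no_two_vertices:
  assumes w: "w \<in> Vert" "w + t *\<^sub>R \<theta> \<in> Vert" shows "t = 0"
proof -
  have pos: False if w: "w \<in> Vert" "w' \<in> Vert" "w' = w + t *\<^sub>R \<theta>" "0 < t" for w w' t
  proof -
    define k where "k = \<lfloor>t * c / h\<rfloor>"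
    have "of_int k \<le> t * c / h" "t * c / h < of_int (k + 1)" unfolding k_def by linarith+
    then have k: "of_int k * h \<le> t * c" "t * c \<le> of_int (k + 1) * h"
      using height_pos by (simp_all add: pos_le_divide_eq pos_divide_less_eq less_imp_le)
    have par: "parallel_edges ({w} \<times> {of_int i * h..of_int (i + 1) * h}) ({w'} \<times> {of_int j * h..of_int (j + 1) * h})" for i j :: int
    proof -
      have "of_int i * h \<le> of_int (i + 1) * h" for i :: int using height_pos by simp
      then show ?thesis
        unfolding parallel_edges_def using height_pos
        by (intro exI[of _ "(w, of_int i * h)"] exI[of _ "(w, of_int (i + 1) * h)"]
          exI[of _ "(w', of_int j * h)"] exI[of _ "(w', of_int (j + 1) * h)"] exI[of _ 1])
          (auto simp: vertical_segment algebra_simps)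
    qed
    have ne: "{w} \<times> {of_int 0 * h..of_int (0 + 1) * h} \<noteq> {w'} \<times> {of_int k * h..of_int (k + 1) * h}"
    proof
      assume eq: "{w} \<times> {of_int 0 * h..of_int (0 + 1) * h} = {w'} \<times> {of_int k * h..of_int (k + 1) * h}"
      have "(w, 0) \<in> {w} \<times> {of_int 0 * h..of_int (0 + 1) * h}" using height_pos by simp
      then have "w = w'" unfolding eq by simp
      then show False using that \<theta>_nz by simp
    qed
    show False
      by (rule no_parallel_pair[OF vertical_edge[OF w(1), of 0] vertical_edge[OF w(2), of k] ne par, of "(w, 0)" t])
        (use height_pos w k in auto)
  qed
  show ?thesis
    using pos[OF w refl] pos[of "w + t *\<^sub>R \<theta>" w "- t"] w by (cases t "0::real" rule: linorder_cases) auto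
qed

text \<open>Times at least \<open>diam / norm \<theta>\<close> apart give points at distance at
  least \<open>diam\<close>, too far apart for one side of a tile. So three different horizontal
  edges lie on one line.\<close>

lemma three_hits:
  assumes S: "x + t1 *\<^sub>R \<theta> \<in> Skel" "x + t2 *\<^sub>R \<theta> \<in> Skel" "x + t3 *\<^sub>R \<theta> \<in> Skel"
    and Z: "z + t1 * c = of_int k1 * h" "z + t2 * c = of_int k2 * h" "z + t3 * c = of_int k3 * h"
    and t: "t1 + diam / norm \<theta> \<le> t2" "t2 + diam / norm \<theta> \<le> t3"
  shows False
proof -
  have n: "0 < norm \<theta>" using \<theta>_nz by simp
  have \<delta>: "0 < diam / norm \<theta>" using n diam_pos by simp
  have E: "\<exists>A. A \<times> {of_int k * h} \<in> unfolded_edges vs h \<and> x + t *\<^sub>R \<theta> \<in> A \<and> (\<forall>a\<in>A. \<forall>b\<in>A. dist a b < diam)"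
    if tS: "x + t *\<^sub>R \<theta> \<in> Skel" for t and k :: int
  proof -
    from tS obtain \<gamma> where "\<gamma> \<in> PU" "x + t *\<^sub>R \<theta> \<in> \<gamma> ` outline vs" unfolding Skel_def by blast
    then obtain i where \<gamma>: "\<gamma> \<in> PU" "i < nv" "x + t *\<^sub>R \<theta> \<in> \<gamma> ` side vs i"
      unfolding outline_def by blast
    have "\<gamma> ` side vs i \<subseteq> \<gamma> ` region vs" using side_region[OF \<gamma>(2)] by blast
    then have "\<forall>a\<in>\<gamma> ` side vs i. \<forall>b\<in>\<gamma> ` side vs i. dist a b < diam" using tile_diam[OF \<gamma>(1)] by blast
    then show ?thesis using horizontal_edge[OF \<gamma>(1,2), of k] \<gamma>(3) by blast
  qed
  obtain A1 where A1: "A1 \<times> {of_int k1 * h} \<in> unfolded_edges vs h" "x + t1 *\<^sub>R \<theta> \<in> A1" "\<forall>a\<in>A1. \<forall>b\<in>A1. dist a b < diam"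
    using E[OF S(1), of k1] by blast
  obtain A2 where A2: "A2 \<times> {of_int k2 * h} \<in> unfolded_edges vs h" "x + t2 *\<^sub>R \<theta> \<in> A2" "\<forall>a\<in>A2. \<forall>b\<in>A2. dist a b < diam"
    using E[OF S(2), of k2] by blast
  obtain A3 where A3: "A3 \<times> {of_int k3 * h} \<in> unfolded_edges vs h" "x + t3 *\<^sub>R \<theta> \<in> A3" "\<forall>a\<in>A3. \<forall>b\<in>A3. dist a b < diam"
    using E[OF S(3), of k3] by blast
  have far: "A \<times> {i} \<noteq> B \<times> {j}"
    if A: "x + s *\<^sub>R \<theta> \<in> A" "x + t *\<^sub>R \<theta> \<in> B" "\<forall>a\<in>A. \<forall>b\<in>A. dist a b < diam" "s + diam / norm \<theta> \<le> t"
    for A B s t and i j :: real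
  proof
    assume "A \<times> {i} = B \<times> {j}"
    then have "A = B" using A by blast
    then have "dist (x + s *\<^sub>R \<theta>) (x + t *\<^sub>R \<theta>) < diam" using A by blast
    moreover have "dist (x + s *\<^sub>R \<theta>) (x + t *\<^sub>R \<theta>) = \<bar>s - t\<bar> * norm \<theta>"
      by (simp add: dist_norm flip: scaleR_diff_left)
    moreover have "diam / norm \<theta> * norm \<theta> \<le> \<bar>s - t\<bar> * norm \<theta>" using A(4) by (intro mult_right_mono) auto
    ultimately show False using n by simp
  qed
  have t13: "t1 + diam / norm \<theta> \<le> t3" using t \<delta> by linarith
  define p where "p = (x + t1 *\<^sub>R \<theta>, z + t1 * c)"
  have ps: "p + s *\<^sub>R (\<theta>, c) = (x + (t1 + s) *\<^sub>R \<theta>, z + (t1 + s) * c)" for s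
    by (simp add: p_def algebra_simps)
  show False
  proof (rule no_three_edges[OF A1(1) A2(1) A3(1) far[OF A1(2) A2(2) A1(3) t(1)] far[OF A1(2) A3(2) A1(3) t13] far[OF A2(2) A3(2) A2(3) t(2)], of p "t2 - t1" "t3 - t1"])
    show "p \<in> A1 \<times> {of_int k1 * h}" using A1(2) Z(1) by (simp add: p_def)
    show "p + (t2 - t1) *\<^sub>R (\<theta>, c) \<in> A2 \<times> {of_int k2 * h}" unfolding ps using A2(2) Z(2) by simp
    show "p + (t3 - t1) *\<^sub>R (\<theta>, c) \<in> A3 \<times> {of_int k3 * h}" unfolding ps using A3(2) Z(3) by simp
  qed (use t \<delta> in auto)
qed

lemma skel_time:
  obtains t where "a \<le> t" "t \<le> a + diam / norm \<theta>" "x + t *\<^sub>R \<theta> \<in> Skel"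
proof -
  have n: "0 < norm \<theta>" using \<theta>_nz by simp
  define \<delta> where "\<delta> = diam / norm \<theta>"
  have \<delta>: "0 < \<delta>" "\<delta> * norm \<theta> = diam" using n diam_pos by (auto simp: \<delta>_def)
  have "dist (x + a *\<^sub>R \<theta>) (x + (a + \<delta>) *\<^sub>R \<theta>) = diam"
    using \<delta> diam_pos by (simp add: dist_norm algebra_simps)
  then obtain u where u: "0 \<le> u" "u \<le> 1" "x + a *\<^sub>R \<theta> + u *\<^sub>R ((x + (a + \<delta>) *\<^sub>R \<theta>) - (x + a *\<^sub>R \<theta>)) \<in> Skel"
    using skel_hit[of "x + a *\<^sub>R \<theta>" "x + (a + \<delta>) *\<^sub>R \<theta>"] by auto
  have "x + (a + u * \<delta>) *\<^sub>R \<theta> \<in> Skel" using u(3) by (simp add: algebra_simps)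
  moreover have "0 \<le> u * \<delta>" "u * \<delta> \<le> \<delta>" using u \<delta> by (auto simp: mult_left_le_one_le)
  ultimately show ?thesis using that[of "a + u * \<delta>"] by (simp add: \<delta>_def)
qed

text \<open>A horizontal line at height 0 meets a horizontal edge whenever its projection meets the
  skeleton, hence in each of the windows starting at \<open>0\<close>, \<open>2 * \<delta>\<close>
  and \<open>4 * \<delta>\<close>; these are far enough apart for \<open>three_hits\<close>.\<close>

lemma c_nz: "c \<noteq> 0"
proof
  assume 0: "c = 0"
  define \<delta> where "\<delta> = diam / norm \<theta>"
  obtain t1 where t1: "0 \<le> t1" "t1 \<le> 0 + \<delta>" "0 + t1 *\<^sub>R \<theta> \<in> Skel" unfolding \<delta>_def by (rule skel_time)
  obtain t2 where t2: "2 * \<delta> \<le> t2" "t2 \<le> 2 * \<delta> + \<delta>" "0 + t2 *\<^sub>R \<theta> \<in> Skel" unfolding \<delta>_def by (rule skel_time)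
  obtain t3 where t3: "4 * \<delta> \<le> t3" "t3 \<le> 4 * \<delta> + \<delta>" "0 + t3 *\<^sub>R \<theta> \<in> Skel" unfolding \<delta>_def by (rule skel_time)
  show False
    by (rule three_hits[OF t1(3) t2(3) t3(3), of 0 0 0 0]) (use t1 t2 t3 0 in \<open>auto simp: \<delta>_def[symmetric]\<close>)
qed

end

subsection \<open>Sign patterns of affine functions\<close>

definition aff :: "('a::real_vector \<Rightarrow> real) \<Rightarrow> bool" where
  "aff \<phi> \<longleftrightarrow> (\<forall>x y u. \<phi> ((1 - u) *\<^sub>R x + u *\<^sub>R y) = (1 - u) * \<phi> x + u * \<phi> y)"

text \<open>The cell of \<open>x\<close> in the arrangement of the zero sets. The value 0 off
  \<open>F\<close> turns patterns into total functions, so that inserting a function is a mere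
  update.\<close>

definition pat :: "('a \<Rightarrow> real) set \<Rightarrow> 'a \<Rightarrow> ('a \<Rightarrow> real) \<Rightarrow> real" where
  "pat F x = (\<lambda>\<phi>. if \<phi> \<in> F then sgn (\<phi> x) else 0)"

lemma pat_eq_iff: "pat F x = pat F y \<longleftrightarrow> (\<forall>\<phi>\<in>F. sgn (\<phi> x) = sgn (\<phi> y))"
  by (auto simp: pat_def fun_eq_iff)

lemma sgn_combo:
  fixes a b u :: real
  assumes "sgn a = sgn b" "0 \<le> u" "u \<le> 1" shows "sgn ((1 - u) * a + u * b) = sgn a"
proof (cases a "0::real" rule: linorder_cases)
  case less
  then have "b < 0" using assms(1) by (simp add: sgn_if split: if_splits)
  then have "(1 - u) * a + u * b < 0" using less convexD_alt[of "{..<0}" a b u] assms by auto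
  then show ?thesis using less by simp
next
  case equal
  then have "b = 0" using assms(1) by (simp add: sgn_if split: if_splits)
  then show ?thesis using equal by simp
next
  case greater
  then have "0 < b" using assms(1) by (simp add: sgn_if split: if_splits)
  then have "0 < (1 - u) * a + u * b" using greater convexD_alt[of "{0<..}" a b u] assms by auto
  then show ?thesis using greater by simp
qed

lemma sgn_mult_cancel:
  fixes a b d :: real
  assumes "sgn (a * d) = sgn (b * d)" "d \<noteq> 0" shows "a < 0 \<longleftrightarrow> b < 0" "0 < a \<longleftrightarrow> 0 < b"
proof -
  have "sgn a = sgn b" using assms by (simp add: sgn_mult sgn_zero_iff)
  then show "a < 0 \<longleftrightarrow> b < 0" "0 < a \<longleftrightarrow> 0 < b" by (auto simp: sgn_if split: if_splits)
qed

lemma card_pat_insert_const: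
  assumes "finite (pat F ` S)" and const: "\<And>x. x \<in> S \<Longrightarrow> \<phi> x = 0"
  shows "finite (pat (insert \<phi> F) ` S)" "card (pat (insert \<phi> F) ` S) \<le> card (pat F ` S)"
proof -
  have "pat (insert \<phi> F) ` S = (\<lambda>p. p(\<phi> := 0)) ` pat F ` S"
    unfolding image_image by (rule image_cong) (auto simp: pat_def const)
  then show "finite (pat (insert \<phi> F) ` S)" "card (pat (insert \<phi> F) ` S) \<le> card (pat F ` S)"
    using assms(1) card_image_le by auto
qed

text \<open>Adding one function splits only those cells which meet its zero set, and those into at
  most three parts.\<close>

lemma card_pat_insert:
  assumes fin: "finite (pat F ` S)" and S: "convex S"
    and F: "\<And>\<psi>. \<psi> \<in> F \<Longrightarrow> aff \<psi>" and \<phi>: "aff \<phi>"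
  shows "finite (pat (insert \<phi> F) ` S)"
    "card (pat (insert \<phi> F) ` S) \<le> card (pat F ` S) + 2 * card (pat F ` (S \<inter> {x. \<phi> x = 0}))"
proof -
  let ?Z = "pat F ` (S \<inter> {x. \<phi> x = 0})"
  define t where "t p = sgn (\<phi> (SOME x. x \<in> S \<and> pat F x = p))" for p
  \<comment> \<open>The signs that the new function can take on cell \<open>p\<close>: all three if
    the cell meets the zero set, otherwise the sign at a sample point.\<close>
  define B where "B p = (if p \<in> ?Z then {-1, 0, 1} else {t p})" for p
  have finB: "finite (B p)" for p by (simp add: B_def)
  have ZF: "?Z \<subseteq> pat F ` S" by blast
  then have finZ: "finite ?Z" using fin finite_subset by blast
  have "pat (insert \<phi> F) ` S \<subseteq> (\<lambda>(p, s). p(\<phi> := s)) ` (SIGMA p:pat F ` S. B p)"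
  proof
    fix q assume "q \<in> pat (insert \<phi> F) ` S"
    then obtain x where x: "x \<in> S" "q = pat (insert \<phi> F) x" by blast
    define p where "p = pat F x"
    have q: "q = p(\<phi> := sgn (\<phi> x))" by (auto simp: x p_def pat_def)
    have "sgn (\<phi> x) \<in> B p"
    proof (cases "p \<in> ?Z")
      case True then show ?thesis by (auto simp: B_def sgn_if)
    next
      case False
      define y where "y = (SOME y. y \<in> S \<and> pat F y = p)"
      have y: "y \<in> S \<and> pat F y = p" unfolding y_def by (rule someI[of _ x]) (simp add: x p_def)
      have on: "\<phi> z \<noteq> 0" if "z \<in> S" "pat F z = p" for z using False that by blast
      have mid: "(1 - u) *\<^sub>R a + u *\<^sub>R b \<in> S \<and> pat F ((1 - u) *\<^sub>R a + u *\<^sub>R b) = p"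
        if ab: "a \<in> S" "pat F a = p" "b \<in> S" "pat F b = p" and u: "0 \<le> u" "u \<le> 1" for a b u
      proof
        show "(1 - u) *\<^sub>R a + u *\<^sub>R b \<in> S" by (rule convexD_alt[OF S ab(1,3) u])
        have "pat F a = pat F b" using ab by simp
        then have "sgn (\<psi> ((1 - u) *\<^sub>R a + u *\<^sub>R b)) = sgn (\<psi> a)" if "\<psi> \<in> F" for \<psi>
          using F[OF that] that sgn_combo[OF _ u] unfolding pat_eq_iff aff_def by metis
        then show "pat F ((1 - u) *\<^sub>R a + u *\<^sub>R b) = p" unfolding ab(2)[symmetric] pat_eq_iff by blast
      qed
      \<comment> \<open>Opposite signs within one cell would produce a zero on the segment joining
        the points, and cells are convex.\<close>
      have opp: False if ab: "a \<in> S" "pat F a = p" "b \<in> S" "pat F b = p" "\<phi> a < 0" "0 < \<phi> b" for a b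
      proof -
        define u where "u = \<phi> a / (\<phi> a - \<phi> b)"
        have u: "0 \<le> u" "u \<le> 1" using ab(5,6) by (auto simp: u_def divide_nonpos_neg field_simps)
        have "\<phi> ((1 - u) *\<^sub>R a + u *\<^sub>R b) = \<phi> a - u * (\<phi> a - \<phi> b)"
          using \<phi> by (simp add: aff_def algebra_simps)
        also have "\<dots> = 0" using ab(5,6) by (simp add: u_def)
        finally show False using on mid[OF ab(1-4) u] by blast
      qed
      have "\<phi> x \<noteq> 0" "\<phi> y \<noteq> 0" using on[OF x(1)] on[of y] y p_def by auto
      moreover have "\<not> (\<phi> x < 0 \<and> 0 < \<phi> y)" using opp[OF x(1) p_def[symmetric], of y] y by blast
      moreover have "\<not> (\<phi> y < 0 \<and> 0 < \<phi> x)" using opp[of y x] x(1) p_def y by blast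
      ultimately have "sgn (\<phi> x) = sgn (\<phi> y)" by (simp add: sgn_if)
      then show ?thesis using False by (simp add: B_def t_def y_def)
    qed
    moreover have "p \<in> pat F ` S" using x by (simp add: p_def)
    ultimately show "q \<in> (\<lambda>(p, s). p(\<phi> := s)) ` (SIGMA p:pat F ` S. B p)"
      using q by (intro image_eqI[of _ _ "(p, sgn (\<phi> x))"]) auto
  qed
  moreover have finS: "finite (SIGMA p:pat F ` S. B p)" using fin finB by (intro finite_SigmaI)
  ultimately show "finite (pat (insert \<phi> F) ` S)" using finite_subset by blast
  have "card (pat (insert \<phi> F) ` S) \<le> card ((\<lambda>(p, s). p(\<phi> := s)) ` (SIGMA p:pat F ` S. B p))"
    using \<open>pat (insert \<phi> F) ` S \<subseteq> _\<close> finS by (intro card_mono) auto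
  also have "\<dots> \<le> card (SIGMA p:pat F ` S. B p)" by (rule card_image_le[OF finS])
  also have "\<dots> = (\<Sum>p\<in>pat F ` S. card (B p))" using fin finB by (intro card_SigmaI) auto
  also have "\<dots> \<le> (\<Sum>p\<in>pat F ` S. 1 + 2 * (if p \<in> ?Z then 1 else 0))"
    by (intro sum_mono) (auto simp: B_def card_insert_if)
  also have "\<dots> = card (pat F ` S) + 2 * (\<Sum>p\<in>pat F ` S. if p \<in> ?Z then 1 else 0)"
    unfolding sum.distrib sum_distrib_left[symmetric] by simp
  also have "(\<Sum>p\<in>pat F ` S. if p \<in> ?Z then 1 else (0::nat)) = card ?Z"
    using fin ZF by (simp add: sum.If_cases Int_absorb1)
  finally show "card (pat (insert \<phi> F) ` S) \<le> card (pat F ` S) + 2 * card ?Z" by simp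
qed

text \<open>The hypothesis \<open>line\<close> expresses that \<open>S\<close> is at most
  one-dimensional. A new function either vanishes on \<open>S\<close> or has at most one zero there,
  and then adds at most two patterns.\<close>

lemma card_pat_line:
  assumes "finite F" and F: "\<forall>\<psi>\<in>F. aff \<psi>" and S: "convex S"
    and line: "\<forall>\<psi> x y z. aff \<psi> \<longrightarrow> x \<in> S \<longrightarrow> y \<in> S \<longrightarrow> x \<noteq> y \<longrightarrow> \<psi> x = 0 \<longrightarrow> \<psi> y = 0 \<longrightarrow> z \<in> S \<longrightarrow> \<psi> z = 0"
  shows "finite (pat F ` S) \<and> card (pat F ` S) \<le> 2 * card F + 1"
  using assms(1) F
proof (induction rule: finite_induct)
  case empty
  have "pat {} ` S \<subseteq> {\<lambda>_. 0}" by (auto simp: pat_def)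
  then show ?case using card_mono[of "{\<lambda>_::'a \<Rightarrow> real. 0::real}" "pat {} ` S"] finite_subset[of "pat {} ` S"] by auto
next
  case (insert \<phi> F)
  then have IH: "finite (pat F ` S)" "card (pat F ` S) \<le> 2 * card F + 1" and a: "aff \<phi>" "\<And>\<psi>. \<psi> \<in> F \<Longrightarrow> aff \<psi>" by auto
  show ?case
  proof (cases "\<forall>z\<in>S. \<phi> z = 0")
    case True
    then show ?thesis using card_pat_insert_const[OF IH(1), of \<phi>] IH insert.hyps by simp
  next
    case False
    have "card (pat F ` (S \<inter> {x. \<phi> x = 0})) \<le> 1"
    proof (cases "S \<inter> {x. \<phi> x = 0} = {}")
      case False
      then obtain x where x: "x \<in> S" "\<phi> x = 0" by blast
      have "y = x" if "y \<in> S" "\<phi> y = 0" for y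
      proof (rule ccontr)
        assume "y \<noteq> x"
        then have "\<forall>z\<in>S. \<phi> z = 0" using line[rule_format, OF a(1) that(1) x(1) _ that(2) x(2)] by blast
        then show False using \<open>\<not> (\<forall>z\<in>S. \<phi> z = 0)\<close> by blast
      qed
      then have "S \<inter> {x. \<phi> x = 0} = {x}" using x by blast
      then show ?thesis by simp
    qed simp
    then show ?thesis using card_pat_insert[OF IH(1) S a(2,1)] IH(2) insert.hyps by auto
  qed
qed

lemma aff_plane:
  fixes \<phi> :: "real^2 \<Rightarrow> real"
  assumes "aff \<phi>" obtains \<alpha> \<beta> where "\<And>x. \<phi> x = \<alpha> \<bullet> x + \<beta>"
proof -
  have a: "\<phi> ((1 - u) *\<^sub>R x + u *\<^sub>R y) = (1 - u) * \<phi> x + u * \<phi> y" for u x y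
    using assms by (simp add: aff_def)
  let ?e = "vector [1, 0] :: real^2" and ?f = "vector [0, 1] :: real^2"
  have sc: "\<phi> (u *\<^sub>R y) = (1 - u) * \<phi> 0 + u * \<phi> y" for u y using a[of u 0 y] by simp
  have "\<phi> x = vector [\<phi> ?e - \<phi> 0, \<phi> ?f - \<phi> 0] \<bullet> x + \<phi> 0" for x
  proof -
    \<comment> \<open>Only mixtures of two points may be used, so \<open>x\<close> is written as the
      midpoint of doubled multiples of the basis vectors.\<close>
    have "x = (1 - 1 / 2) *\<^sub>R ((2 * x $ 1) *\<^sub>R ?e) + (1 / 2) *\<^sub>R ((2 * x $ 2) *\<^sub>R ?f)"
      by (simp add: vec2_eq_iff)
    then have "\<phi> x = \<phi> ((1 - 1 / 2) *\<^sub>R ((2 * x $ 1) *\<^sub>R ?e) + (1 / 2) *\<^sub>R ((2 * x $ 2) *\<^sub>R ?f))" by simp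
    also have "\<dots> = (1 / 2) * ((1 - 2 * x $ 1) * \<phi> 0 + (2 * x $ 1) * \<phi> ?e) + (1 / 2) * ((1 - 2 * x $ 2) * \<phi> 0 + (2 * x $ 2) * \<phi> ?f)"
      unfolding a sc by simp
    also have "\<dots> = vector [\<phi> ?e - \<phi> 0, \<phi> ?f - \<phi> 0] \<bullet> x + \<phi> 0" by (simp add: inner_2 algebra_simps)
    finally show ?thesis .
  qed
  then show ?thesis using that by blast
qed

text \<open>The zero set of a nonconstant affine function is a line, so it satisfies the hypothesis
  \<open>line\<close> of \<open>card_pat_line\<close>.\<close>

lemma zero_line:
  fixes \<phi> \<psi> :: "real^2 \<Rightarrow> real"
  assumes \<phi>: "aff \<phi>" "\<phi> w \<noteq> 0" and \<psi>: "aff \<psi>"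
    and xy: "\<phi> x = 0" "\<phi> y = 0" "x \<noteq> y" "\<psi> x = 0" "\<psi> y = 0" and z: "\<phi> z = 0"
  shows "\<psi> z = 0"
proof -
  obtain \<alpha> \<beta> where a: "\<And>x. \<phi> x = \<alpha> \<bullet> x + \<beta>" by (rule aff_plane[OF \<phi>(1)]) blast
  have "\<alpha> \<noteq> 0" using a[of x] a[of w] \<phi>(2) xy(1) by auto
  define d where "d = y - x"
  have d: "d \<noteq> 0" "\<alpha> \<bullet> d = 0" using a[of x] a[of y] xy by (auto simp: d_def inner_diff_right)
  have zx: "\<alpha> \<bullet> (z - x) = 0" using a[of x] a[of z] xy z by (simp add: inner_diff_right)
  have "(d \<bullet> d) *\<^sub>R \<alpha> = (\<alpha> \<bullet> perp d) *\<^sub>R perp d" using perp_decomp[of d \<alpha>] d by simp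
  then have "(\<alpha> \<bullet> perp d) * (perp d \<bullet> (z - x)) = 0" using zx by (metis inner_scaleR_left mult_zero_right)
  moreover have "\<alpha> \<bullet> perp d \<noteq> 0"
    using \<open>(d \<bullet> d) *\<^sub>R \<alpha> = _\<close> \<open>\<alpha> \<noteq> 0\<close> d by auto
  ultimately have "(z - x) \<bullet> perp d = 0" by (simp add: inner_commute)
  then have "z - x = ((z - x) \<bullet> d / (d \<bullet> d)) *\<^sub>R d" by (rule parallel_of_inner_perp_0[OF d(1)])
  then obtain s where "z - x = s *\<^sub>R d" by blast
  then have "z = (1 - s) *\<^sub>R x + s *\<^sub>R y" by (simp add: d_def algebra_simps)
  then show ?thesis using \<psi> xy by (simp add: aff_def)
qed

text \<open>On the zero line of the new function, \<open>k\<close> earlier functions have at most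
  \<open>2 * k + 1\<close> patterns, so at most \<open>2 * (2 * k + 1)\<close> patterns are added;
  this is exactly the growth of \<open>2 * k^2 + 1\<close>.\<close>

lemma card_pat_plane:
  fixes F :: "(real^2 \<Rightarrow> real) set"
  assumes "finite F" "\<forall>\<psi>\<in>F. aff \<psi>"
  shows "finite (range (pat F)) \<and> card (range (pat F)) \<le> 2 * (card F)\<^sup>2 + 1"
  using assms
proof (induction rule: finite_induct)
  case empty
  have "range (pat {}) \<subseteq> {\<lambda>_::real^2 \<Rightarrow> real. 0::real}" by (auto simp: pat_def)
  then show ?case using card_mono[of "{\<lambda>_::real^2 \<Rightarrow> real. 0::real}" "range (pat {})"] finite_subset[of "range (pat {})"] by auto
next
  case (insert \<phi> F)
  then have IH: "finite (range (pat F))" "card (range (pat F)) \<le> 2 * (card F)\<^sup>2 + 1"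
    and a: "aff \<phi>" "\<And>\<psi>. \<psi> \<in> F \<Longrightarrow> aff \<psi>" by auto
  show ?case
  proof (cases "\<forall>z. \<phi> z = 0")
    case True
    then show ?thesis using card_pat_insert_const[OF IH(1), of \<phi>] IH insert.hyps by (auto simp: power2_eq_square)
  next
    case False
    then obtain w where w: "\<phi> w \<noteq> 0" by blast
    let ?S = "UNIV \<inter> {x. \<phi> x = 0}"
    have "convex ?S"
      unfolding convex_alt
    proof (intro ballI allI impI)
      fix x y and u :: real assume "x \<in> ?S" "y \<in> ?S"
      moreover have "\<phi> ((1 - u) *\<^sub>R x + u *\<^sub>R y) = (1 - u) * \<phi> x + u * \<phi> y"
        using a(1) unfolding aff_def by blast
      ultimately show "(1 - u) *\<^sub>R x + u *\<^sub>R y \<in> ?S" by simp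
    qed
    moreover have "\<forall>\<psi> x y z. aff \<psi> \<longrightarrow> x \<in> ?S \<longrightarrow> y \<in> ?S \<longrightarrow> x \<noteq> y \<longrightarrow> \<psi> x = 0 \<longrightarrow> \<psi> y = 0 \<longrightarrow> z \<in> ?S \<longrightarrow> \<psi> z = 0"
    proof (intro allI impI)
      fix \<psi> x y z assume "aff \<psi>" "x \<in> ?S" "y \<in> ?S" "x \<noteq> y" "\<psi> x = 0" "\<psi> y = 0" "z \<in> ?S"
      then show "\<psi> z = 0" by - (rule zero_line[OF a(1) w, of \<psi> x y], simp_all)
    qed
    moreover have "\<forall>\<psi>\<in>F. aff \<psi>" using a(2) by blast
    ultimately have "card (pat F ` ?S) \<le> 2 * card F + 1"
      by (intro conjunct2[OF card_pat_line[OF insert.hyps(1)]])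
    moreover have "finite (range (pat (insert \<phi> F))) \<and> card (range (pat (insert \<phi> F))) \<le> card (range (pat F)) + 2 * card (pat F ` ?S)"
      using card_pat_insert[OF IH(1) convex_UNIV a(2,1)] by blast
    ultimately show ?thesis using IH(2) insert.hyps by (auto simp: power2_eq_square)
  qed
qed

subsection \<open>The upper bound\<close>

context prism_table
begin

text \<open>The functions \<open>edge_form v (j, k)\<close> vanish on the plane spanned by the direction \<open>v\<close> and
  an edge: the vertical edge over the vertex \<open>j\<close> for \<open>k = 0\<close>, and the edge along the side \<open>j\<close>
  in the bottom or the top for \<open>k = 1\<close> or \<open>k = 2\<close>.\<close>

definition edge_form :: "space \<Rightarrow> nat \<times> nat \<Rightarrow> space \<Rightarrow> real" where
  "edge_form v i p = (if snd i = 0 then (fst p - vs ! fst i) \<bullet> perp (fst v)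
     else ht (fst i) (fst p) * snd v - (snd p - (if snd i = 1 then 0 else h)) * (fst v \<bullet> inn (fst i)))"

lemma edge_form_invariant: "edge_form v i (p + t *\<^sub>R v) = edge_form v i p"
  by (simp add: edge_form_def ht_add algebra_simps inner_add_left inner_diff_left)

lemma aff_edge_form: "aff (edge_form v i)"
  unfolding aff_def edge_form_def ht_def
  by (auto simp: algebra_simps inner_add_left inner_diff_left)

text \<open>Within the plane of the face, the forms belonging to the edges of that face become
  nonzero multiples of the heights above these edges. Equal signs thus place \<open>y\<close> on the
  same side of every edge as \<open>p\<close>.\<close>

lemma hits_face_of_same_signs:
  assumes f: "f \<in> faces vs" "p \<in> face_set vs h f" "p \<notin> edge_set"
    and v: "v \<bullet> finn f < 0" "snd v \<noteq> 0" and y: "fht f y = 0"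
    and sg: "\<And>i. i \<in> {..<nv} \<times> {..<3} \<Longrightarrow> sgn (edge_form v i p) = sgn (edge_form v i y)"
  shows "y \<in> face_set vs h f"
proof -
  obtain y1 y2 where yy: "y = (y1, y2)" by (cases y)
  obtain \<eta> e where vv: "v = (\<eta>, e)" by (cases v)
  have core: "y1 \<in> core" if x: "x \<in> core" and s: "\<And>j. j < nv \<Longrightarrow> sgn (ht j x * e) = sgn (ht j y1 * e)" for x
  proof -
    have "0 < ht j y1" if j: "j < nv" for j
    proof -
      have "0 < ht j x" using x j core_iff by blast
      then show ?thesis using sgn_mult_cancel(2)[OF s[OF j]] v(2) vv by simp
    qed
    then show ?thesis using core_iff by blast
  qed
  show ?thesis
    using face_rel_cases[OF f]
  proof cases
    case (1 i x z)
    let ?j = "Suc i mod nv"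
    define d where "d = next_vertex vs i - vs ! i"
    define D where "D = d \<bullet> perp \<eta>"
    define N where "N = \<eta> \<bullet> inn i"
    have N: "N < 0" using v 1 vv by (simp add: N_def)
    have nx: "next_vertex vs i = vs ! ?j" by (simp add: next_vertex_def)
    obtain a where "inn i = a *\<^sub>R side_normal vs i" by (rule inn_cases[OF 1(1)])
    then have "N = a * (\<eta> \<bullet> perp d)" by (simp add: N_def d_def side_normal_eq)
    moreover have "\<eta> \<bullet> perp d = - D" by (simp add: D_def inner_2)
    ultimately have D: "D \<noteq> 0" using N by auto
    obtain u where u: "0 \<le> u" "u \<le> 1" "x = (1 - u) *\<^sub>R vs ! i + u *\<^sub>R next_vertex vs i"
      using 1(4) by (auto simp: side_def in_segment)
    have "u \<noteq> 0" using u(3) 1 by auto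
    moreover have "u \<noteq> 1" using u(3) 1 next_in by auto
    ultimately have u': "0 < u" "u < 1" using u by auto
    have xu: "x - vs ! i = u *\<^sub>R d" "x - next_vertex vs i = (u - 1) *\<^sub>R d" unfolding u(3) d_def by (simp_all add: algebra_simps)
    have h0: "ht i y1 = 0" using y 1 yy by simp
    then have "(y1 - vs ! i) \<bullet> perp d = 0"
      using ht_zero_iff[OF 1(1)] by (simp add: side_form_def side_normal_eq d_def)
    then have "y1 - vs ! i = ((y1 - vs ! i) \<bullet> d / (d \<bullet> d)) *\<^sub>R d"
      using next_neq[OF 1(1)] by (intro parallel_of_inner_perp_0) (simp_all add: d_def)
    then obtain r where r: "y1 - vs ! i = r *\<^sub>R d" by blast
    have r1: "y1 - next_vertex vs i = (r - 1) *\<^sub>R d" using r by (simp add: d_def algebra_simps)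
    \<comment> \<open>For a lateral face the forms of kind 0 at the two end vertices give
      \<open>0 < r\<close> and \<open>r < 1\<close>; kinds 1 and 2 then bound the height from below
      and above.\<close>
    have "sgn (u * D) = sgn (r * D)"
      using sg[of "(i, 0)"] 1 yy vv xu r by (simp add: edge_form_def D_def)
    then have r0: "0 < r" using sgn_mult_cancel(2)[OF _ D] u' by blast
    have "sgn ((u - 1) * D) = sgn ((r - 1) * D)"
      using sg[of "(?j, 0)"] 1 yy vv xu r1 by (simp add: edge_form_def D_def nx)
    then have "u - 1 < 0 \<longleftrightarrow> r - 1 < 0" by (rule sgn_mult_cancel(1)[OF _ D])
    then have r2: "r < 1" using u' by simp
    have hx: "ht i x = 0" using 1 by simp
    have "sgn (z * N) = sgn (y2 * N)"
      using sg[of "(i, 1)"] 1 yy vv hx h0 by (simp add: edge_form_def N_def sgn_minus)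
    then have y20: "0 < y2" using sgn_mult_cancel(2)[of z N y2] 1 N by simp
    have "sgn ((z - h) * N) = sgn ((y2 - h) * N)"
      using sg[of "(i, 2)"] 1 yy vv hx h0 by (simp add: edge_form_def N_def sgn_minus)
    then have y2h: "y2 < h" using sgn_mult_cancel(1)[of "z - h" N "y2 - h"] 1 N by simp
    have "y1 = (1 - r) *\<^sub>R vs ! i + r *\<^sub>R next_vertex vs i" using r by (simp add: d_def algebra_simps)
    then have "y1 \<in> side vs i" unfolding side_def closed_segment_def using r0 r2 by (auto intro!: exI[of _ r])
    then show ?thesis using 1 yy y20 y2h by simp
  next
    case (2 x)
    have y2: "y2 = 0" using y 2 yy by simp
    have "y1 \<in> core"
      using sg[of "(_, 1)"] 2 yy vv y2 by (intro core[of x]) (auto simp: edge_form_def)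
    then show ?thesis using 2 yy y2 core_subset_region by auto
  next
    case (3 x)
    have y2: "y2 = h" using y 3 yy by simp
    have "y1 \<in> core"
      using sg[of "(_, 2)"] 3 yy vv y2 by (intro core[of x]) (auto simp: edge_form_def)
    then show ?thesis using 3 yy y2 core_subset_region by auto
  qed
qed

text \<open>The line of \<open>y\<close> is followed to the plane of the face that \<open>x\<close>
  hits. It arrives within that face, hence in the prism, and convexity leaves no other exit time:
  reaching either point first would put it into the interior.\<close>

lemma same_next_face:
  assumes x: "billiard_orbit vs h x" "norm (snd (x 0)) = 1" and y: "billiard_orbit vs h y" "norm (snd (y 0)) = 1"
    and v: "snd (x k) = v" "snd (y l) = v" "snd v \<noteq> 0"
    and sg: "\<And>i. i \<in> {..<nv} \<times> {..<3} \<Longrightarrow> sgn (edge_form v i (fst (x k))) = sgn (edge_form v i (fst (y l)))"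
  shows "face_at x (k + 1) = face_at y (l + 1)"
proof -
  define f where "f = face_at x (k + 1)"
  have f: "f \<in> faces vs" "fst (x (k + 1)) \<in> face_set vs h f" using face_at[OF x(1)] by (auto simp: f_def)
  note sx = step_time[OF x(1), of k] and sy = step_time[OF y(1), of l]
  define m where "m = fst (y l)"
  have vnz: "v \<noteq> 0" using v(3) by auto
  have half: "fst (z j) + (step_time z j / 2) *\<^sub>R snd (z j) \<in> interior P"
    if z: "billiard_orbit vs h z" "snd (z j) = v" for z j
  proof -
    note sz = step_time[OF z(1), of j]
    have "fst (z j) + (step_time z j / 2) *\<^sub>R snd (z j) = (1 - 1 / 2) *\<^sub>R fst (z j) + (1 / 2) *\<^sub>R fst (z (j + 1))"
      unfolding sz(2) by (simp add: algebra_simps flip: scaleR_add_left)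
    moreover have "fst (z j) \<noteq> fst (z (j + 1))" using sz(1,2) z(2) vnz by auto
    ultimately have "fst (z j) + (step_time z j / 2) *\<^sub>R snd (z j) \<in> open_segment (fst (z j)) (fst (z (j + 1)))"
      unfolding in_segment(2) by (intro conjI exI[of _ "1 / 2"]) auto
    then show ?thesis using sz(3) by blast
  qed
  define q where "q = v \<bullet> finn f"
  have q: "q < 0"
  proof -
    have "fht f (fst (x k)) + step_time x k * q = 0"
      using fht_face[OF f] unfolding sx(2) v(1) fht_add q_def .
    moreover have "0 < fht f (fst (x k)) + (step_time x k / 2) * q"
      using interior_fht[OF f(1) half[OF x(1) v(1)]] unfolding v(1) fht_add q_def .
    ultimately have "step_time x k * q < 0" by (simp add: algebra_simps)
    then show ?thesis using sx(1) by (simp add: mult_less_0_iff)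
  qed
  \<comment> \<open>The time at which the line from \<open>m\<close> reaches the plane of
    \<open>f\<close>, approached with speed \<open>- q\<close>.\<close>
  define t where "t = fht f m / (- q)"
  define p where "p = m + t *\<^sub>R v"
  have pz: "fht f p = 0" unfolding p_def fht_add q_def[symmetric] t_def using q by simp
  have pf: "p \<in> face_set vs h f"
  proof (rule hits_face_of_same_signs[OF f not_edge_at[OF x(1)] q[unfolded q_def] v(3) pz])
    fix i assume i: "i \<in> {..<nv} \<times> {..<(3::nat)}"
    show "sgn (edge_form v i (fst (x (k + 1)))) = sgn (edge_form v i p)"
      unfolding sx(2) v(1) p_def edge_form_invariant m_def by (rule sg[OF i])
  qed
  have pP: "p \<in> P" using pf face_subset_P[OF f(1)] by blast
  define r where "r = step_time y l"
  have r: "0 < r" using sy(1) by (simp add: r_def)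
  have hm: "m + (r / 2) *\<^sub>R v \<in> interior P" using half[OF y(1) v(2)] v(2) by (simp add: m_def r_def)
  have "0 < fht f m + (r / 2) * q" using interior_fht[OF f(1) hm] unfolding fht_add q_def .
  then have "(r / 2) * (- q) < fht f m" by simp
  then have tr: "r / 2 < t"
    unfolding t_def using pos_less_divide_eq[of "- q" "r / 2" "fht f m"] q by (simp only: neg_0_less_iff_less)
  have y1: "fst (y (l + 1)) = m + r *\<^sub>R v" using sy(2) v(2) by (simp add: m_def r_def)
  have "t = r"
  proof (rule ccontr)
    assume "t \<noteq> r"
    then consider "t < r" | "r < t" by linarith
    then show False
    proof cases
      case 1
      have "p = (1 - t / r) *\<^sub>R m + (t / r) *\<^sub>R (m + r *\<^sub>R v)" using r by (simp add: p_def algebra_simps)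
      moreover have "m \<noteq> m + r *\<^sub>R v" using r vnz by simp
      moreover have "0 < t / r" "t / r < 1" using 1 r tr by auto
      ultimately have "p \<in> open_segment m (m + r *\<^sub>R v)" unfolding in_segment(2) by blast
      then have "p \<in> interior P" using sy(3) y1 by (auto simp: m_def)
      from interior_fht[OF f(1) this] pz show False by simp
    next
      case 2
      define u where "u = (t - r) / (t - r / 2)"
      have u: "0 < u" "u \<le> 1" using 2 r by (auto simp: u_def)
      have "u * (t - r / 2) = t - r" using 2 r by (simp add: u_def)
      then have "r = t - u * (t - r / 2)" by simp
      then have "m + r *\<^sub>R v = p - u *\<^sub>R (p - (m + (r / 2) *\<^sub>R v))"
        by (simp add: p_def algebra_simps flip: scaleR_diff_left scaleR_add_left)
      moreover have "p - u *\<^sub>R (p - (m + (r / 2) *\<^sub>R v)) \<in> interior P"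
        by (rule mem_interior_closure_convex_shrink[OF convex_P hm _ u]) (use pP closure_subset in blast)
      ultimately have "fst (y (l + 1)) \<in> interior P" using y1 by simp
      from interior_fht[OF face_at(1)[OF y(1), of "l + 1"] this] fht_face[OF face_at[OF y(1), of "l + 1"]]
      show False by simp
    qed
  qed
  then have "fst (y (l + 1)) \<in> face_set vs h f" using pf y1 by (simp add: p_def)
  then have "face_at y (l + 1) = f" by (rule face_at_eq[OF y(1) f(1)])
  then show ?thesis by (simp add: f_def)
qed

text \<open>An edge form of the copy \<open>g P\<close>, read off at a point of the plane at height
  0. Its zero set is the line carrying the projection of that edge along \<open>v\<close>.\<close>

definition tile_form :: "space \<Rightarrow> (space \<Rightarrow> space) \<Rightarrow> nat \<times> nat \<Rightarrow> real^2 \<Rightarrow> real" where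
  "tile_form v g i q = edge_form (lin_part (inv g) v) i (inv g (q, 0))"

lemma SU_inv:
  assumes "g \<in> SU" shows "inv g \<in> SU" "\<And>p. inv g (g p) = p"
proof -
  have i: "inj g" by (rule rigid_inj[OF SU_rigid[OF assms]])
  then show "\<And>p. inv g (g p) = p" by simp
  obtain g' where g': "g' \<in> SU" "g \<circ> g' = id" "g' \<circ> g = id" by (rule SU_inverse[OF assms])
  have "inv g = g'" by (rule inv_unique_comp[OF g'(2,3)])
  then show "inv g \<in> SU" using g' by simp
qed

lemma aff_tile_form: assumes "g \<in> SU" shows "aff (tile_form v g i)"
proof -
  have "inv g ((1 - u) *\<^sub>R x + u *\<^sub>R y, 0) = (1 - u) *\<^sub>R inv g (x, 0) + u *\<^sub>R inv g (y, 0)" for u x y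
    using rigid_combo[OF SU_rigid[OF SU_inv(1)[OF assms]], of u "(x, 0)" "(y, 0)"] by simp
  moreover have "edge_form w i ((1 - u) *\<^sub>R p + u *\<^sub>R q) = (1 - u) * edge_form w i p + u * edge_form w i q" for w p q u
    using aff_edge_form[of w i] unfolding aff_def by blast
  ultimately show ?thesis unfolding aff_def tile_form_def by (simp only: simp_thms)
qed

text \<open>Where the line of a state crosses the plane at height 0, provided that the direction is
  not horizontal. It reduces the three-dimensional starting position to two coordinates.\<close>

definition foot :: "state \<Rightarrow> real^2" where
  "foot s = fst (fst s) - (snd (fst s) / snd (snd s)) *\<^sub>R fst (snd s)"

text \<open>Edge forms are constant along the trajectory, so their values at a later hit can be
  moved back to the foot of the initial state.\<close>

lemma tile_form_orbit:
  assumes x: "billiard_orbit vs h x" "norm (snd (x 0)) = 1" and v: "snd (x k) = v" "snd v \<noteq> 0"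
  shows "lin_part (inv (unf x k j)) v = snd (x (k + int j))"
    "edge_form (snd (x (k + int j))) i (fst (x (k + int j))) = tile_form v (unf x k j) i (foot (x k))"
proof -
  let ?g = "unf x k j"
  have g: "?g \<in> SU" by (rule unf_SU[OF x])
  have r: "rigid (inv ?g)" "rigid ?g" using SU_rigid SU_inv(1)[OF g] g by auto
  have li: "lin_part (inv ?g) (lin_part ?g u) = u" for u
  proof -
    have e: "inv ?g \<circ> ?g = id" using SU_inv(2)[OF g] by (simp add: fun_eq_iff)
    have "lin_part (inv ?g) (lin_part ?g u) = lin_part (inv ?g \<circ> ?g) u"
      unfolding lin_part_comp[OF r(1)] comp_apply ..
    then show ?thesis unfolding e lin_part_id id_apply .
  qed
  show l: "lin_part (inv ?g) v = snd (x (k + int j))"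
    using li[of "snd (x (k + int j))"] unf_point(2)[OF x, of k j] v(1) by simp
  have "fst (x (k + int j)) = inv ?g (fst (x k) + hit x k j *\<^sub>R v)"
    using SU_inv(2)[OF g, of "fst (x (k + int j))"] unf_point(1)[OF x, of k j] v(1) by simp
  also have "fst (x k) = (foot (x k), 0) + (snd (fst (x k)) / snd v) *\<^sub>R v"
    using v by (cases "fst (x k)"; cases v) (auto simp: foot_def)
  also have "\<dots> + hit x k j *\<^sub>R v = (foot (x k), 0) + (snd (fst (x k)) / snd v + hit x k j) *\<^sub>R v"
    by (simp add: algebra_simps)
  also have "inv ?g \<dots> = inv ?g (foot (x k), 0) + (snd (fst (x k)) / snd v + hit x k j) *\<^sub>R snd (x (k + int j))"
    unfolding lin_part_add[OF r(1)] l ..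
  finally have "fst (x (k + int j)) = inv ?g (foot (x k), 0) + (snd (fst (x k)) / snd v + hit x k j) *\<^sub>R snd (x (k + int j))" .
  then show "edge_form (snd (x (k + int j))) i (fst (x (k + int j))) = tile_form v ?g i (foot (x k))"
    unfolding tile_form_def l by (simp only: edge_form_invariant)
qed

definition tube_forms :: "space \<Rightarrow> nat \<Rightarrow> (real^2 \<Rightarrow> real) set" where
  "tube_forms v n = (\<lambda>(g, i). tile_form v g i) ` (tube v n \<times> ({..<nv} \<times> {..<3}))"

lemma tube_forms: "finite (tube_forms v n)" "\<forall>\<psi>\<in>tube_forms v n. aff \<psi>"
  "card (tube_forms v n) \<le> 3 * nv * card (tube v n)"
proof -
  have fin: "finite (tube v n \<times> ({..<nv} \<times> {..<(3::nat)}))" using finite_tube by auto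
  then show "finite (tube_forms v n)" unfolding tube_forms_def by simp
  show "\<forall>\<psi>\<in>tube_forms v n. aff \<psi>" unfolding tube_forms_def by (auto simp: tube_def intro: aff_tile_form)
  have "card (tube_forms v n) \<le> card (tube v n \<times> ({..<nv} \<times> {..<(3::nat)}))"
    unfolding tube_forms_def by (rule card_image_le[OF fin])
  then show "card (tube_forms v n) \<le> 3 * nv * card (tube v n)"
    by (simp add: card_cartesian_product algebra_simps)
qed

text \<open>Agreement of all earlier faces makes the two unfoldings equal, so both orbits are in the
  same copy with the same direction; the pattern then settles the next face. Strong induction is
  needed as the unfolding depends on the whole past.\<close>

lemma same_word_of_pattern:
  assumes x: "billiard_orbit vs h x" "norm (snd (x 0)) = 1" and y: "billiard_orbit vs h y" "norm (snd (y 0)) = 1"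
    and v: "snd (x k) = v" "snd (y l) = v" "snd v \<noteq> 0"
    and first: "face_at x k = face_at y l"
    and pat: "pat (tube_forms v n) (foot (x k)) = pat (tube_forms v n) (foot (y l))"
    and i: "i \<le> n"
  shows "face_at x (k + int i) = face_at y (l + int i)"
  using i
proof (induction i rule: less_induct)
  case (less i)
  show ?case
  proof (cases i)
    case 0 then show ?thesis using first by simp
  next
    case (Suc j)
    let ?g = "unf x k j"
    have g: "?g = unf y l j"
    proof (rule unf_cong[of j])
      fix i' assume "i' < j"
      then show "face_at x (k + int i' + 1) = face_at y (l + int i' + 1)"
        using less.IH[of "Suc i'"] less.prems Suc by (simp add: algebra_simps)
    qed simp
    have "hit x k j \<le> real j * pdiam" by (rule hit_le[OF x])
    also have "\<dots> \<le> real n * pdiam" using less.prems Suc pdiam_pos by (intro mult_right_mono) auto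
    finally have gt: "?g \<in> tube v n" using unf_tube[OF x, of k j n] v by simp
    have dir: "snd (x (k + int j)) = snd (y (l + int j))"
      using tile_form_orbit(1)[OF x v(1,3), of j] tile_form_orbit(1)[OF y v(2,3), of j] g by simp
    have "snd (snd (x (k + int j))) \<noteq> 0"
    proof -
      obtain \<gamma> s r where \<gamma>: "s = 1 \<or> s = -1" "inv ?g = prod_map \<gamma> s r"
        by (rule SU_cases[OF SU_inv(1)[OF unf_SU[OF x]]])
      have "snd (lin_part (inv ?g) v) = of_int s * snd v"
        unfolding \<gamma>(2) by (cases v) (simp add: lin_part_prod_map)
      then show ?thesis using tile_form_orbit(1)[OF x v(1,3), of j] v(3) \<gamma>(1) by auto
    qed
    moreover have "sgn (edge_form (snd (x (k + int j))) e (fst (x (k + int j)))) =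
      sgn (edge_form (snd (x (k + int j))) e (fst (y (l + int j))))" if e: "e \<in> {..<nv} \<times> {..<3}" for e
    proof -
      have "tile_form v ?g e \<in> tube_forms v n" unfolding tube_forms_def using gt e by (auto intro!: rev_image_eqI)
      then show ?thesis
        using pat tile_form_orbit(2)[OF x v(1,3), of j e] tile_form_orbit(2)[OF y v(2,3), of j e] g dir
        unfolding pat_eq_iff by metis
    qed
    ultimately have "face_at x (k + int j + 1) = face_at y (l + int j + 1)"
      using dir by (intro same_next_face[OF x y refl]) auto
    then show ?thesis using Suc by (simp add: algebra_simps)
  qed
qed

text \<open>Direction and first face are fixed, because patterns only determine each face from its
  predecessors.\<close>

definition words_from :: "nat \<Rightarrow> space \<Rightarrow> face \<Rightarrow> face list set" where
  "words_from n v f = {map (\<lambda>i. face_at x (k + int i)) [0..<n] | x k.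
     billiard_orbit vs h x \<and> norm (snd (x 0)) = 1 \<and> snd (x k) = v \<and> face_at x k = f}"

lemma card_words_from:
  assumes v: "snd v \<noteq> 0"
  shows "finite (words_from n v f)" "card (words_from n v f) \<le> 2 * (card (tube_forms v n))\<^sup>2 + 1"
proof -
  define R where "R w = (\<lambda>(x, k). w = map (\<lambda>i. face_at x (k + int i)) [0..<n] \<and>
     billiard_orbit vs h x \<and> norm (snd (x 0)) = 1 \<and> snd (x k) = v \<and> face_at x k = f)" for w
  define s where "s w = (SOME xk. R w xk)" for w
  have s: "R w (s w)" if "w \<in> words_from n v f" for w
  proof -
    have "\<exists>xk. R w xk" using that unfolding words_from_def R_def by auto
    then show ?thesis unfolding s_def by (rule someI_ex)
  qed
  define \<Phi> where "\<Phi> w = pat (tube_forms v n) (foot (fst (s w) (snd (s w))))" for w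
  have inj: "inj_on \<Phi> (words_from n v f)"
  proof (rule inj_onI)
    fix w w' assume w: "w \<in> words_from n v f" "w' \<in> words_from n v f" "\<Phi> w = \<Phi> w'"
    obtain x k where x: "s w = (x, k)" by (cases "s w")
    obtain y l where y: "s w' = (y, l)" by (cases "s w'")
    have rx: "w = map (\<lambda>i. face_at x (k + int i)) [0..<n]" "billiard_orbit vs h x" "norm (snd (x 0)) = 1" "snd (x k) = v" "face_at x k = f"
      using s[OF w(1)] unfolding x R_def by auto
    have ry: "w' = map (\<lambda>i. face_at y (l + int i)) [0..<n]" "billiard_orbit vs h y" "norm (snd (y 0)) = 1" "snd (y l) = v" "face_at y l = f"
      using s[OF w(2)] unfolding y R_def by auto
    have "face_at x (k + int i) = face_at y (l + int i)" if "i < n" for i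
      using same_word_of_pattern[OF rx(2,3) ry(2,3) rx(4) ry(4) v, of n i] rx(5) ry(5) w(3) that
      by (simp add: \<Phi>_def x y)
    then show "w = w'" unfolding rx(1) ry(1) by simp
  qed
  have sub: "\<Phi> ` words_from n v f \<subseteq> range (pat (tube_forms v n))" by (auto simp: \<Phi>_def)
  have r: "finite (range (pat (tube_forms v n)))" "card (range (pat (tube_forms v n))) \<le> 2 * (card (tube_forms v n))\<^sup>2 + 1"
    using card_pat_plane[OF tube_forms(1,2)] by auto
  show "finite (words_from n v f)" using inj sub r(1) by (meson finite_imageD finite_subset)
  show "card (words_from n v f) \<le> 2 * (card (tube_forms v n))\<^sup>2 + 1"
    using card_inj_on_le[OF inj sub r(1)] r(2) by linarith
qed

end

context irrational_direction
begin

text \<open>A finite set closed under the face reflections. Words may start at any time of an orbit,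
  so every direction along the orbit can be an initial one.\<close>

definition directions :: "space set" where
  "directions = (\<lambda>(A, s). (A \<theta>, s * c)) ` (lin_part ` PU \<times> {1, -1})"

lemma directions_reflect:
  assumes "f \<in> faces vs" "v \<in> directions" shows "reflect (face_normal vs f) v \<in> directions"
proof -
  obtain \<gamma> s where v: "\<gamma> \<in> PU" "s = 1 \<or> s = (-1::real)" "v = (lin_part \<gamma> \<theta>, s * c)"
  proof -
    from assms(2) obtain As where As: "As \<in> lin_part ` PU \<times> {1, -1::real}" "v = (\<lambda>(A, s). (A \<theta>, s * c)) As"
      unfolding directions_def by (elim imageE)
    obtain A s where "As = (A, s)" by (cases As)
    with As that show ?thesis by auto
  qed
  have I: "(lin_part \<gamma>' \<theta>, s' * c) \<in> directions" if "\<gamma>' \<in> PU" "s' = 1 \<or> s' = (-1::real)" for \<gamma>' s'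
    unfolding directions_def using that by (intro image_eqI[of _ _ "(lin_part \<gamma>', s')"]) auto
  from assms(1) show ?thesis
  proof (cases rule: faces_cases)
    case (1 i)
    have "reflect (face_normal vs f) v = (reflect (side_normal vs i) (lin_part \<gamma> \<theta>), s * c)"
      by (simp add: 1 v reflect_def)
    also have "reflect (side_normal vs i) (lin_part \<gamma> \<theta>) = lin_part (rf i \<circ> \<gamma>) \<theta>"
      by (simp add: lin_part_comp[OF rigid_reflect_at])
    finally show ?thesis using I[OF PU_comp[OF PU_rf[OF 1(1)] v(1)] v(2)] by simp
  next
    case 2
    have "reflect (face_normal vs f) v = (lin_part \<gamma> \<theta>, (- s) * c)" by (simp add: 2 v reflect_def)
    moreover have "(lin_part \<gamma> \<theta>, (- s) * c) \<in> directions" using v by (intro I) auto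
    ultimately show ?thesis by simp
  next
    case 3
    have "reflect (face_normal vs f) v = (lin_part \<gamma> \<theta>, (- s) * c)" by (simp add: 3 v reflect_def)
    moreover have "(lin_part \<gamma> \<theta>, (- s) * c) \<in> directions" using v by (intro I) auto
    ultimately show ?thesis by simp
  qed
qed

lemma orbit_directions:
  assumes x: "billiard_orbit vs h x" "snd (x 0) = (\<theta>, c)" shows "snd (x k) \<in> directions"
proof (induction k rule: int_induct[of _ 0])
  case base
  have "(\<theta>, c) = (\<lambda>(A, s). (A \<theta>, s * c)) (lin_part id, 1)" unfolding lin_part_id by simp
  moreover have "(lin_part id, 1) \<in> lin_part ` PU \<times> {1, -1::real}" using PU_id by blast
  ultimately show ?case unfolding x(2) directions_def by (rule image_eqI)
next
  case (step1 i)
  then show ?case using direction_Suc[OF x(1), of i] directions_reflect[OF face_at(1)[OF x(1)]] by simp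
next
  case (step2 i)
  have "snd (x (i - 1)) = reflect (face_normal vs (face_at x i)) (snd (x i))"
    using direction_Suc[OF x(1), of "i - 1"] by simp
  then show ?case using directions_reflect[OF face_at(1)[OF x(1)] step2(2)] by simp
qed

lemma finite_directions: "finite directions"
proof -
  have "finite (lin_part ` PU \<times> {1, -1::real})" using finite_lin_part by simp
  then show ?thesis unfolding directions_def by (rule finite_imageI)
qed

lemma upper_bound:
  obtains A where "0 < A" "\<And>n. 0 < n \<Longrightarrow> card (billiard_language vs h n (\<theta>, c)) \<le> A * n\<^sup>2"
proof -
  obtain M where M: "0 < M" "\<And>v J. card (tube v J) \<le> M * (J + 1)" by (rule card_tube) blast
  \<comment> \<open>Each copy contributes \<open>3 * nv\<close> forms, and there are at most
    \<open>M * (n + 1) \<le> 2 * M * n\<close> copies. Below, \<open>Suc A\<close> replaces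
    \<open>A\<close> to make positivity evident.\<close>
  define K where "K = 6 * nv * M"
  define A where "A = card directions * card (faces vs) * (2 * K\<^sup>2 + 1)"
  have "card (billiard_language vs h n (\<theta>, c)) \<le> Suc A * n\<^sup>2" if n: "0 < n" for n
  proof -
    have bound: "card (words_from n v f) \<le> (2 * K\<^sup>2 + 1) * n\<^sup>2" if v: "v \<in> directions" for v f
    proof -
      have "snd v \<noteq> 0" using v c_nz by (auto simp: directions_def)
      then have "card (words_from n v f) \<le> 2 * (card (tube_forms v n))\<^sup>2 + 1" by (rule card_words_from)
      also have "card (tube_forms v n) \<le> K * n"
      proof -
        have "card (tube_forms v n) \<le> 3 * nv * card (tube v n)" by (rule tube_forms)
        also have "\<dots> \<le> 3 * nv * (M * (n + 1))" using M(2) by (intro mult_left_mono) auto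
        also have "\<dots> \<le> 3 * nv * (M * (2 * n))" using n by (intro mult_left_mono) auto
        finally show ?thesis by (simp add: K_def algebra_simps)
      qed
      then have "2 * (card (tube_forms v n))\<^sup>2 + 1 \<le> 2 * (K * n)\<^sup>2 + 1" by (simp add: power_mono)
      also have "\<dots> \<le> (2 * K\<^sup>2 + 1) * n\<^sup>2" using n by (simp add: algebra_simps power_mult_distrib)
      finally show ?thesis .
    qed
    have fin: "finite (words_from n v f)" if v: "v \<in> directions" for v f
    proof (rule card_words_from)
      show "snd v \<noteq> 0" using v c_nz by (auto simp: directions_def)
    qed
    have "billiard_language vs h n (\<theta>, c) \<subseteq> (\<Union>(v, f)\<in>directions \<times> faces vs. words_from n v f)"
    proof
      fix w assume "w \<in> billiard_language vs h n (\<theta>, c)"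
      then obtain x k where x: "w = map (\<lambda>i. face_at x (k + int i)) [0..<n]" "billiard_orbit vs h x" "snd (x 0) = (\<theta>, c)"
        unfolding language_eq by blast
      have "norm (snd (x 0)) = 1" using x unit by simp
      then have "w \<in> words_from n (snd (x k)) (face_at x k)" unfolding words_from_def using x by blast
      then show "w \<in> (\<Union>(v, f)\<in>directions \<times> faces vs. words_from n v f)"
        using orbit_directions[OF x(2,3), of k] face_at(1)[OF x(2), of k] by blast
    qed
    then have "card (billiard_language vs h n (\<theta>, c)) \<le> card (\<Union>(v, f)\<in>directions \<times> faces vs. words_from n v f)"
      using fin finite_directions finite_faces by (intro card_mono) auto
    also have "\<dots> \<le> (\<Sum>(v, f)\<in>directions \<times> faces vs. card (words_from n v f))"
      unfolding case_prod_unfold using finite_directions finite_faces by (intro card_UN_le) auto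
    also have "\<dots> \<le> (\<Sum>(v, f)\<in>directions \<times> faces vs. (2 * K\<^sup>2 + 1) * n\<^sup>2)"
      using bound by (intro sum_mono) auto
    also have "\<dots> = A * n\<^sup>2" by (simp add: card_cartesian_product A_def algebra_simps)
    also have "\<dots> \<le> Suc A * n\<^sup>2" by simp
    finally show ?thesis .
  qed
  then show ?thesis using that[of "Suc A"] by blast
qed

end

subsection \<open>The lower bound\<close>

text \<open>The points of \<open>Z\<close> interlace with \<open>Y\<close>, one in each gap
  including both ends; uncountability of intervals allows \<open>C\<close> to be avoided. The
  induction adds the greatest element of \<open>Y\<close> and one new point above it.\<close>

lemma separated_choice:
  fixes Y C :: "real set"
  assumes "finite Y" "Y \<subseteq> {l<..<u}" "l < u" "countable C"
  obtains Z where "finite Z" "Z \<subseteq> {l<..<u} - C" "card Z = Suc (card Y)"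
    "\<forall>z\<in>Z. \<forall>z'\<in>Z. z < z' \<longrightarrow> (\<exists>y\<in>Y. z < y \<and> y < z')"
proof -
  have pick: "\<exists>z. z \<in> {a<..<b} - C" if "a < b" for a b
  proof (rule ccontr)
    assume "\<nexists>z. z \<in> {a<..<b} - C"
    then have "{a<..<b} \<subseteq> C" by blast
    then show False using assms(4) that countable_subset uncountable_open_interval by blast
  qed
  have "\<exists>Z. finite Z \<and> Z \<subseteq> {l<..<u} - C \<and> card Z = Suc (card Y) \<and>
     (\<forall>z\<in>Z. \<forall>z'\<in>Z. z < z' \<longrightarrow> (\<exists>y\<in>Y. z < y \<and> y < z'))"
    using assms(1,2,3)
  proof (induction arbitrary: u rule: finite_linorder_max_induct)
    case empty
    obtain z where "z \<in> {l<..<u} - C" using pick[OF empty(2)] by blast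
    then show ?case by (intro exI[of _ "{z}"]) auto
  next
    case (insert b Y)
    have "Y \<subseteq> {l<..<b}" "l < b" using insert by auto
    from insert.IH[OF this] obtain Z where Z: "finite Z" "Z \<subseteq> {l<..<b} - C" "card Z = Suc (card Y)"
      "\<forall>z\<in>Z. \<forall>z'\<in>Z. z < z' \<longrightarrow> (\<exists>y\<in>Y. z < y \<and> y < z')" by blast
    have bu: "b < u" using insert.prems by simp
    obtain z where z: "z \<in> {b<..<u} - C" using pick[OF bu] by blast
    have below: "z' < b" if "z' \<in> Z" for z' using Z(2) that by auto
    have "z \<notin> Z" using below z by force
    moreover have "b \<notin> Y" using insert.hyps by auto
    ultimately have "card (insert z Z) = Suc (card (insert b Y))" using Z insert.hyps by simp
    moreover have "insert z Z \<subseteq> {l<..<u} - C" using Z(2) z \<open>l < b\<close> bu by auto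
    moreover have "\<exists>y\<in>insert b Y. z1 < y \<and> y < z2"
      if zz: "z1 \<in> insert z Z" "z2 \<in> insert z Z" "z1 < z2" for z1 z2
    proof (cases "z2 = z")
      case True
      then have "z1 \<in> Z" using zz by auto
      then show ?thesis using below True z by auto
    next
      case False
      then have z2: "z2 \<in> Z" using zz by simp
      then have "z1 \<in> Z" using zz below[OF z2] z by auto
      then show ?thesis using Z(4) z2 zz(3) by blast
    qed
    ultimately show ?case using Z(1) by (intro exI[of _ "insert z Z"]) auto
  qed
  then show ?thesis using that by blast
qed

lemma card_le_twice_image:
  assumes fin: "finite A" and fib: "\<And>y. card {a \<in> A. f a = y} \<le> 2"
  shows "card A \<le> 2 * card (f ` A)"
proof -
  have "A = (\<Union>y\<in>f ` A. {a \<in> A. f a = y})" by blast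
  then have "card A = card (\<Union>y\<in>f ` A. {a \<in> A. f a = y})" by simp
  also have "\<dots> \<le> (\<Sum>y\<in>f ` A. card {a \<in> A. f a = y})" using fin by (intro card_UN_le) simp
  also have "\<dots> \<le> (\<Sum>y\<in>f ` A. 2)" by (intro sum_mono fib)
  finally show ?thesis by simp
qed

lemma three_elements:
  fixes A :: "nat set"
  assumes "2 < card A"
  obtains i j k where "i \<in> A" "j \<in> A" "k \<in> A" "i < j" "j < k"
proof -
  have fin: "finite A" using assms by (metis card.infinite not_less0)
  define i where "i = Min A"
  define k where "k = Max A"
  have "A \<noteq> {}" using assms by auto
  then have ik: "i \<in> A" "k \<in> A" using fin by (auto simp: i_def k_def)
  have "A - {i, k} \<noteq> {}"
  proof
    assume "A - {i, k} = {}"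
    then have "card A \<le> card {i, k}" by (intro card_mono) auto
    also have "\<dots> \<le> 2" by (simp add: card_insert_if)
    finally show False using assms by simp
  qed
  then obtain j where j: "j \<in> A" "j \<noteq> i" "j \<noteq> k" by blast
  have "i \<le> j" "j \<le> k" using fin j by (auto simp: i_def k_def)
  then show ?thesis using that[of i j k] ik j by simp
qed

context irrational_direction
begin

text \<open>A translation along \<open>\<theta>\<close> would carry a vertex to another vertex on
  the same line.\<close>

lemma Lat_nz: assumes b: "b \<in> Lat" "b \<bullet> perp \<theta> = 0" shows "b = 0"
proof -
  obtain r where r: "b = r *\<^sub>R \<theta>" using parallel_of_inner_perp_0[OF \<theta>_nz b(2)] by blast
  have v: "vs ! 0 \<in> Vert" using vertex_Vert by auto
  have "vs ! 0 + r *\<^sub>R \<theta> \<in> Vert" using Lat_Vert[OF v b(1)] r by simp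
  then have "r = 0" by (rule no_two_vertices[OF v])
  then show ?thesis using r by simp
qed

definition base :: "real^2" where "base = (SOME q. q \<in> core)"

lemma base: "base \<in> core"
  unfolding base_def using inside_nonempty by (simp add: some_in_eq)

text \<open>A transversal through \<open>base\<close>, scaled so that
  \<open>offset (start s) = s\<close>. With \<open>offset\<close> and \<open>depth\<close> it gives
  plane coordinates in which \<open>depth w\<close> is the flight time from the transversal to
  \<open>w\<close>.\<close>

definition start :: "real \<Rightarrow> real^2" where
  "start s = base + (s / (\<theta> \<bullet> \<theta>)) *\<^sub>R perp \<theta>"

definition offset :: "real^2 \<Rightarrow> real" where "offset w = (w - base) \<bullet> perp \<theta>"
definition depth :: "real^2 \<Rightarrow> real" where "depth w = (w - base) \<bullet> \<theta> / (\<theta> \<bullet> \<theta>)"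

lemma \<theta>\<theta>_pos: "0 < \<theta> \<bullet> \<theta>"
  using \<theta>_nz by simp

lemma start_offset: "start (offset w) + depth w *\<^sub>R \<theta> = w"
proof -
  have 1: "(\<theta> \<bullet> \<theta>) *\<^sub>R start (offset w) = (\<theta> \<bullet> \<theta>) *\<^sub>R base + offset w *\<^sub>R perp \<theta>"
    using \<theta>\<theta>_pos by (simp add: start_def scaleR_add_right)
  have 2: "(\<theta> \<bullet> \<theta>) *\<^sub>R (depth w *\<^sub>R \<theta>) = ((w - base) \<bullet> \<theta>) *\<^sub>R \<theta>"
    using \<theta>\<theta>_pos by (simp add: depth_def)
  have "(\<theta> \<bullet> \<theta>) *\<^sub>R (start (offset w) + depth w *\<^sub>R \<theta>) =
      (\<theta> \<bullet> \<theta>) *\<^sub>R base + offset w *\<^sub>R perp \<theta> + ((w - base) \<bullet> \<theta>) *\<^sub>R \<theta>"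
    by (simp only: scaleR_add_right 1 2)
  also have "\<dots> = (\<theta> \<bullet> \<theta>) *\<^sub>R base +
      (((w - base) \<bullet> \<theta>) *\<^sub>R \<theta> + ((w - base) \<bullet> perp \<theta>) *\<^sub>R perp \<theta>)"
    unfolding offset_def by (simp only: ac_simps)
  also have "\<dots> = (\<theta> \<bullet> \<theta>) *\<^sub>R base + (\<theta> \<bullet> \<theta>) *\<^sub>R (w - base)"
    by (simp only: perp_decomp)
  also have "\<dots> = (\<theta> \<bullet> \<theta>) *\<^sub>R w" by (simp add: scaleR_diff_right)
  finally have "(\<theta> \<bullet> \<theta>) *\<^sub>R (start (offset w) + depth w *\<^sub>R \<theta>) = (\<theta> \<bullet> \<theta>) *\<^sub>R w" .
  then show ?thesis using \<theta>\<theta>_pos by (metis less_irrefl scaleR_left_imp_eq)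
qed

lemma offset_start: "offset (start s + t *\<^sub>R \<theta>) = s"
  using \<theta>\<theta>_pos by (simp add: offset_def start_def inner_add_left)

lemma start_combo: "(1 - u) *\<^sub>R start s + u *\<^sub>R start s' = start ((1 - u) * s + u * s')"
  by (simp add: start_def algebra_simps add_divide_distrib diff_divide_distrib)

definition width :: real where
  "width = (SOME e. 0 < e \<and> (\<forall>s. \<bar>s\<bar> < e \<longrightarrow> start s \<in> core))"

lemma width: "0 < width" "\<And>s. \<bar>s\<bar> < width \<Longrightarrow> start s \<in> core"
proof -
  obtain r where r: "0 < r" "ball base r \<subseteq> core"
    using base open_inside_outline open_contains_ball by metis
  have n: "0 < norm \<theta>" using \<theta>_nz by simp
  have "start s \<in> core" if "\<bar>s\<bar> < r * norm \<theta>" for s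
  proof -
    have "dist base (start s) = \<bar>s\<bar> / (\<theta> \<bullet> \<theta>) * norm \<theta>"
      by (simp add: start_def dist_norm)
    also have "\<dots> = \<bar>s\<bar> / norm \<theta>" using n by (simp add: dot_square_norm power2_eq_square)
    also have "\<dots> < r" using that n by (simp add: pos_divide_less_eq)
    finally show ?thesis using r by auto
  qed
  then have "\<exists>e. 0 < e \<and> (\<forall>s. \<bar>s\<bar> < e \<longrightarrow> start s \<in> core)"
    using r n by (intro exI[of _ "r * norm \<theta>"]) simp
  then have "0 < width \<and> (\<forall>s. \<bar>s\<bar> < width \<longrightarrow> start s \<in> core)"
    unfolding width_def by (rule someI_ex)
  then show "0 < width" "\<And>s. \<bar>s\<bar> < width \<Longrightarrow> start s \<in> core" by auto
qed

lemma inj_offset: "inj_on offset Vert"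
proof (rule inj_onI)
  fix w w' assume w: "w \<in> Vert" "w' \<in> Vert" "offset w = offset w'"
  have "w + (depth w' - depth w) *\<^sub>R \<theta> = start (offset w) + depth w *\<^sub>R \<theta> + (depth w' - depth w) *\<^sub>R \<theta>"
    by (simp only: start_offset)
  also have "\<dots> = start (offset w') + depth w' *\<^sub>R \<theta>" using w(3) by (simp add: algebra_simps)
  finally have e: "w + (depth w' - depth w) *\<^sub>R \<theta> = w'" by (simp only: start_offset)
  then have "depth w' - depth w = 0" using no_two_vertices[OF w(1)] w(2) by metis
  then show "w = w'" using e by simp
qed

lemma strip_offsets:
  obtains t\<^sub>0 \<tau> where "0 < t\<^sub>0" "0 < \<tau>"
    "\<And>K. \<exists>W\<subseteq>Vert. finite W \<and> card (offset ` W) = K \<and>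
       (\<forall>w\<in>W. \<bar>offset w\<bar> < width \<and> 0 < depth w \<and> depth w \<le> t\<^sub>0 + real K * \<tau>)"
proof -
  obtain R where R: "\<And>p. \<exists>b\<in>Lat. dist p b \<le> R" by (rule Lat_dense) blast
  have v: "vs ! 0 \<in> Vert" using vertex_Vert by auto
  obtain t0 \<tau> where t: "0 < t0" "0 < \<tau>"
    "\<And>K. \<exists>W\<subseteq>Vert. finite W \<and> card W = K \<and>
       (\<forall>w\<in>W. \<bar>(w - base) \<bullet> perp \<theta>\<bar> < width \<and> 0 < (w - base) \<bullet> \<theta> \<and> (w - base) \<bullet> \<theta> \<le> t0 + real K * \<tau>)"
  proof (rule strip_points[of Lat R \<theta> width "vs ! 0" Vert base])
    show "\<forall>a\<in>Lat. \<forall>b\<in>Lat. a - b \<in> Lat" using Lat_diff by blast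
    show "\<forall>p. \<exists>b\<in>Lat. dist p b \<le> R" using R by blast
    show "\<forall>b\<in>Lat. b \<bullet> perp \<theta> = 0 \<longrightarrow> b = 0" using Lat_nz by blast
    show "\<forall>a\<in>Vert. \<forall>b\<in>Lat. a + b \<in> Vert" using Lat_Vert by blast
  qed (use \<theta>_nz width(1) v in auto)
  let ?n = "\<theta> \<bullet> \<theta>"
  show ?thesis
  proof (rule that[of "t0 / ?n" "\<tau> / ?n"])
    fix K
    obtain W where W: "W \<subseteq> Vert" "finite W" "card W = K"
      "\<And>w. w \<in> W \<Longrightarrow> \<bar>(w - base) \<bullet> perp \<theta>\<bar> < width \<and> 0 < (w - base) \<bullet> \<theta> \<and> (w - base) \<bullet> \<theta> \<le> t0 + real K * \<tau>"
      using t(3)[of K] by blast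
    have "card (offset ` W) = K" using W(1,3) inj_offset inj_on_subset by (metis card_image)
    moreover have "\<bar>offset w\<bar> < width \<and> 0 < depth w \<and> depth w \<le> t0 / ?n + real K * (\<tau> / ?n)" if "w \<in> W" for w
    proof -
      have "depth w \<le> (t0 + real K * \<tau>) / ?n" unfolding depth_def
        using W(4)[OF that] \<theta>\<theta>_pos by (intro divide_right_mono) auto
      then show ?thesis using W(4)[OF that] \<theta>\<theta>_pos by (simp add: offset_def depth_def add_divide_distrib)
    qed
    ultimately show "\<exists>W\<subseteq>Vert. finite W \<and> card (offset ` W) = K \<and>
       (\<forall>w\<in>W. \<bar>offset w\<bar> < width \<and> 0 < depth w \<and> depth w \<le> t0 / ?n + real K * (\<tau> / ?n))"
      using W(1,2) by blast
  qed (use t \<theta>\<theta>_pos in auto)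
qed

text \<open>The heights over \<open>start s\<close> from which the line meets a horizontal unfolded
  edge at some time, past or future.\<close>

definition bad_heights :: "real \<Rightarrow> real set" where
  "bad_heights s = {z. \<exists>t. start s + t *\<^sub>R \<theta> \<in> Skel \<and> (\<exists>k::int. z + t * c = of_int k * h)}"

lemma generic_avoids_grid:
  assumes "s \<notin> offset ` Vert" "z \<notin> bad_heights s"
  shows "(start s, z) + t *\<^sub>R (\<theta>, c) \<notin> grid"
proof
  assume "(start s, z) + t *\<^sub>R (\<theta>, c) \<in> grid"
  then have "(start s + t *\<^sub>R \<theta>, z + t * c) \<in> grid" by simp
  then consider "start s + t *\<^sub>R \<theta> \<in> Skel" "\<exists>k::int. z + t * c = of_int k * h" | "start s + t *\<^sub>R \<theta> \<in> Vert"
    unfolding mem_grid by blast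
  then show False
  proof cases
    case 1 then show False using assms(2) unfolding bad_heights_def by blast
  next
    case 2
    then have "s \<in> offset ` Vert" by (rule rev_image_eqI) (simp only: offset_start)
    then show False using assms(1) by simp
  qed
qed

text \<open>Two meetings of the planar line with one side would put both endpoints of the side,
  which are vertices, on the line; the choice of \<open>s\<close> forbids this. So each of the
  countably many sides is met at most once, and each meeting spoils countably many heights.\<close>

lemma countable_bad_heights:
  assumes s: "s \<notin> offset ` Vert" shows "countable (bad_heights s)"
proof -
  have nV: "start s + t *\<^sub>R \<theta> \<notin> Vert" for t
  proof
    assume "start s + t *\<^sub>R \<theta> \<in> Vert"
    then have "s \<in> offset ` Vert" by (rule rev_image_eqI) (simp only: offset_start)
    then show False using s by simp
  qed
  define T where "T \<gamma> i = {t. start s + t *\<^sub>R \<theta> \<in> \<gamma> ` side vs i}" for \<gamma> i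
  have one: "t = t'" if \<gamma>: "\<gamma> \<in> PU" "i < nv" and t: "t \<in> T \<gamma> i" "t' \<in> T \<gamma> i" for \<gamma> i t t'
  proof (rule ccontr)
    assume ne: "t \<noteq> t'"
    define A where "A = \<gamma> (vs ! i)"
    define B where "B = \<gamma> (next_vertex vs i)"
    have im: "\<gamma> ` side vs i = closed_segment A B"
      unfolding side_def A_def B_def by (rule rigid_segment[OF PU_rigid[OF \<gamma>(1)]])
    have "start s + t *\<^sub>R \<theta> \<in> closed_segment A B" using t(1) by (simp only: T_def im mem_Collect_eq)
    then obtain a where a: "start s + t *\<^sub>R \<theta> = (1 - a) *\<^sub>R A + a *\<^sub>R B" by (auto simp: in_segment)
    have "start s + t' *\<^sub>R \<theta> \<in> closed_segment A B" using t(2) by (simp only: T_def im mem_Collect_eq)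
    then obtain b where b: "start s + t' *\<^sub>R \<theta> = (1 - b) *\<^sub>R A + b *\<^sub>R B" by (auto simp: in_segment)
    have d: "(t' - t) *\<^sub>R \<theta> = (b - a) *\<^sub>R (B - A)"
    proof -
      have "(t' - t) *\<^sub>R \<theta> = (start s + t' *\<^sub>R \<theta>) - (start s + t *\<^sub>R \<theta>)" by (simp add: algebra_simps)
      also have "\<dots> = (b - a) *\<^sub>R (B - A)" unfolding a b by (simp add: algebra_simps)
      finally show ?thesis .
    qed
    have "b \<noteq> a" using d ne \<theta>_nz by auto
    define r where "r = a / (b - a)"
    have "A = (start s + t *\<^sub>R \<theta>) - a *\<^sub>R (B - A)" unfolding a by (simp add: algebra_simps)
    also have "a *\<^sub>R (B - A) = r *\<^sub>R ((b - a) *\<^sub>R (B - A))" using \<open>b \<noteq> a\<close> by (simp add: r_def)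
    also have "\<dots> = (r * (t' - t)) *\<^sub>R \<theta>" unfolding d[symmetric] by simp
    finally have "A = start s + (t - r * (t' - t)) *\<^sub>R \<theta>" by (simp add: algebra_simps)
    moreover have "A \<in> Vert" unfolding A_def
      by (rule Vert_image[OF \<gamma>(1) subsetD[OF vertex_Vert nth_mem[OF \<gamma>(2)]]])
    ultimately show False using nV by metis
  qed
  have cT: "countable (T \<gamma> i)" if "\<gamma> \<in> PU" "i < nv" for \<gamma> i
  proof (cases "T \<gamma> i = {}")
    case False
    then obtain t where "t \<in> T \<gamma> i" by blast
    then have "T \<gamma> i \<subseteq> {t}" using one[OF that] by blast
    then show ?thesis using countable_subset by blast
  qed simp
  have c1: "countable (\<Union>\<gamma>\<in>PU. \<Union>i\<in>{..<nv}. T \<gamma> i)"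
    using countable_PU cT by (intro countable_UN) auto
  have "bad_heights s \<subseteq> (\<lambda>(t, k). of_int k * h - t * c) ` ((\<Union>\<gamma>\<in>PU. \<Union>i\<in>{..<nv}. T \<gamma> i) \<times> (UNIV :: int set))"
  proof
    fix z assume "z \<in> bad_heights s"
    then obtain t and k :: int where t: "start s + t *\<^sub>R \<theta> \<in> Skel" "z + t * c = of_int k * h"
      unfolding bad_heights_def by blast
    from t(1) have "t \<in> (\<Union>\<gamma>\<in>PU. \<Union>i\<in>{..<nv}. T \<gamma> i)" unfolding Skel_def outline_def T_def by blast
    then show "z \<in> (\<lambda>(t, k). of_int k * h - t * c) ` ((\<Union>\<gamma>\<in>PU. \<Union>i\<in>{..<nv}. T \<gamma> i) \<times> (UNIV :: int set))"
      using t(2) by (intro image_eqI[of _ _ "(t, k)"]) auto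
  qed
  moreover have "countable ((\<lambda>(t, k). of_int k * h - t * c) ` ((\<Union>\<gamma>\<in>PU. \<Union>i\<in>{..<nv}. T \<gamma> i) \<times> (UNIV :: int set)))"
    using c1 by simp
  ultimately show ?thesis using countable_subset by blast
qed

text \<open>The heights at which a trajectory over \<open>start s\<close> hits an edge in a bottom or top. By
  \<open>three_hits\<close> no height occurs for three well separated times.\<close>

lemma cut_heights:
  obtains Y where "finite Y" "Y \<subseteq> {0<..<h}" "m \<le> 2 * Suc (card Y)"
    "\<And>y. y \<in> Y \<Longrightarrow> \<exists>t. 0 \<le> t \<and> t \<le> (2 * real m + 1) * (diam / norm \<theta>) \<and> (start s, y) + t *\<^sub>R (\<theta>, c) \<in> grid"
proof -
  define \<delta> where "\<delta> = diam / norm \<theta>"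
  have \<delta>: "0 < \<delta>" using \<theta>_nz diam_pos by (simp add: \<delta>_def)
  \<comment> \<open>Only every second window of length \<open>\<delta>\<close> is used, so that
    times from different windows are at least \<open>\<delta>\<close> apart, as
    \<open>three_hits\<close> requires.\<close>
  have "\<exists>t. 2 * real j * \<delta> \<le> t \<and> t \<le> 2 * real j * \<delta> + \<delta> \<and> start s + t *\<^sub>R \<theta> \<in> Skel" for j :: nat
    using skel_time[of "2 * real j * \<delta>" "start s"] unfolding \<delta>_def by blast
  then obtain t where t: "\<And>j::nat. 2 * real j * \<delta> \<le> t j" "\<And>j. t j \<le> 2 * real j * \<delta> + \<delta>" "\<And>j. start s + t j *\<^sub>R \<theta> \<in> Skel"
    by metis
  have gap: "t i + \<delta> \<le> t j" if "i < j" for i j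
  proof -
    have "2 * real i * \<delta> + \<delta> + \<delta> \<le> 2 * real j * \<delta>"
    proof -
      have "real i + 1 \<le> real j" using that by simp
      then have "(real i + 1) * (2 * \<delta>) \<le> real j * (2 * \<delta>)" using \<delta> by (intro mult_right_mono) auto
      then show ?thesis by (simp add: algebra_simps)
    qed
    then show ?thesis using t(1)[of j] t(2)[of i] by linarith
  qed
  \<comment> \<open>The level for which the corresponding starting height \<open>f j\<close> falls
    into \<open>[0, h)\<close>.\<close>
  define k where "k j = \<lceil>t j * c / h\<rceil>" for j
  define f where "f j = of_int (k j) * h - t j * c" for j
  have f: "0 \<le> f j \<and> f j < h" for j
  proof -
    have "t j * c / h \<le> of_int (k j)" "of_int (k j) < t j * c / h + 1" unfolding k_def by linarith+
    then have "t j * c \<le> of_int (k j) * h" "of_int (k j) * h < (t j * c / h + 1) * h"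
      using height_pos by (simp_all add: pos_divide_le_eq)
    then show ?thesis using height_pos by (simp add: f_def algebra_simps)
  qed
  have "card {j \<in> {..<m}. f j = y} \<le> 2" for y
  proof (rule ccontr)
    assume "\<not> card {j \<in> {..<m}. f j = y} \<le> 2"
    then have "2 < card {j \<in> {..<m}. f j = y}" by simp
    then obtain i j l where ijl: "f i = y" "f j = y" "f l = y" "i < j" "j < l"
      by (rule three_elements) blast
    have z: "y + t i * c = of_int (k i) * h" "y + t j * c = of_int (k j) * h" "y + t l * c = of_int (k l) * h"
      using ijl(1-3) by (auto simp: f_def)
    show False
      by (rule three_hits[OF t(3)[of i] t(3)[of j] t(3)[of l] z]) (use gap ijl in \<open>simp_all add: \<delta>_def[symmetric]\<close>)
  qed
  then have "card {..<m} \<le> 2 * card (f ` {..<m})" by (intro card_le_twice_image) auto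
  then have m: "m \<le> 2 * card (f ` {..<m})" by simp
  \<comment> \<open>Height 0 is not an interior height; dropping it costs at most one element,
    whence the \<open>Suc\<close> in the count.\<close>
  define Y where "Y = f ` {..<m} - {0}"
  have finY: "finite Y" by (simp add: Y_def)
  have "card (f ` {..<m}) \<le> Suc (card Y)"
  proof -
    have "f ` {..<m} \<subseteq> insert 0 Y" by (auto simp: Y_def)
    then have "card (f ` {..<m}) \<le> card (insert 0 Y)" using finY by (intro card_mono) auto
    also have "\<dots> \<le> Suc (card Y)" by (rule card_insert_le_m1) (simp_all add: finY)
    finally show ?thesis .
  qed
  then have "2 * card (f ` {..<m}) \<le> 2 * Suc (card Y)" by (rule mult_left_mono) simp
  with m have mY: "m \<le> 2 * Suc (card Y)" by (rule order_trans)
  have Yi: "Y \<subseteq> {0<..<h}"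
  proof
    fix y assume "y \<in> Y"
    then obtain j where "y = f j" "y \<noteq> 0" by (auto simp: Y_def)
    then show "y \<in> {0<..<h}" using f[of j] by simp
  qed
  have hits: "\<exists>r. 0 \<le> r \<and> r \<le> (2 * real m + 1) * \<delta> \<and> (start s, y) + r *\<^sub>R (\<theta>, c) \<in> grid" if "y \<in> Y" for y
  proof -
    obtain j where j: "j < m" "y = f j" using \<open>y \<in> Y\<close> by (auto simp: Y_def)
    have "0 \<le> 2 * real j * \<delta>" using \<delta> by simp
    then have "0 \<le> t j" using t(1)[of j] by linarith
    moreover have "t j \<le> (2 * real m + 1) * \<delta>"
    proof -
      have "2 * real j * \<delta> \<le> 2 * real m * \<delta>" using j \<delta> by (intro mult_right_mono) auto
      then show ?thesis using t(2)[of j] by (simp add: algebra_simps)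
    qed
    moreover have "(start s, y) + t j *\<^sub>R (\<theta>, c) \<in> grid"
    proof -
      have "y + t j * c = of_int (k j) * h" by (simp add: j f_def)
      then show ?thesis using t(3)[of j] by (auto simp: mem_grid)
    qed
    ultimately show ?thesis by blast
  qed
  show ?thesis using that[OF finY Yi mY] hits unfolding \<delta>_def by blast
qed

definition generic :: "real \<Rightarrow> real \<Rightarrow> bool" where
  "generic s z \<longleftrightarrow> \<bar>s\<bar> < width \<and> s \<notin> offset ` Vert \<and> 0 < z \<and> z < h \<and> z \<notin> bad_heights s"

lemma generic_orbit:
  assumes "generic s z"
  obtains x t where "0 < t" "billiard_orbit vs h x" "x 0 = ((start s, z) - t *\<^sub>R (\<theta>, c), (\<theta>, c))"
proof (rule orbit_through_interior[of "(start s, z)" "(\<theta>, c)"])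
  show "(start s, z) \<in> interior P" using assms width(2) by (simp add: generic_def mem_interior_P)
  show "(\<theta>, c) \<noteq> 0" using \<theta>_nz by (simp add: zero_prod_def)
  show "(start s, z) + t *\<^sub>R (\<theta>, c) \<notin> grid" for t
    using assms by (intro generic_avoids_grid) (auto simp: generic_def)
qed (rule that)

text \<open>A chosen orbit through the point over \<open>start s\<close> at height \<open>z\<close>,
  together with the time it needs from its state at index 0 to that point.\<close>

definition orb :: "real \<times> real \<Rightarrow> (int \<Rightarrow> state) \<times> real" where
  "orb sz = (SOME xt. 0 < snd xt \<and> billiard_orbit vs h (fst xt) \<and>
     fst xt 0 = ((start (fst sz), snd sz) - snd xt *\<^sub>R (\<theta>, c), (\<theta>, c)))"

lemma orb:
  assumes "generic s z"
  shows "0 < snd (orb (s, z))" "billiard_orbit vs h (fst (orb (s, z)))"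
    "fst (orb (s, z)) 0 = ((start s, z) - snd (orb (s, z)) *\<^sub>R (\<theta>, c), (\<theta>, c))"
proof -
  have "\<exists>xt. 0 < snd xt \<and> billiard_orbit vs h (fst xt) \<and>
     fst xt 0 = ((start (fst (s, z)), snd (s, z)) - snd xt *\<^sub>R (\<theta>, c), (\<theta>, c))"
    using generic_orbit[OF assms] by (metis fst_conv snd_conv)
  from someI_ex[OF this]
  have "0 < snd (orb (s, z)) \<and> billiard_orbit vs h (fst (orb (s, z))) \<and>
     fst (orb (s, z)) 0 = ((start (fst (s, z)), snd (s, z)) - snd (orb (s, z)) *\<^sub>R (\<theta>, c), (\<theta>, c))"
    unfolding orb_def .
  then show "0 < snd (orb (s, z))" "billiard_orbit vs h (fst (orb (s, z)))"
    "fst (orb (s, z)) 0 = ((start s, z) - snd (orb (s, z)) *\<^sub>R (\<theta>, c), (\<theta>, c))" by simp_all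
qed

text \<open>Reading starts at index 1, the first hit after the interior point; the face at index 0
  lies behind that point.\<close>

definition word :: "nat \<Rightarrow> real \<times> real \<Rightarrow> face list" where
  "word n sz = map (\<lambda>i. face_at (fst (orb sz)) (1 + int i)) [0..<n]"

lemma word_in_language:
  assumes "generic s z" shows "word n (s, z) \<in> billiard_language vs h n (\<theta>, c)"
  unfolding language_eq word_def using orb[OF assms] by force

text \<open>Hit times count from the boundary state, while \<open>t\<close> counts from the interior
  point; the difference is less than \<open>pdiam\<close>, which explains the margin in
  \<open>t + pdiam \<le> T\<close>.\<close>

lemma same_word:
  assumes g: "generic s z" "generic s' z'" and w: "word n (s, z) = word n (s', z')"
    and u: "0 \<le> u" "u \<le> 1" and t: "0 \<le> t" "t + pdiam \<le> T"
    and T: "\<forall>x. billiard_orbit vs h x \<longrightarrow> norm (snd (x 0)) = 1 \<longrightarrow> T < hit x 0 n"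
  shows "(start ((1 - u) * s + u * s'), (1 - u) * z + u * z') + t *\<^sub>R (\<theta>, c) \<notin> grid"
proof -
  note o = orb[OF g(1)] and o' = orb[OF g(2)]
  have i: "(start s, z) \<in> interior P" "(start s', z') \<in> interior P"
    using g width(2) by (auto simp: generic_def mem_interior_P)
  have d: "norm (snd (fst (orb (s, z)) 0)) = 1" "norm (snd (fst (orb (s', z')) 0)) = 1"
    using o(3) o'(3) unit by simp_all
  have early: "snd (orb (r, y)) < pdiam" if "generic r y" for r y
  proof -
    note p = orb[OF that]
    have n1: "norm (snd (fst (orb (r, y)) 0)) = 1" using p(3) unit by simp
    have "(start r, y) \<in> interior P" using that width(2) by (simp add: generic_def mem_interior_P)
    then have "snd (orb (r, y)) < hit (fst (orb (r, y))) 0 1"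
      by (rule interior_before_first_hit[OF p(2) n1 p(3) _ p(1)])
    also have "\<dots> \<le> pdiam" using hit_le[OF p(2) n1, of 0 1] by simp
    finally show ?thesis .
  qed
  have "(1 - u) *\<^sub>R (start s, z) + u *\<^sub>R (start s', z') + t *\<^sub>R (\<theta>, c) \<notin> grid"
  proof (rule same_word_misses_grid[OF o(2,3,1) i(1) o'(2,3,1) i(2) unit _ u t(1), of n])
    fix i assume i: "i < n"
    have "word n (s, z) ! i = word n (s', z') ! i" using w by simp
    then show "face_at (fst (orb (s, z))) (int i + 1) = face_at (fst (orb (s', z'))) (int i + 1)"
      using i by (simp add: word_def add.commute)
  next
    show "t \<le> hit (fst (orb (s, z))) 0 n - snd (orb (s, z))"
      using T[rule_format, OF o(2) d(1)] early[OF g(1)] t(2) by linarith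
    show "t \<le> hit (fst (orb (s', z'))) 0 n - snd (orb (s', z'))"
      using T[rule_format, OF o'(2) d(2)] early[OF g(2)] t(2) by linarith
  qed
  then show ?thesis using start_combo by simp
qed

text \<open>The words are indexed by pairs of an offset and a height. Different offsets are
  separated by a vertical edge over a vertex of \<open>W\<close>; equal offsets with different
  heights are separated by a horizontal edge from \<open>cut_heights\<close>.\<close>

lemma many_words:
  assumes T: "\<forall>x. billiard_orbit vs h x \<longrightarrow> norm (snd (x 0)) = 1 \<longrightarrow> T < hit x 0 n"
    and W: "W \<subseteq> Vert" "finite W" "\<And>w. w \<in> W \<Longrightarrow> \<bar>offset w\<bar> < width \<and> 0 < depth w \<and> depth w + pdiam \<le> T"
    and m: "(2 * real m + 1) * (diam / norm \<theta>) + pdiam \<le> T"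
  shows "Suc (card (offset ` W)) * m \<le> 2 * card (billiard_language vs h n (\<theta>, c))"
proof -
  have finO: "finite (offset ` W)" using W by simp
  have subO: "offset ` W \<subseteq> {- width<..<width}"
  proof
    fix y assume "y \<in> offset ` W"
    then have "\<bar>y\<bar> < width" using W(3) by blast
    then show "y \<in> {- width<..<width}" by auto
  qed
  have ww: "- width < width" using width(1) by simp
  have cV: "countable (offset ` Vert)" using countable_Vert by simp
  obtain S where S: "finite S" "S \<subseteq> {- width<..<width} - offset ` Vert" "card S = Suc (card (offset ` W))"
    "\<forall>s\<in>S. \<forall>s'\<in>S. s < s' \<longrightarrow> (\<exists>y\<in>offset ` W. s < y \<and> y < s')"
    by (rule separated_choice[OF finO subO ww cV])
  define Q where "Q s Z \<longleftrightarrow> finite Z \<and> (\<forall>z\<in>Z. generic s z) \<and> m \<le> 2 * card Z \<and>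
     (\<forall>z\<in>Z. \<forall>z'\<in>Z. z < z' \<longrightarrow> (\<exists>y t. z < y \<and> y < z' \<and> 0 \<le> t \<and> t + pdiam \<le> T \<and> (start s, y) + t *\<^sub>R (\<theta>, c) \<in> grid))" for s Z
  have "\<exists>Z. Q s Z" if s: "s \<in> S" for s
  proof -
    have "s \<in> {- width<..<width} - offset ` Vert" using S(2) s by blast
    then have sg: "\<bar>s\<bar> < width" "s \<notin> offset ` Vert" by auto
    obtain Y where Y: "finite Y" "Y \<subseteq> {0<..<h}" "m \<le> 2 * Suc (card Y)"
      "\<And>y. y \<in> Y \<Longrightarrow> \<exists>t. 0 \<le> t \<and> t \<le> (2 * real m + 1) * (diam / norm \<theta>) \<and> (start s, y) + t *\<^sub>R (\<theta>, c) \<in> grid"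
      by (rule cut_heights[of m s]) blast
    obtain Z where Z: "finite Z" "Z \<subseteq> {0<..<h} - bad_heights s" "card Z = Suc (card Y)"
      "\<forall>z\<in>Z. \<forall>z'\<in>Z. z < z' \<longrightarrow> (\<exists>y\<in>Y. z < y \<and> y < z')"
      by (rule separated_choice[OF Y(1,2) height_pos countable_bad_heights[OF sg(2)]])
    have "\<forall>z\<in>Z. generic s z" using Z(2) sg by (auto simp: generic_def)
    moreover have "\<exists>y t. z < y \<and> y < z' \<and> 0 \<le> t \<and> t + pdiam \<le> T \<and> (start s, y) + t *\<^sub>R (\<theta>, c) \<in> grid"
      if zz: "z \<in> Z" "z' \<in> Z" "z < z'" for z z'
    proof -
      obtain y where y: "y \<in> Y" "z < y" "y < z'" using Z(4) zz by blast
      obtain t where t: "0 \<le> t" "t \<le> (2 * real m + 1) * (diam / norm \<theta>)" "(start s, y) + t *\<^sub>R (\<theta>, c) \<in> grid"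
        using Y(4)[OF y(1)] by blast
      have "t + pdiam \<le> T" using t(2) m by linarith
      then show ?thesis using y t by blast
    qed
    ultimately show ?thesis using Z(1,3) Y(3) unfolding Q_def by (intro exI[of _ Z]) simp
  qed
  then have "\<forall>s. \<exists>Z. s \<in> S \<longrightarrow> Q s Z" by blast
  then obtain Z where "\<forall>s. s \<in> S \<longrightarrow> Q s (Z s)" by (rule exE[OF choice])
  then have Z: "\<And>s. s \<in> S \<Longrightarrow> finite (Z s)" "\<And>s z. s \<in> S \<Longrightarrow> z \<in> Z s \<Longrightarrow> generic s z"
    "\<And>s. s \<in> S \<Longrightarrow> m \<le> 2 * card (Z s)"
    "\<And>s z z'. s \<in> S \<Longrightarrow> z \<in> Z s \<Longrightarrow> z' \<in> Z s \<Longrightarrow> z < z' \<Longrightarrow>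
       \<exists>y t. z < y \<and> y < z' \<and> 0 \<le> t \<and> t + pdiam \<le> T \<and> (start s, y) + t *\<^sub>R (\<theta>, c) \<in> grid"
    unfolding Q_def by blast+
  have combo: "\<exists>u. 0 \<le> u \<and> u \<le> 1 \<and> (1 - u) * a + u * b = y" if "a < y" "y < b" for a b y :: real
  proof -
    have "y \<in> closed_segment a b" using that by (simp add: closed_segment_eq_real_ivl)
    then show ?thesis by (auto simp: in_segment)
  qed
  have ne1: False if s: "s \<in> S" "s' \<in> S" "s < s'" and z: "z \<in> Z s" "z' \<in> Z s'" and w: "word n (s, z) = word n (s', z')" for s s' z z'
  proof -
    obtain v where v: "v \<in> W" "s < offset v" "offset v < s'" using S(4) s by blast
    \<comment> \<open>The mixture lies exactly over the line through \<open>v\<close>. Its height is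
      uncontrolled but irrelevant, since \<open>grid\<close> contains the full vertical line over
      \<open>v\<close>.\<close>
    obtain u where u: "0 \<le> u" "u \<le> 1" "(1 - u) * s + u * s' = offset v" using combo[OF v(2,3)] by blast
    have "0 \<le> depth v" "depth v + pdiam \<le> T" using W(3)[OF v(1)] by auto
    from same_word[OF Z(2)[OF s(1) z(1)] Z(2)[OF s(2) z(2)] w u(1,2) this T]
    have "(start (offset v), (1 - u) * z + u * z') + depth v *\<^sub>R (\<theta>, c) \<notin> grid"
      unfolding u(3) .
    moreover have "(start (offset v), (1 - u) * z + u * z') + depth v *\<^sub>R (\<theta>, c) = (v, (1 - u) * z + u * z' + depth v * c)"
      using start_offset[of v] by simp
    moreover have "v \<in> Vert" using v W(1) by blast
    ultimately show False by (simp add: mem_grid)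
  qed
  have ne2: False if s: "s \<in> S" and z: "z \<in> Z s" "z' \<in> Z s" "z < z'" and w: "word n (s, z) = word n (s, z')" for s z z'
  proof -
    obtain y t where y: "z < y" "y < z'" "0 \<le> t" "t + pdiam \<le> T" "(start s, y) + t *\<^sub>R (\<theta>, c) \<in> grid"
      using Z(4)[OF s z] by blast
    obtain u where u: "0 \<le> u" "u \<le> 1" "(1 - u) * z + u * z' = y" using combo[OF y(1,2)] by blast
    have "(1 - u) * s + u * s = s" by (simp add: algebra_simps)
    with same_word[OF Z(2)[OF s z(1)] Z(2)[OF s z(2)] w u(1,2) y(3,4) T] u(3) y(5) show False by simp
  qed
  let ?D = "SIGMA s:S. Z s"
  have inj: "inj_on (word n) ?D"
  proof (rule inj_onI)
    fix p p' assume p: "p \<in> ?D" "p' \<in> ?D" "word n p = word n p'"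
    obtain s z where sz: "p = (s, z)" by (cases p)
    obtain s' z' where sz': "p' = (s', z')" by (cases p')
    have m: "s \<in> S" "s' \<in> S" "z \<in> Z s" "z' \<in> Z s'" using p by (auto simp: sz sz')
    have w: "word n (s, z) = word n (s', z')" using p by (simp add: sz sz')
    have "s = s'" using ne1[OF m(1,2) _ m(3,4) w] ne1[OF m(2,1) _ m(4,3) w[symmetric]] by (meson linorder_neqE_linordered_idom)
    moreover from this have "z = z'" using ne2[OF m(1,3)] ne2[OF m(2,4)] m w by (metis linorder_neqE_linordered_idom)
    ultimately show "p = p'" by (simp add: sz sz')
  qed
  have "card S * m = (\<Sum>s\<in>S. m)" by simp
  also have "\<dots> \<le> (\<Sum>s\<in>S. 2 * card (Z s))" using Z(3) by (intro sum_mono) auto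
  also have "\<dots> = 2 * card ?D" using S(1) Z(1) by (simp add: card_SigmaI sum_distrib_left)
  also have "card ?D = card (word n ` ?D)" by (simp add: card_image[OF inj])
  also have "\<dots> \<le> card (billiard_language vs h n (\<theta>, c))"
    using word_in_language Z(2) by (intro card_mono finite_language) auto
  finally show ?thesis using S(3) by simp
qed

text \<open>Covers the small \<open>n\<close> for which the quadratic count is not yet
  effective.\<close>

lemma language_nonempty: "0 < card (billiard_language vs h n (\<theta>, c))"
proof -
  have ww: "- width < width" using width(1) by simp
  obtain S where S: "S \<subseteq> {- width<..<width} - offset ` Vert" "card S = Suc (card ({} :: real set))"
    by (rule separated_choice[OF finite.emptyI empty_subsetI ww, of "offset ` Vert"]) (use countable_Vert in auto)
  then obtain s where s: "s \<in> S" by (metis card.empty ex_in_conv nat.distinct(1))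
  then have "s \<in> {- width<..<width} - offset ` Vert" using S(1) by blast
  then have sg: "\<bar>s\<bar> < width" "s \<notin> offset ` Vert" by auto
  obtain Z where Z: "Z \<subseteq> {0<..<h} - bad_heights s" "card Z = Suc (card ({} :: real set))"
    by (rule separated_choice[OF finite.emptyI empty_subsetI height_pos countable_bad_heights[OF sg(2)]]) blast
  then obtain z where z: "z \<in> Z" by (metis card.empty ex_in_conv nat.distinct(1))
  have "generic s z" using Z(1) z sg by (auto simp: generic_def)
  then show ?thesis using word_in_language finite_language by (metis card_gt_0_iff empty_iff)
qed

lemma lower_bound:
  obtains L where "0 < L" "\<And>n r. L * (r + 1) \<le> n \<Longrightarrow> (r + 1) * r \<le> 2 * card (billiard_language vs h n (\<theta>, c))"
proof -
  obtain M where M: "0 < M"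
    "\<And>x n J. billiard_orbit vs h x \<Longrightarrow> norm (snd (x 0)) = 1 \<Longrightarrow> M * (J + 1) \<le> n \<Longrightarrow> real J * pdiam < hit x 0 n"
    by (rule hit_lower_bound) blast
  obtain t0 \<tau> where t: "0 < t0" "0 < \<tau>"
    "\<And>K. \<exists>W\<subseteq>Vert. finite W \<and> card (offset ` W) = K \<and>
       (\<forall>w\<in>W. \<bar>offset w\<bar> < width \<and> 0 < depth w \<and> depth w \<le> t0 + real K * \<tau>)"
    by (rule strip_offsets) blast
  define \<delta> where "\<delta> = diam / norm \<theta>"
  have \<delta>: "0 < \<delta>" using \<theta>_nz diam_pos by (simp add: \<delta>_def)
  \<comment> \<open>Chosen so that time \<open>a * pdiam\<close> per unit of \<open>r + 1\<close>
    suffices for both the depth \<open>t0 + r * \<tau>\<close> of the vertices and the time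
    \<open>(2 * r + 1) * \<delta>\<close> of the height cuts.\<close>
  obtain a :: nat where a: "(t0 + \<tau> + 3 * \<delta>) / pdiam \<le> real a" using real_arch_simple by blast
  have ap: "t0 + \<tau> + 3 * \<delta> \<le> real a * pdiam" using a pdiam_pos by (simp add: pos_divide_le_eq)
  have "(r + 1) * r \<le> 2 * card (billiard_language vs h n (\<theta>, c))" if n: "M * (a + 2) * (r + 1) \<le> n" for n r
  proof -
    \<comment> \<open>The extra 1 provides the margin \<open>pdiam\<close>; then
      \<open>J + 1 \<le> (a + 2) * (r + 1)\<close> explains the constant
      \<open>M * (a + 2)\<close>.\<close>
    define J where "J = a * (r + 1) + 1"
    define T where "T = real J * pdiam"
    have "J + 1 \<le> (a + 2) * (r + 1)" by (simp add: J_def)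
    then have "M * (J + 1) \<le> M * ((a + 2) * (r + 1))" by (rule mult_left_mono) simp
    then have "M * (J + 1) \<le> n" using n by (simp only: mult.assoc)
    then have "T < hit x 0 n" if "billiard_orbit vs h x" "norm (snd (x 0)) = 1" for x
      unfolding T_def using M(2)[OF that] by blast
    then have T: "\<forall>x. billiard_orbit vs h x \<longrightarrow> norm (snd (x 0)) = 1 \<longrightarrow> T < hit x 0 n" by blast
    have "(t0 + \<tau> + 3 * \<delta>) * (real r + 1) \<le> (real a * pdiam) * (real r + 1)"
      using ap by (intro mult_right_mono) auto
    also have "\<dots> = T - pdiam" by (simp add: T_def J_def algebra_simps)
    finally have key: "(t0 + \<tau> + 3 * \<delta>) * (real r + 1) + pdiam \<le> T" by simp
    have nn: "0 \<le> t0 * real r" "0 \<le> \<tau> * real r" "0 \<le> \<delta> * real r" using t \<delta> by simp_all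
    have e: "(t0 + \<tau> + 3 * \<delta>) * (real r + 1) = t0 * real r + \<tau> * real r + 3 * (\<delta> * real r) + t0 + \<tau> + 3 * \<delta>"
      by (simp add: algebra_simps)
    have k1: "t0 + real r * \<tau> + pdiam \<le> T"
    proof -
      have "real r * \<tau> = \<tau> * real r" by (rule mult.commute)
      then show ?thesis using key nn t(1,2) \<delta> unfolding e by linarith
    qed
    have k2: "(2 * real r + 1) * \<delta> + pdiam \<le> T"
    proof -
      have "(2 * real r + 1) * \<delta> = 2 * (\<delta> * real r) + \<delta>" by (simp add: algebra_simps)
      then show ?thesis using key nn t \<delta> unfolding e by linarith
    qed
    obtain W where W: "W \<subseteq> Vert" "finite W" "card (offset ` W) = r"
      "\<And>w. w \<in> W \<Longrightarrow> \<bar>offset w\<bar> < width \<and> 0 < depth w \<and> depth w \<le> t0 + real r * \<tau>"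
      using t(3)[of r] by blast
    have "Suc (card (offset ` W)) * r \<le> 2 * card (billiard_language vs h n (\<theta>, c))"
    proof (rule many_words[OF T W(1,2)])
      show "\<bar>offset w\<bar> < width \<and> 0 < depth w \<and> depth w + pdiam \<le> T" if "w \<in> W" for w
        using W(4)[OF that] k1 by linarith
      show "(2 * real r + 1) * (diam / norm \<theta>) + pdiam \<le> T" using k2 by (simp only: \<delta>_def)
    qed
    then show ?thesis using W(3) by simp
  qed
  moreover have "0 < M * (a + 2)" using M(1) by simp
  ultimately show ?thesis using that by blast
qed

lemma quadratic_lower_bound:
  obtains B :: real where "0 < B" "\<And>n. 0 < n \<Longrightarrow> B * (real n)\<^sup>2 \<le> real (card (billiard_language vs h n (\<theta>, c)))"
proof -
  obtain L where L: "0 < L" "\<And>n r. L * (r + 1) \<le> n \<Longrightarrow> (r + 1) * r \<le> 2 * card (billiard_language vs h n (\<theta>, c))"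
    by (rule lower_bound) blast
  \<comment> \<open>For large \<open>n\<close> the count is at least \<open>r^2 / 2\<close> with
    \<open>n \<le> 3 * L * r\<close>, which gives the factor 18. For \<open>n < 3 * L\<close> the
    left side is below 1, and one word is enough.\<close>
  define B where "B = 1 / (18 * (real L)\<^sup>2)"
  have B: "0 < B" using L by (simp add: B_def)
  have "B * (real n)\<^sup>2 \<le> real (card (billiard_language vs h n (\<theta>, c)))" if n: "0 < n" for n
  proof (cases "n < 3 * L")
    case True
    then have "real n \<le> 3 * real L" by linarith
    then have "(real n)\<^sup>2 \<le> (3 * real L)\<^sup>2" by (intro power_mono) auto
    then have "B * (real n)\<^sup>2 \<le> B * (3 * real L)\<^sup>2" using B by (intro mult_left_mono) auto
    also have "\<dots> \<le> 1" using L(1) by (simp add: B_def power_mult_distrib)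
    also have "\<dots> \<le> real (card (billiard_language vs h n (\<theta>, c)))"
      using language_nonempty[of n] by linarith
    finally show ?thesis .
  next
    case False
    define r where "r = n div L - 1"
    have d3: "3 \<le> n div L" using False L(1) by (simp add: less_eq_div_iff_mult_less_eq)
    then have r: "r + 1 = n div L" by (simp add: r_def)
    have "L * (r + 1) \<le> n" unfolding r by simp
    then have main: "(r + 1) * r \<le> 2 * card (billiard_language vs h n (\<theta>, c))" by (rule L(2))
    have "n < L * (n div L + 1)" using L(1) by (metis add.commute mult_Suc_right Suc_eq_plus1 dividend_less_times_div)
    then have "n < L * (r + 2)" using r by (simp add: algebra_simps)
    also have "L * (r + 2) \<le> L * (3 * r)" using d3 r by (intro mult_left_mono) auto
    finally have "real n \<le> real (L * (3 * r))" by (simp only: of_nat_le_iff less_imp_le)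
    then have nr: "real n \<le> 3 * real L * real r" by simp
    have "(real n)\<^sup>2 \<le> (3 * real L * real r)\<^sup>2" using nr by (intro power_mono) auto
    then have "B * (real n)\<^sup>2 \<le> B * (3 * real L * real r)\<^sup>2" using B by (intro mult_left_mono) auto
    also have "\<dots> = (real r * real r) / 2" using L(1) by (simp add: B_def power_mult_distrib power2_eq_square)
    also have "\<dots> \<le> real (card (billiard_language vs h n (\<theta>, c)))"
    proof -
      have "r * r \<le> 2 * card (billiard_language vs h n (\<theta>, c))" using main by (simp add: algebra_simps)
      then have "real (r * r) \<le> real (2 * card (billiard_language vs h n (\<theta>, c)))" by (simp only: of_nat_le_iff)
      then show ?thesis by simp
    qed
    finally show ?thesis .
  qed
  then show ?thesis using that B by blast
qed

end

theorem theorem8: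
  fixes vs :: "(real^2) list" and h :: real and \<omega> :: space
  assumes "tiling_polygon vs" and "0 < h"
    and "norm \<omega> = 1"
    and "minimal_direction vs h \<omega>"
    and "BP_irrational vs h \<omega>"
  shows "\<exists>A>0. \<exists>B>0. \<forall>n>0.
           B \<le> real (billiard_complexity vs h n \<omega>) / (real n)\<^sup>2 \<and>
           real (billiard_complexity vs h n \<omega>) / (real n)\<^sup>2 \<le> A"
  proof -
  obtain \<theta> c where \<omega>: "\<omega> = (\<theta>, c)" by (cases \<omega>)
  interpret irrational_direction vs h \<theta> c
    using assms by unfold_locales (simp_all add: \<omega>)
  obtain A where A: "0 < A" "\<And>n. 0 < n \<Longrightarrow> card (billiard_language vs h n \<omega>) \<le> A * n\<^sup>2"
    unfolding \<omega> by (rule upper_bound) blast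
  obtain B where B: "0 < B" "\<And>n. 0 < n \<Longrightarrow> B * (real n)\<^sup>2 \<le> real (card (billiard_language vs h n \<omega>))"
    unfolding \<omega> by (rule quadratic_lower_bound) blast
  have "B \<le> real (billiard_complexity vs h n \<omega>) / (real n)\<^sup>2 \<and>
      real (billiard_complexity vs h n \<omega>) / (real n)\<^sup>2 \<le> real A" if n: "0 < n" for n
  proof -
    have "real (card (billiard_language vs h n \<omega>)) \<le> real (A * n\<^sup>2)"
      using A(2)[OF n] by (simp only: of_nat_le_iff)
    then show ?thesis
      using B(2)[OF n] n unfolding billiard_complexity_def by (simp add: pos_le_divide_eq pos_divide_le_eq)
  qed
  then show ?thesis using A(1) B(1) by (intro exI[of _ "real A"] conjI exI[of _ B]) auto
qed


end
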